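(* Let $m\ge1$, $1\le k\le n-m$. For fixed $x\in\mathfrak M_{n,m}$, let $F_x(r)=(M_rf)(x)$, $r\in\mathcal P_m$. If $f\in L^p(\mathfrak M_{n,m})$, $1\le p<(n+m-1)/(k+m-1)$, then $$(\hat f)^{\vee}_s(x)=\pi^{km/2}(I_-^{k/2}F_x)(s),\qquad s\in\mathcal P_m.$$
   Context: $\mathfrak M_{n,m}$: real $n\times m$ matrices with Lebesgue measure; $x'$ transpose; $|a|$ absolute value of the determinant of a square matrix $a$. $\mathcal P_m$: cone of positive definite symmetric $m\times m$ matrices, $dr=\prod_{i\le j}dr_{i,j}$. $\Gamma_m(\alpha)=\pi^{m(m-1)/4}\prod_{j=0}^{m-1}\Gamma(\alpha-j/2)$. $V_{n,m}=\{v\in\mathfrak M_{n,m}:v'v=I_m\}$ with $O(n)$-invariant measure $dv$ of total mass $\sigma_{n,m}=2^m\pi^{nm/2}/\Gamma_m(n/2)$. Radon transform: $\hat f(\xi,t)=\int_{\mathfrak M_{k,m}}f\left(g_\xi\begin{bmatrix}\omega\\ t\end{bmatrix}\right)d\omega$ for $\xi\in V_{n,n-k}$, $t\in\mathfrak M_{n-k,m}$, with $g_\xi\in SO(n)$ any rotation sending $\begin{bmatrix}0\\ I_{n-k}\end{bmatrix}$ to $\xi$. Shifted dual Radon transform of a function $\varphi(\xi,t)$ on $V_{n,n-k}\times\mathfrak M_{n-k,m}$ (with $\varphi(\xi\theta',\theta t)=\varphi(\xi,t)$ for all $\theta\in O(n-k)$): $\check\varphi_s(x)=\sigma_{n,n-k}^{-1}\int_{V_{n,n-k}}\varphi(\xi,\xi'x+z)\,d\xi$,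 where $z\in\mathfrak M_{n-k,m}$ is any matrix with $z'z=s$ (the result is independent of the choice of $z$). $(\hat f)^\vee_s$ is this transform applied to $\varphi=\hat f$. Matrix spherical mean: $(M_rf)(x)=\sigma_{n,m}^{-1}\int_{V_{n,m}}f(x+vr^{1/2})\,dv$, $r\in\mathcal P_m$. Right-sided Gårding–Gindikin fractional integral, $d=(m+1)/2$: $(I_-^{k/2}F)(s)=\frac1{\Gamma_m(k/2)}\int_{\{r:\,r-s\in\mathcal P_m\}}F(r)|r-s|^{k/2-d}dr$ if $k\ge m$, and $(I_-^{k/2}F)(s)=\pi^{-km/2}\int_{\mathfrak M_{k,m}}F(s+\omega'\omega)\,d\omega$ if $1\le k<m$.
   Formalization: For f in L^p the identity (with absolute convergence of both sides) is stated for almost every s in P_m instead of every s, since at single s the integrals may diverge or be undefined; for Borel f it holds at every s where either side converges absolutely. *)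

theory Defs
  imports "HOL-Analysis.Analysis"
begin

text \<open>
  The space of real $n \times m$ matrices is the type \<open>real^'m^'n\<close>, with \<open>n = CARD('n)\<close> and
  \<open>m = CARD('m)\<close>; its Lebesgue measure is the library's \<^term>\<open>lebesgue\<close>.  For the Radon
  transform the row index type is a sum \<open>'k + 'l\<close>, so that \<open>k = CARD('k)\<close>, \<open>n - k = CARD('l)\<close>,
  \<open>n = CARD('k + 'l)\<close> and vertical blocks are available without an ordering of the indices.

  All measures are completed, because a Lebesgue measurable function need not have Borel
  measurable restrictions.
\<close>

subsection \<open>Positive definite matrices\<close>

definition pos_def_matrices :: "(real^'m^'m) set" where
  "pos_def_matrices = {r. transpose r = r \<and> (\<forall>y. y \<noteq> 0 \<longrightarrow> 0 < y \<bullet> (r *v y))}"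

definition pos_def_sqrt :: "real^'m^'m \<Rightarrow> real^'m^'m" where
  "pos_def_sqrt r = (THE q. q \<in> pos_def_matrices \<and> q ** q = r)"

text \<open>
  The entries $r_{i,j}$, $i \le j$, of a symmetric matrix are indexed by the unordered pairs
  \<open>{i, j}\<close> (singletons on the diagonal), which makes an ordering of \<open>'m\<close> unnecessary.  The
  measure $dr = \prod_{i \le j} dr_{i,j}$ is regarded as a measure on all square matrices that is
  concentrated on the symmetric ones.
\<close>

definition sym_matrix :: "('m set \<Rightarrow> real) \<Rightarrow> real^'m^'m" where
  "sym_matrix c = (\<chi> i j. c {i, j})"

definition sym_lebesgue :: "(real^'m^'m) measure" where
  "sym_lebesgue =
     completion (distr (\<Pi>\<^sub>M e\<in>{{i, j} |i j. True}. lborel) borel sym_matrix)"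

text \<open>The Gamma function $\Gamma_m(\alpha)$ of the cone of positive definite matrices.\<close>

definition cone_Gamma :: "nat \<Rightarrow> real \<Rightarrow> real" where
  "cone_Gamma m \<alpha> =
     pi powr (real m * (real m - 1) / 4) * (\<Prod>j<m. Gamma (\<alpha> - real j / 2))"

subsection \<open>Stiefel manifolds\<close>

definition stiefel :: "(real^'m^'n) set" where
  "stiefel = {v. transpose v ** v = mat 1}"

definition stiefel_mass :: "nat \<Rightarrow> nat \<Rightarrow> real" where
  "stiefel_mass n m = 2 ^ m * pi powr (real n * real m / 2) / cone_Gamma m (real n / 2)"

definition is_stiefel_measure :: "(real^'m^'n) measure \<Rightarrow> bool" where
  "is_stiefel_measure \<mu> \<longleftrightarrow>
     sets \<mu> = sets (restrict_space borel stiefel) \<and>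
     emeasure \<mu> stiefel = ennreal (stiefel_mass CARD('n) CARD('m)) \<and>
     (\<forall>\<gamma>. orthogonal_matrix \<gamma> \<longrightarrow> distr \<mu> \<mu> (\<lambda>v. \<gamma> ** v) = \<mu>)"

text \<open>For \<open>m \<le> n\<close> there is exactly one Borel measure with these properties.\<close>

definition stiefel_measure :: "(real^'m^'n) measure" where
  "stiefel_measure = completion (SOME \<mu>. is_stiefel_measure \<mu>)"

subsection \<open>The Radon transform and its shifted dual\<close>

definition vstack :: "real^'m^'k \<Rightarrow> real^'m^'l \<Rightarrow> real^'m^('k + 'l)" where
  "vstack \<omega> t = (\<chi> i. case i of Inl a \<Rightarrow> \<omega> $ a | Inr b \<Rightarrow> t $ b)"

text \<open>
  The rotation $g_\xi$.  It is determined up to right multiplication by the rotations of the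
  first \<open>k\<close> coordinates, which does not affect the Radon transform.
\<close>

definition frame_rotation :: "real^'l^('k + 'l) \<Rightarrow> real^('k + 'l)^('k::finite + 'l::finite)" where
  "frame_rotation \<xi> = (SOME g. rotation_matrix g \<and> g ** vstack 0 (mat 1) = \<xi>)"

definition radon ::
  "(real^'m^('k::finite + 'l::finite) \<Rightarrow> 'b::{banach, second_countable_topology})
    \<Rightarrow> real^'l^('k + 'l) \<Rightarrow> real^'m^'l \<Rightarrow> 'b" where
  "radon f \<xi> t = (\<integral>\<omega>. f (frame_rotation \<xi> ** vstack \<omega> t) \<partial>lebesgue)"

text \<open>
  The shifted dual transform at \<open>s\<close> is \<open>shifted_dual \<phi> z x\<close> for any \<open>z\<close> with
  \<open>transpose z ** z = s\<close>.
\<close>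

definition shifted_dual ::
  "(real^'l^('k::finite + 'l::finite) \<Rightarrow> real^'m^'l \<Rightarrow> 'b::{banach, second_countable_topology})
    \<Rightarrow> real^'m^'l \<Rightarrow> real^'m^('k + 'l) \<Rightarrow> 'b" where
  "shifted_dual \<phi> z x =
     (1 / stiefel_mass CARD('k + 'l) CARD('l)) *\<^sub>R
       (\<integral>\<xi>. \<phi> \<xi> (transpose \<xi> ** x + z) \<partial>stiefel_measure)"

subsection \<open>Spherical means and Garding-Gindikin fractional integrals\<close>

definition sph_mean ::
  "(real^'m^'n \<Rightarrow> 'b::{banach, second_countable_topology}) \<Rightarrow> real^'m^'n \<Rightarrow> real^'m^'m \<Rightarrow> 'b" where
  "sph_mean f x r =
     (1 / stiefel_mass CARD('n) CARD('m)) *\<^sub>R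
       (\<integral>v. f (x + v ** pos_def_sqrt r) \<partial>stiefel_measure)"

text \<open>The integral $I_-^{k/2}$, where \<open>k = CARD('k)\<close>.\<close>

definition frac_integral ::
  "'k::finite itself \<Rightarrow> (real^'m^'m \<Rightarrow> 'b::{banach, second_countable_topology})
    \<Rightarrow> real^'m^'m \<Rightarrow> 'b" where
  "frac_integral (_ :: 'k itself) F s =
     (if CARD('m) \<le> CARD('k) then
        (1 / cone_Gamma CARD('m) (real CARD('k) / 2)) *\<^sub>R
          (\<integral>r\<in>{r. r - s \<in> pos_def_matrices}.
             \<bar>det (r - s)\<bar> powr (real CARD('k) / 2 - (real CARD('m) + 1) / 2) *\<^sub>R F r
           \<partial>sym_lebesgue)
      else
        pi powr (- (real CARD('k) * real CARD('m) / 2)) *\<^sub>R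
          (\<integral>(\<omega> :: real^'m^'k). F (s + transpose \<omega> ** \<omega>) \<partial>lebesgue))"

subsection \<open>Absolute convergence\<close>

text \<open>
  The Bochner integral is total (it is 0 for functions that are not integrable).  The two
  predicates below say that the iterated integrals in \<open>shifted_dual (radon f) z x\<close> and in
  \<open>frac_integral TYPE('k) (sph_mean f x) s\<close> exist as absolutely convergent integrals: the inner one
  for almost all values of the outer variable, and the outer one with \<open>f\<close> replaced by its
  absolute value.
\<close>

definition dual_radon_converges ::
  "(real^'m^('k::finite + 'l::finite) \<Rightarrow> 'b::{banach, second_countable_topology})
    \<Rightarrow> real^'m^'l \<Rightarrow> real^'m^('k + 'l) \<Rightarrow> bool" where
  "dual_radon_converges f z x \<longleftrightarrow>
     (AE \<xi> in stiefel_measure.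
        integrable lebesgue
          (\<lambda>\<omega>. f (frame_rotation \<xi> ** vstack \<omega> (transpose \<xi> ** x + z)))) \<and>
     integrable stiefel_measure
       (\<lambda>\<xi>. radon (\<lambda>a. norm (f a)) \<xi> (transpose \<xi> ** x + z))"

definition frac_mean_converges ::
  "'k::finite itself \<Rightarrow> (real^'m^'n \<Rightarrow> 'b::{banach, second_countable_topology})
    \<Rightarrow> real^'m^'n \<Rightarrow> real^'m^'m \<Rightarrow> bool" where
  "frac_mean_converges (_ :: 'k itself) f x s \<longleftrightarrow>
     (if CARD('m) \<le> CARD('k) then
        (AE r in sym_lebesgue. r - s \<in> pos_def_matrices \<longrightarrow>
           integrable stiefel_measure (\<lambda>v. f (x + v ** pos_def_sqrt r))) \<and>
        set_integrable sym_lebesgue {r. r - s \<in> pos_def_matrices}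
          (\<lambda>r. \<bar>det (r - s)\<bar> powr (real CARD('k) / 2 - (real CARD('m) + 1) / 2) *\<^sub>R
             sph_mean (\<lambda>a. norm (f a)) x r)
      else
        (AE (\<omega> :: real^'m^'k) in lebesgue.
           integrable stiefel_measure
             (\<lambda>v. f (x + v ** pos_def_sqrt (s + transpose \<omega> ** \<omega>)))) \<and>
        integrable lebesgue
          (\<lambda>\<omega> :: real^'m^'k. sph_mean (\<lambda>a. norm (f a)) x (s + transpose \<omega> ** \<omega>)))"

end

theory Submission
  imports Defs 
begin

text \<open>
  Both sides are iterated integrals of $f(x + g [\omega; z])$ over $g \in O(n)$ with Haar measure and
  over $\omega \in \mathfrak{M}_{k,m}$, in opposite orders.  On the Radon side, $\xi$ is the last block
  of columns of $g$, and a translation in $\omega$ replaces $\xi' x + z$ by $z$.  On the other side, the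
  polar decomposition $[\omega; z] = v (\omega'\omega + s)^{1/2}$ turns the average over $g$ into the
  spherical mean at $r = s + \omega'\omega$; for $k \ge m$ the integral over $\omega$ becomes an integral
  over $r$ by the formula for the image of Lebesgue measure under $\omega \mapsto \omega'\omega$, which is
  proved by splitting off one column of $\omega$ and taking Schur complements.

  For convergence at almost all $s$, the double integral is integrated in $z$ against the weight
  $\det(I + z'z)^{-n/2}$, up to a constant.  Averaged over $O(n)$ this weight is a multiple of
  $\det(I + yy')^{-(n-k)/2}$, which belongs to $L^{p'}$ precisely when $p < (n+m-1)/(k+m-1)$.
\<close>

section \<open>Lebesgue measure on spaces of matrices\<close>

text \<open>An L^p function is determined only up to a null set, and a null set may contain whole
  planes and spheres. For Lebesgue measurable \<open>f\<close> the identity is therefore claimed for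
  almost all \<open>s\<close>, while Borel \<open>f\<close> admit an equivalence at every
  \<open>s\<close>, both sides being governed by integrability of one function on a product space.

  The exceptional set is first found among the \<open>z\<close> and then carried to
  \<open>s = z'z\<close>. This is a second use of the formula for Gram matrices, now for
  \<open>z\<close> instead of \<omega>; it requires m <= n-k, and it loses nothing because the image
  density is positive on the whole cone.

  The threshold for \<open>p\<close> comes from the dual exponent p' = p/(p-1): det(I + yy') to the
  power -q/2 is integrable for q > n+m-1, here with q = p'(n-k), and p'(n-k) > n+m-1 rearranges to
  p(k+m-1) < n+m-1. The case p = 1 uses boundedness instead.

  The weight in \<open>z\<close> is written as a Gaussian integral over an auxiliary matrix
  \<open>A\<close>, because its rotation average can then be computed by changing the order of
  integration and moving the rotation onto \<open>A\<close>.\<close>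

lemma nn_integral_lborel_shift:
  fixes h :: "'a::euclidean_space \<Rightarrow> ennreal"
  assumes "h \<in> borel_measurable borel"
  shows "(\<integral>\<^sup>+x. h (x + a) \<partial>lborel) = (\<integral>\<^sup>+x. h x \<partial>lborel)"
proof -
  have "(\<integral>\<^sup>+x. h x \<partial>lborel) = (\<integral>\<^sup>+x. h x \<partial>distr lborel borel ((+) a))"
    by (simp add: lborel_distr_plus)
  also have "\<dots> = (\<integral>\<^sup>+x. h (a + x) \<partial>lborel)"
    using assms by (subst nn_integral_distr) auto
  finally show ?thesis by (simp add: add.commute)
qed

lemma lborel_pair_swap:
  fixes h :: "'a::euclidean_space \<Rightarrow> 'b::euclidean_space \<Rightarrow> ennreal"
  assumes "(\<lambda>(x, y). h x y) \<in> borel_measurable (borel \<Otimes>\<^sub>M borel)"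
  shows "(\<integral>\<^sup>+x. \<integral>\<^sup>+y. h x y \<partial>lborel \<partial>lborel) = (\<integral>\<^sup>+y. \<integral>\<^sup>+x. h x y \<partial>lborel \<partial>lborel)"
proof -
  show ?thesis
    using assms pair_sigma_finite.Fubini[OF lborel_pair.pair_sigma_finite_axioms, of "\<lambda>(x, y). h x y"] by (simp add: lborel_prod borel_prod cong: measurable_cong_sets)
qed

text \<open>Translation invariant measures are proportional, and \<open>f\<close> preserves the volume of a ball.\<close>

lemma lborel_distr_orthogonal:
  fixes f :: "'a::euclidean_space \<Rightarrow> 'a"
  assumes f: "orthogonal_transformation f"
  shows "distr lborel borel f = lborel"
proof -
  have lin: "linear f" using f by (simp add: orthogonal_transformation)
  have [measurable]: "f \<in> borel_measurable borel"
    using lin by (intro borel_measurable_continuous_onI linear_continuous_on)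
       (simp add: linear_conv_bounded_linear)
  have eq: "emeasure (distr lborel borel f) A = emeasure lborel A" if [measurable]: "A \<in> sets borel" for A :: "'a set"
  proof -
    let ?B = "ball (0::'a) 1"
    have [measurable]: "?B \<in> sets borel" by simp
    have "emeasure (distr lborel borel f) A * emeasure lborel ?B
        = (\<integral>\<^sup>+x. indicator A (f x) * emeasure lborel ?B \<partial>lborel)"
      by (simp add: nn_integral_multc nn_integral_distr flip: nn_integral_indicator)
    also have "\<dots> = (\<integral>\<^sup>+x. \<integral>\<^sup>+y. indicator A (f x) * indicator ?B y \<partial>lborel \<partial>lborel)"
      by (simp add: nn_integral_cmult)
    also have "\<dots> = (\<integral>\<^sup>+x. \<integral>\<^sup>+y. indicator A (f x) * indicator ?B (y - f x) \<partial>lborel \<partial>lborel)"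
    proof (rule nn_integral_cong)
      fix x
      show "(\<integral>\<^sup>+y. indicator A (f x) * indicator ?B y \<partial>lborel)
          = (\<integral>\<^sup>+y. indicator A (f x) * indicator ?B (y - f x) \<partial>lborel)"
        using nn_integral_lborel_shift[of "\<lambda>y. indicator A (f x) * indicator ?B y" "- f x"] by simp
    qed
    also have "\<dots> = (\<integral>\<^sup>+y. \<integral>\<^sup>+x. indicator A (f x) * indicator ?B (y - f x) \<partial>lborel \<partial>lborel)"
      by (rule lborel_pair_swap) measurable
    \<comment> \<open>With \<open>y = f a\<close>, translating \<open>x\<close> by \<open>a\<close>
      moves \<open>y\<close> out of the ball and into the argument of \<open>A\<close>. After the
      next interchange a translation in \<open>y\<close> removes \<open>f x\<close> there, and the
      two factors separate.\<close>
    also have "\<dots> = (\<integral>\<^sup>+y. \<integral>\<^sup>+x. indicator A (f x + y) * indicator ?B (- f x) \<partial>lborel \<partial>lborel)"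
    proof (rule nn_integral_cong)
      fix y
      obtain a where a: "y = f a" using orthogonal_transformation_surj[OF f] by (auto simp: surj_def)
      show "(\<integral>\<^sup>+x. indicator A (f x) * indicator ?B (y - f x) \<partial>lborel)
          = (\<integral>\<^sup>+x. indicator A (f x + y) * indicator ?B (- f x) \<partial>lborel)"
        using nn_integral_lborel_shift[of "\<lambda>x. indicator A (f x) * indicator ?B (y - f x)" a]
        by (simp add: linear_add[OF lin] a)
    qed
    also have "\<dots> = (\<integral>\<^sup>+x. \<integral>\<^sup>+y. indicator A (f x + y) * indicator ?B (- f x) \<partial>lborel \<partial>lborel)"
      by (rule lborel_pair_swap[symmetric]) measurable
    also have "\<dots> = (\<integral>\<^sup>+x. \<integral>\<^sup>+y. indicator A y * indicator ?B x \<partial>lborel \<partial>lborel)"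
    proof (rule nn_integral_cong)
      fix x
      have "indicator ?B (- f x) = (indicator ?B x :: ennreal)"
        using f by (auto simp: indicator_def orthogonal_transformation_norm)
      then show "(\<integral>\<^sup>+y. indicator A (f x + y) * indicator ?B (- f x) \<partial>lborel)
          = (\<integral>\<^sup>+y. indicator A y * indicator ?B x \<partial>lborel)"
        using nn_integral_lborel_shift[of "\<lambda>y. indicator A y * indicator ?B x" "f x"]
        by (simp add: add.commute)
    qed
    also have "\<dots> = emeasure lborel A * emeasure lborel ?B"
      by (simp add: nn_integral_multc nn_integral_cmult)
    finally have "emeasure (distr lborel borel f) A * emeasure lborel ?B = emeasure lborel A * emeasure lborel ?B" .
    moreover have "emeasure lborel ?B \<noteq> 0" "emeasure lborel ?B \<noteq> \<infinity>"
      using emeasure_lborel_ball_finite[of "0::'a" 1]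
      by (auto simp: emeasure_ball unit_ball_vol_pos ennreal_eq_0_iff not_le)
    ultimately show ?thesis
      by (metis mult_divide_eq_ennreal infinity_ennreal_def)
  qed
  show ?thesis by (rule measure_eqI) (simp_all add: eq)
qed

lemma Basis_vec_image: "Basis = (\<lambda>(i, b). axis i b) ` (UNIV \<times> (Basis :: 'a::euclidean_space set))"
  by (auto simp: Basis_vec_def)

lemma prod_Basis_vec:
  "(\<Prod>b\<in>Basis. f (b :: 'a::euclidean_space ^ 'n)) = (\<Prod>i\<in>UNIV. \<Prod>b\<in>Basis. f (axis i b))"
proof -
  have "inj_on (\<lambda>(i::'n, b). axis i b) (UNIV \<times> (Basis :: 'a set))"
    by (auto simp: inj_on_def axis_eq_axis dest: nonzero_Basis)
  then show ?thesis
    unfolding Basis_vec_image by (subst prod.reindex) (simp_all add: prod.cartesian_product case_prod_beta)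
qed

text \<open>Lebesgue measure is determined by its values on boxes, and these factor over the
  components. This opens the way to product measures wherever an integrand splits by
  coordinates.\<close>

lemma lborel_vec:
  "distr (\<Pi>\<^sub>M i\<in>UNIV. lborel) borel (\<lambda>c. \<chi> i. c i) = (lborel :: ('a::euclidean_space ^ 'n::finite) measure)"
proof (rule lborel_eqI[symmetric])
  interpret product_sigma_finite "\<lambda>_::'n. lborel :: 'a measure" ..
  have [measurable]: "(\<lambda>c. \<chi> i. c i) \<in> measurable (\<Pi>\<^sub>M i\<in>UNIV. lborel :: 'a measure) (borel :: ('a^'n) measure)"
    unfolding borel_measurable_euclidean_space[of "\<lambda>c. \<chi> i. c i"]
    by (auto simp: Basis_vec_def inner_axis)
  fix l u :: "'a^'n"
  assume lu: "\<And>b. b \<in> Basis \<Longrightarrow> l \<bullet> b \<le> u \<bullet> b"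
  have lu': "l $ i \<bullet> b \<le> u $ i \<bullet> b" if "b \<in> Basis" for i b
    using lu[of "axis i b"] that by (auto simp: Basis_vec_def inner_axis)
  have "(\<lambda>c. \<chi> i. c i) -` box l u \<inter> space (\<Pi>\<^sub>M i\<in>UNIV. lborel) = (\<Pi>\<^sub>E i\<in>UNIV. box (l $ i) (u $ i))"
    by (auto simp: space_PiM box_def Basis_vec_def inner_axis PiE_def)
  then have "emeasure (distr (\<Pi>\<^sub>M i\<in>UNIV. lborel) borel (\<lambda>c. \<chi> i. c i)) (box l u)
     = (\<Prod>i\<in>UNIV. emeasure lborel (box (l $ i) (u $ i)))"
    by (simp add: emeasure_distr emeasure_PiM)
  also have "\<dots> = (\<Prod>i\<in>UNIV. ennreal (\<Prod>b\<in>Basis. (u $ i - l $ i) \<bullet> b))"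
    using lu' by (intro prod.cong refl emeasure_lborel_box) auto
  also have "\<dots> = ennreal (\<Prod>i\<in>UNIV. (\<Prod>b\<in>Basis. (u $ i - l $ i) \<bullet> b))"
    using lu' by (intro prod_ennreal prod_nonneg) (auto simp: inner_diff_left)
  also have "(\<Prod>i\<in>UNIV. (\<Prod>b\<in>Basis. (u $ i - l $ i) \<bullet> b)) = (\<Prod>b\<in>Basis. (u - l) \<bullet> b)"
    by (simp add: prod_Basis_vec inner_axis)
  finally show "emeasure (distr (\<Pi>\<^sub>M i\<in>UNIV. lborel) borel (\<lambda>c. \<chi> i. c i)) (box l u) = ennreal (\<Prod>b\<in>Basis. (u - l) \<bullet> b)" .
qed simp

lemma borel_measurable_transpose [measurable]:
  "transpose \<in> borel_measurable (borel :: (real^'m^'n) measure)"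
  by (intro borel_measurable_continuous_onI) (auto simp: transpose_def intro!: continuous_intros)

lemma transpose_add: "transpose (A + B) = transpose A + transpose (B :: real^'m^'n)"
  and transpose_diff: "transpose (A - B) = transpose A - transpose (B :: real^'m^'n)"
  by (simp_all add: transpose_def vec_eq_iff)

text \<open>Transposition permutes the standard basis, hence maps boxes to boxes. It lets columns be
  handled as rows, which are the components of the vector type.\<close>

lemma lborel_transpose: "distr lborel borel transpose = (lborel :: (real^'m^'n) measure)"
proof (rule lborel_eqI[symmetric])
  fix l u :: "real^'m^'n"
  have bas: "(Basis :: (real^'m^'n) set) = transpose ` Basis"
  proof -
    have t: "transpose (axis j (axis i 1)) = (axis i (axis j 1) :: real^'m^'n)" for i j
      by (auto simp: transpose_def axis_def vec_eq_iff)
    have "axis i (axis j (1::real)) \<in> transpose ` Basis" for i :: 'n and j :: 'm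
      by (rule image_eqI[of _ _ "axis j (axis i 1)"]) (auto simp: t Basis_vec_def)
    moreover have "transpose ` Basis \<subseteq> (Basis :: (real^'m^'n) set)"
      by (auto simp: t Basis_vec_def) blast+
    ultimately show ?thesis by (auto simp: Basis_vec_def)
  qed
  have inn: "a \<bullet> transpose b = transpose a \<bullet> b" for a :: "real^'m^'n" and b :: "real^'n^'m"
    by (simp add: inner_vec_def transpose_def) (rule sum.swap)
  have inj: "inj_on transpose A" for A :: "(real^'n^'m) set"
    by (auto simp: inj_on_def)
  assume lu: "\<And>b. b \<in> Basis \<Longrightarrow> l \<bullet> b \<le> u \<bullet> b"
  have lu': "transpose l \<bullet> b \<le> transpose u \<bullet> b" if "b \<in> Basis" for b
    using lu[of "transpose b"] that bas by (auto simp: inn)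
  have "transpose -` box l u = box (transpose l) (transpose u)"
    unfolding box_def bas by (auto simp: inn)
  then have "emeasure (distr lborel borel transpose) (box l u) = emeasure lborel (box (transpose l) (transpose u))"
    by (simp add: emeasure_distr)
  also have "\<dots> = (\<Prod>b\<in>Basis. (transpose u - transpose l) \<bullet> b)"
    using lu' by (rule emeasure_lborel_box)
  also have "(\<Prod>b\<in>Basis. (transpose u - transpose l) \<bullet> b) = (\<Prod>b\<in>Basis. (u - l) \<bullet> b)"
    unfolding bas by (subst prod.reindex[OF inj]) (simp add: inn inner_diff_left transpose_diff)
  finally show "emeasure (distr lborel borel transpose) (box l u) = ennreal (\<Prod>b\<in>Basis. (u - l) \<bullet> b)" .
qed simp

lemma borel_measurable_vstack [measurable]:
  "(\<lambda>(\<omega>, t). vstack \<omega> t :: real^'m^('k::finite + 'l::finite)) \<in> borel_measurable (borel \<Otimes>\<^sub>M borel)"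
  unfolding borel_prod
proof (intro borel_measurable_continuous_onI)
  have "continuous_on UNIV (\<lambda>p :: (real^'m^'k) \<times> (real^'m^'l). case i of Inl a \<Rightarrow> fst p $ a | Inr b \<Rightarrow> snd p $ b)" for i :: "'k + 'l"
    by (cases i) (auto intro!: continuous_intros)
  then show "continuous_on UNIV (\<lambda>(\<omega>, t). vstack \<omega> t :: real^'m^('k::finite + 'l::finite))"
    by (auto simp: vstack_def case_prod_beta intro!: continuous_intros)
qed

lemma prod_UNIV_sum:
  "(\<Prod>i\<in>UNIV. f (i :: 'k::finite + 'l::finite)) = (\<Prod>i\<in>UNIV. f (Inl i)) * (\<Prod>i\<in>UNIV. f (Inr i))"
  by (subst UNIV_Plus_UNIV[symmetric], subst prod.Plus) auto

lemma lborel_vstack: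
  "distr (lborel \<Otimes>\<^sub>M lborel) borel (\<lambda>(\<omega>, t). vstack \<omega> t) = (lborel :: (real^'m^('k::finite + 'l::finite)) measure)"
proof (rule lborel_eqI[symmetric])
  let ?T = "\<lambda>(\<omega>, t). vstack \<omega> t :: real^'m^('k + 'l)"
  fix l u :: "real^'m^('k + 'l)"
  let ?L = "\<lambda>a::real^'m^('k+'l). (\<chi> i. a $ Inl i)" and ?R = "\<lambda>a::real^'m^('k+'l). (\<chi> i. a $ Inr i)"
  assume lu: "\<And>b. b \<in> Basis \<Longrightarrow> l \<bullet> b \<le> u \<bullet> b"
  have lu': "l $ i $ j \<le> u $ i $ j" for i j
    using lu[of "axis i (axis j 1)"] by (auto simp: Basis_vec_def inner_axis)
  have e: "a \<in> box l' u' \<longleftrightarrow> (\<forall>i j. l' $ i $ j < a $ i $ j \<and> a $ i $ j < u' $ i $ j)" for a l' u' :: "real^'a::finite^'b::finite"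
    by (auto simp: box_def Basis_vec_def inner_axis)
  have pr: "(\<Prod>b\<in>Basis. a \<bullet> b) = (\<Prod>i\<in>UNIV. \<Prod>j\<in>UNIV. a $ i $ j)" for a :: "real^'a::finite^'b::finite"
    by (simp add: prod_Basis_vec inner_axis)
  have "?T -` box l u \<inter> space (lborel \<Otimes>\<^sub>M lborel) = box (?L l) (?L u) \<times> box (?R l) (?R u)"
    unfolding set_eq_iff Int_iff vimage_eq mem_Times_iff e
    by (auto simp: vstack_def space_pair_measure split_sum_all)
  moreover have [measurable]: "?T \<in> measurable (lborel \<Otimes>\<^sub>M lborel) borel"
    using borel_measurable_vstack[where 'm='m and 'k='k and 'l='l] by (simp add: borel_prod lborel_prod cong: measurable_cong_sets)
  ultimately have "emeasure (distr (lborel \<Otimes>\<^sub>M lborel) borel ?T) (box l u) = emeasure lborel (box (?L l) (?L u)) * emeasure lborel (box (?R l) (?R u))"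
    by (simp add: emeasure_distr lborel.emeasure_pair_measure_Times)
  also have "\<dots> = ennreal (\<Prod>b\<in>Basis. (?L u - ?L l) \<bullet> b) * ennreal (\<Prod>b\<in>Basis. (?R u - ?R l) \<bullet> b)"
    using lu' by (intro arg_cong2[where f="(*)"] emeasure_lborel_box) (auto simp: Basis_vec_def inner_axis)
  also have "\<dots> = ennreal ((\<Prod>b\<in>Basis. (?L u - ?L l) \<bullet> b) * (\<Prod>b\<in>Basis. (?R u - ?R l) \<bullet> b))"
    unfolding pr using lu' by (intro ennreal_mult[symmetric] prod_nonneg) auto
  also have "(\<Prod>b\<in>Basis. (?L u - ?L l) \<bullet> b) * (\<Prod>b\<in>Basis. (?R u - ?R l) \<bullet> b) = (\<Prod>b\<in>Basis. (u - l) \<bullet> b)"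
    unfolding pr by (subst prod_UNIV_sum) simp
  finally show "emeasure (distr (lborel \<Otimes>\<^sub>M lborel) borel ?T) (box l u) = ennreal (\<Prod>b\<in>Basis. (u - l) \<bullet> b)" .
qed simp

section \<open>Orthogonal and positive definite matrices\<close>

lemma column_matrix_mult: "column j (A ** B) = A *v column j B"
  by (simp add: column_def matrix_matrix_mult_def matrix_vector_mult_def vec_eq_iff)

lemma row_matrix_mult: "((A :: real^'n^'m) ** B) $ i = transpose B *v (A $ i)"
  by (simp add: matrix_matrix_mult_def matrix_vector_mult_def transpose_def vec_eq_iff mult.commute)

lemma inner_matrix_rows: "A \<bullet> B = (\<Sum>i\<in>UNIV. A $ i \<bullet> (B :: real^'m^'n) $ i)"
  by (simp add: inner_vec_def)

lemma inner_matrix_columns: "A \<bullet> B = (\<Sum>j\<in>UNIV. column j A \<bullet> column j (B :: real^'m^'n))"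
  unfolding inner_vec_def column_def by (simp add: sum.swap[of _ "UNIV :: 'm set"])

lemma transpose_mult_nth: "(transpose A ** B) $ i $ j = column i A \<bullet> column j (B :: real^'m^'n)"
  by (simp add: matrix_matrix_mult_def transpose_def inner_vec_def column_def)

lemma orthogonal_matrix_inner:
  assumes "orthogonal_matrix (g :: real^'n^'n)"
  shows "(g *v x) \<bullet> (g *v y) = x \<bullet> y"
  using assms orthogonal_transformation_matrix[of "(*v) g"]
  by (simp add: orthogonal_transformation_def)

lemma orthogonal_matrixD:
  assumes "orthogonal_matrix (g :: real^'n^'n)"
  shows "transpose g ** g = mat 1" "g ** transpose g = mat 1"
    "transpose g ** (g ** A) = A" "g ** (transpose g ** A) = A"
  using assms by (simp_all add: orthogonal_matrix_def matrix_mul_assoc)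

lemma orthogonal_transformation_matrix_mult_left:
  assumes "orthogonal_matrix (g :: real^'n^'n)"
  shows "orthogonal_transformation (\<lambda>A :: real^'m^'n. g ** A)"
  unfolding orthogonal_transformation_def
proof
  show "linear (\<lambda>A :: real^'m^'n. g ** A)"
    by (auto intro!: linearI simp:  matrix_matrix_mult_def vec_eq_iff sum.distrib algebra_simps sum_distrib_left)
  show "\<forall>v w. (g ** v) \<bullet> (g ** w) = v \<bullet> (w :: real^'m^'n)"
    by (simp add: inner_matrix_columns column_matrix_mult orthogonal_matrix_inner[OF assms])
qed

lemma orthogonal_transformation_matrix_mult_right:
  assumes "orthogonal_matrix (g :: real^'n^'n)"
  shows "orthogonal_transformation (\<lambda>A :: real^'n^'m. A ** g)"
  unfolding orthogonal_transformation_def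
proof
  show "linear (\<lambda>A :: real^'n^'m. A ** g)"
    by (auto intro!: linearI simp: 
        matrix_matrix_mult_def vec_eq_iff sum.distrib algebra_simps sum_distrib_left)
  have "orthogonal_matrix (transpose g)" using assms by simp
  then show "\<forall>v w. (v ** g) \<bullet> (w ** g) = v \<bullet> (w :: real^'n^'m)"
    unfolding inner_matrix_rows by (simp only: row_matrix_mult orthogonal_matrix_inner) simp
qed

text \<open>The Householder reflection in the hyperplane orthogonal to \<open>a - b\<close>. The
  last property lists the vectors of that hyperplane; later it keeps directions fixed that have
  already been put in place.\<close>

lemma orthogonal_matrix_reflection:
  fixes a b :: "real^'n"
  assumes "norm a = norm b"
  obtains g where "orthogonal_matrix g" "g *v a = b" "\<And>x. x \<bullet> a = x \<bullet> b \<Longrightarrow> g *v x = x"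
proof (cases "a = b")
  case True
  then show ?thesis using that[of "mat 1"] by (simp add: orthogonal_matrix_id)
next
  case False
  define w where "w = a - b"
  define f where "f x = x - (2 * (x \<bullet> w) / (w \<bullet> w)) *\<^sub>R w" for x
  have w: "w \<bullet> w \<noteq> 0" using False by (simp add: w_def)
  have lin: "linear f"
    by (rule linearI) (simp_all add: f_def algebra_simps add_divide_distrib)
  have nf: "norm (f x) = norm x" for x
  proof -
    have "f x \<bullet> f x = x \<bullet> x"
      using w by (simp add: f_def inner_diff_left inner_diff_right inner_commute field_simps)
    then show ?thesis by (simp add: norm_eq_sqrt_inner)
  qed
  have orth: "orthogonal_transformation f"
    by (simp add: orthogonal_transformation lin nf)
  have mf: "matrix f *v x = f x" for x using lin by (simp add: matrix_works)
  have eq: "a \<bullet> a = b \<bullet> b" using assms by (simp add: norm_eq)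
  \<comment> \<open>Equal lengths make the coefficient at \<open>a\<close> equal to 1, so
    \<open>a\<close> goes to \<open>a - w = b\<close>.\<close>
  have "2 * (a \<bullet> w) = w \<bullet> w"
    by (simp add: w_def inner_diff_left inner_diff_right inner_commute eq)
  then have "f a = b" using w by (simp add: f_def) (simp add: w_def)
  moreover have "f x = x" if "x \<bullet> a = x \<bullet> b" for x
    using that by (simp add: f_def w_def inner_diff_right)
  ultimately show ?thesis
    using orth orthogonal_transformation_matrix[of f] by (intro that[of "matrix f"]) (simp_all add: mf)
qed

lemma stiefel_iff: "v \<in> stiefel \<longleftrightarrow> (\<forall>i j. column i v \<bullet> column j (v :: real^'m^'n) = (if i = j then 1 else 0))"
  by (simp add: stiefel_def vec_eq_iff transpose_mult_nth mat_def)

lemma stiefel_mult_left: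
  assumes "orthogonal_matrix g" "v \<in> stiefel"
  shows "g ** v \<in> stiefel"
  using assms by (simp add: stiefel_def matrix_transpose_mul matrix_mul_assoc[symmetric] orthogonal_matrixD)

text \<open>Columns are matched one at a time. The reflection that carries the current image of
  column \<open>j\<close> to its target fixes the columns already matched, because both vectors are
  orthogonal to them.\<close>

lemma orthogonal_matrix_transitive:
  fixes v w :: "real^'m^'n"
  assumes v: "v \<in> stiefel" and w: "w \<in> stiefel"
  obtains g where "orthogonal_matrix g" "g ** v = w"
proof -
  have "\<exists>g. orthogonal_matrix g \<and> (\<forall>i\<in>S. g *v column i v = column i w)" if "finite S" for S
    using that
  proof induction
    case empty
    then show ?case by (auto intro!: exI[of _ "mat 1"] simp: orthogonal_matrix_id)
  next
    case (insert j S)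
    then obtain g where g: "orthogonal_matrix g" "\<forall>i\<in>S. g *v column i v = column i w" by auto
    let ?a = "g *v column j v" and ?b = "column j w"
    have "norm ?a = norm ?b"
      using v w g by (simp add: norm_eq_sqrt_inner orthogonal_matrix_inner stiefel_iff)
    then obtain h where h: "orthogonal_matrix h" "h *v ?a = ?b" "\<And>x. x \<bullet> ?a = x \<bullet> ?b \<Longrightarrow> h *v x = x"
      by (metis orthogonal_matrix_reflection)
    have "h *v (g *v column i v) = column i w" if "i \<in> S" for i
    proof -
      have "i \<noteq> j" using that insert by auto
      have "column i w \<bullet> ?a = (g *v column i v) \<bullet> (g *v column j v)" using g that by simp
      also have "\<dots> = 0" using v \<open>i \<noteq> j\<close> by (simp add: orthogonal_matrix_inner[OF g(1)] stiefel_iff)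
      also have "\<dots> = column i w \<bullet> ?b" using w \<open>i \<noteq> j\<close> by (simp add: stiefel_iff)
      finally have "column i w \<bullet> ?a = column i w \<bullet> ?b" .
      from h(3)[OF this] show ?thesis using g that by simp
    qed
    then show ?case
      using g h by (intro exI[of _ "h ** g"]) (auto simp: orthogonal_matrix_mul simp flip: matrix_vector_mul_assoc)
  qed
  from this[OF finite_class.finite_UNIV] obtain g where g: "orthogonal_matrix g" "\<forall>i. g *v column i v = column i w" by auto
  then have "g ** v = w"
    by (simp add: vec_eq_iff column_def matrix_matrix_mult_def matrix_vector_mult_def)
  with g that show ?thesis by blast
qed

lemma stiefel_nonempty:
  assumes "CARD('m) \<le> CARD('n)"
  obtains v where "v \<in> (stiefel :: (real^'m^'n) set)"
proof -
  obtain e :: "'m \<Rightarrow> 'n" where e: "inj e"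
    using assms card_le_inj[of "UNIV :: 'm set" "UNIV :: 'n set"] by auto
  have "(\<chi> i j. if i = e j then 1 else 0) \<in> (stiefel :: (real^'m^'n) set)"
    using e by (auto simp: stiefel_iff column_def inner_vec_def if_distrib[of "\<lambda>a. a * _"] cong: if_cong dest: injD)
  then show ?thesis by (rule that)
qed

lemma vstack_mult: "transpose (vstack \<omega> t) ** vstack \<omega>' t' = transpose \<omega> ** \<omega>' + transpose t ** t'"
  by (simp add: vec_eq_iff matrix_matrix_mult_def transpose_def vstack_def UNIV_Plus_UNIV[symmetric] sum.Plus del: UNIV_Plus_UNIV)

lemma stiefel_vstack: "vstack 0 (mat 1) \<in> stiefel"
  by (simp add: stiefel_def vstack_mult transpose_mat matrix_mul_lid)

text \<open>Shows that the choice in \<open>frame_rotation\<close> has a witness; transitivity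
  supplies an orthogonal matrix, whose determinant may still have the wrong sign.\<close>

lemma frame_rotation:
  fixes \<xi> :: "real^'l^('k::finite + 'l::finite)"
  assumes "\<xi> \<in> stiefel"
  shows "orthogonal_matrix (frame_rotation \<xi>)" "frame_rotation \<xi> ** vstack 0 (mat 1) = \<xi>"
proof -
  obtain g where g: "orthogonal_matrix g" "g ** vstack 0 (mat 1) = \<xi>"
    using orthogonal_matrix_transitive[OF stiefel_vstack assms] .
  have "\<exists>g. rotation_matrix g \<and> g ** vstack 0 (mat 1) = \<xi>"
  proof (cases "det g = 1")
    case True
    then show ?thesis using g by (auto simp: rotation_matrix_def)
  next
    case False
    then have d: "det g = -1" using g det_orthogonal_matrix by blast
    \<comment> \<open>Reversing one of the first \<open>k\<close> coordinates changes the sign of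
      the determinant and does not touch the last block. Such a coordinate exists because types are
      nonempty.\<close>
    define a where "a = (SOME a::'k. True)"
    define D :: "real^('k + 'l)^('k + 'l)" where "D = (\<chi> i j. if i = j then (if i = Inl a then -1 else 1) else 0)"
    have "transpose D = D" by (auto simp: D_def transpose_def vec_eq_iff)
    moreover have "D ** D = mat 1"
      by (auto simp: D_def matrix_matrix_mult_def mat_def vec_eq_iff if_distrib[of "\<lambda>a. a * _"] cong: if_cong)
    ultimately have "orthogonal_matrix D" by (simp add: orthogonal_matrix_def)
    moreover have "det D = -1"
      by (subst det_diagonal) (auto simp: D_def prod.If_cases)
    moreover have "D ** vstack 0 (mat 1) = vstack 0 (mat 1)"
      by (auto simp: D_def matrix_matrix_mult_def vec_eq_iff vstack_def if_distrib[of "\<lambda>a. a * _"] split: sum.splits cong: if_cong)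
    ultimately show ?thesis using g d
      by (intro exI[of _ "g ** D"]) (auto simp: rotation_matrix_def orthogonal_matrix_mul det_mul simp flip: matrix_mul_assoc)
  qed
  then have "rotation_matrix (frame_rotation \<xi>) \<and> frame_rotation \<xi> ** vstack 0 (mat 1) = \<xi>"
    unfolding frame_rotation_def by (rule someI_ex)
  then show "orthogonal_matrix (frame_rotation \<xi>)" "frame_rotation \<xi> ** vstack 0 (mat 1) = \<xi>"
    by (auto simp: rotation_matrix_def)
qed

section \<open>The spectral theorem for symmetric matrices\<close>

lemma symmetric_inner_mult:
  fixes A :: "real^'n^'n"
  assumes "transpose A = A"
  shows "(A *v x) \<bullet> y = x \<bullet> (A *v y)"
  by (metis assms dot_lmul_matrix transpose_matrix_vector)

text \<open>The linear coefficient is the first variation at t = 0. At t = -b/(q+1) the quadratic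
  equals -(q+2) b^2/(q+1)^2, which forces b = 0.\<close>

lemma quadratic_nonneg_imp_zero:
  fixes b q :: real
  assumes Q: "\<And>t. 0 \<le> 2 * t * b + t\<^sup>2 * q" and q: "0 \<le> q"
  shows "b = 0"
proof -
  define u where "u = b / (q + 1)"
  have b: "b = u * (q + 1)" using q by (simp add: u_def)
  have "0 \<le> - (u\<^sup>2 * (q + 2))" using Q[of "- u"] by (simp add: b algebra_simps power2_eq_square)
  then have "u\<^sup>2 \<le> 0" using q by (simp add: mult_le_0_iff)
  then show ?thesis by (simp add: b)
qed

text \<open>A maximum point of the quadratic form on the unit sphere of \<open>V\<close> is an
  eigenvector: its first variation vanishes in every direction of \<open>V\<close>, and the
  invariance of \<open>V\<close> makes the defect \<open>c x - A x\<close> one of these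
  directions.\<close>

lemma symmetric_eigenvector:
  fixes A :: "real^'n^'n"
  assumes sym: "transpose A = A" and V: "subspace V" "\<And>x. x \<in> V \<Longrightarrow> A *v x \<in> V" and "x0 \<in> V" "x0 \<noteq> 0"
  obtains x c where "x \<in> V" "norm x = 1" "A *v x = c *\<^sub>R x"
proof -
  let ?K = "sphere 0 1 \<inter> V"
  have "compact ?K" using V(1) by (simp add: closed_subspace compact_Int_closed)
  moreover have "x0 /\<^sub>R norm x0 \<in> ?K" using assms by (simp add: subspace_scale)
  moreover have "continuous_on ?K (\<lambda>x. x \<bullet> (A *v x))"
    by (intro continuous_intros linear_continuous_on) (simp add: linear_conv_bounded_linear[symmetric])
  ultimately obtain x where x: "x \<in> ?K" "\<And>y. y \<in> ?K \<Longrightarrow> y \<bullet> (A *v y) \<le> x \<bullet> (A *v x)"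
    using continuous_attains_sup[of ?K "\<lambda>x. x \<bullet> (A *v x)"] by blast
  define c where "c = x \<bullet> (A *v x)"
  have nx: "x \<bullet> x = 1" using x by (simp add: norm_eq_sqrt_inner)
  have Q: "0 \<le> c * (y \<bullet> y) - y \<bullet> (A *v y)" if "y \<in> V" for y
  proof (cases "y = 0")
    case False
    then have "y /\<^sub>R norm y \<in> ?K" using that V(1) by (simp add: subspace_scale)
    from x(2)[OF this] have "inverse (norm y) * (inverse (norm y) * (y \<bullet> (A *v y))) \<le> c"
      by (simp add: c_def matrix_vector_mult_scaleR)
    then have "y \<bullet> (A *v y) \<le> c * (norm y * norm y)" using False by (simp add: field_simps)
    then show ?thesis by (simp add: dot_square_norm power2_eq_square)
  qed simp
  have "x \<bullet> (c *\<^sub>R y - A *v y) = 0" if y: "y \<in> V" for y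
  proof (rule ccontr)
    let ?b = "x \<bullet> (c *\<^sub>R y - A *v y)" and ?q = "c * (y \<bullet> y) - y \<bullet> (A *v y)"
    assume b: "?b \<noteq> 0"
    have Qt: "0 \<le> 2 * t * ?b + t\<^sup>2 * ?q" for t
    proof -
      have "x + t *\<^sub>R y \<in> V" using x y V(1) by (simp add: subspace_add subspace_scale)
      from Q[OF this] show ?thesis
        using nx symmetric_inner_mult[OF sym, of x y]
        by (simp add: inner_add_left inner_add_right inner_diff_right matrix_vector_right_distrib matrix_vector_mult_scaleR
            c_def[symmetric] power2_eq_square algebra_simps inner_commute)
    qed
    have q: "0 \<le> ?q" by (rule Q[OF y])
    show False using quadratic_nonneg_imp_zero[OF Qt q] b by blast
  qed
  moreover have "c *\<^sub>R x - A *v x \<in> V" using x V by (simp add: subspace_diff subspace_scale)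
  \<comment> \<open>The first variation in the direction \<open>c x - A x\<close>; symmetry of
    \<open>A\<close> turns it into the squared length of that vector.\<close>
  ultimately have "x \<bullet> (c *\<^sub>R (c *\<^sub>R x - A *v x) - A *v (c *\<^sub>R x - A *v x)) = 0" by blast
  then have "(c *\<^sub>R x - A *v x) \<bullet> (c *\<^sub>R x - A *v x) = 0"
    using symmetric_inner_mult[OF sym, of x "c *\<^sub>R x - A *v x"]
    by (simp add: inner_diff_left inner_diff_right inner_commute right_diff_distrib)
  then have "A *v x = c *\<^sub>R x" by simp
  then show ?thesis using x by (intro that[of x c]) auto
qed

definition diag_matrix :: "('n \<Rightarrow> real) \<Rightarrow> real^'n^'n" where
  "diag_matrix d = (\<chi> i j. if i = j then d i else 0)"

lemma diag_matrix_mult_vec: "diag_matrix d *v x = (\<chi> i. d i * x $ i)"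
  by (simp add: diag_matrix_def matrix_vector_mult_def vec_eq_iff if_distrib[of "\<lambda>a. a * _"] cong: if_cong)

lemma diag_matrix_mult: "diag_matrix d ** diag_matrix e = diag_matrix (\<lambda>i. d i * e i)"
  by (simp add: diag_matrix_def matrix_matrix_mult_def vec_eq_iff if_distrib[of "\<lambda>a. a * _"] cong: if_cong)

lemma transpose_diag_matrix [simp]: "transpose (diag_matrix d) = diag_matrix d"
  by (auto simp: diag_matrix_def transpose_def vec_eq_iff)

lemma det_diag_matrix: "det (diag_matrix d) = (\<Prod>i\<in>UNIV. d i)"
  by (subst det_diagonal) (simp_all add: diag_matrix_def)

text \<open>Eigenvectors are found successively in the orthogonal complement of the earlier ones,
  which is invariant by symmetry and nonzero by a dimension count. The index set of the columns
  serves as the set for the induction.\<close>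

theorem symmetric_matrix_spectral:
  fixes A :: "real^'n^'n"
  assumes sym: "transpose A = A"
  obtains g d where "orthogonal_matrix g" "A = g ** diag_matrix d ** transpose g"
proof -
  have "\<exists>q d. (\<forall>i\<in>S. \<forall>j\<in>S. q i \<bullet> q j = (if i = j then 1 else 0)) \<and> (\<forall>i\<in>S. A *v q i = d i *\<^sub>R q i)"
    if "finite S" for S :: "'n set"
    using that
  proof induction
    case (insert k S)
    then obtain q :: "'n \<Rightarrow> real^'n" and d where
      q: "\<forall>i\<in>S. \<forall>j\<in>S. q i \<bullet> q j = (if i = j then 1 else 0)" "\<forall>i\<in>S. A *v q i = d i *\<^sub>R q i" by auto
    let ?V = "{x. \<forall>i\<in>S. x \<bullet> q i = 0}"
    have "subspace ?V" by (auto simp: subspace_def inner_add_left)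
    moreover have "A *v x \<in> ?V" if "x \<in> ?V" for x
      using that q by (auto simp: symmetric_inner_mult[OF sym])
    moreover have "\<exists>x0. x0 \<in> ?V \<and> x0 \<noteq> 0"
    proof -
      have "card S < CARD('n)" using insert by (metis UNIV_I card_mono finite_code insertI1 psubset_card_mono psubset_eq subset_UNIV)
      moreover have "dim (q ` S) \<le> card S"
        using insert(1) card_image_le[of S q] dim_le_card'[of "q ` S"] by simp
      ultimately have "dim (q ` S) < DIM(real^'n)" by simp
      then obtain x0 where "x0 \<noteq> 0" "\<And>y. y \<in> span (q ` S) \<Longrightarrow> orthogonal x0 y"
        using orthogonal_to_subspace_exists by blast
      then show ?thesis by (auto simp: orthogonal_def span_base intro!: exI[of _ x0])
    qed
    ultimately obtain x c where x: "x \<in> ?V" "norm x = 1" "A *v x = c *\<^sub>R x"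
      using symmetric_eigenvector[OF sym, of ?V] by (smt (verit) mem_Collect_eq)
    show ?case
      using q x insert(2) 
      by (intro exI[of _ "q(k := x)"] exI[of _ "d(k := c)"]) (auto simp: inner_commute norm_eq_1 dest: bspec)
  qed simp
  from this[OF finite_class.finite_UNIV] obtain q :: "'n \<Rightarrow> real^'n" and d where
    q: "\<And>i j. q i \<bullet> q j = (if i = j then 1 else 0)" "\<And>i. A *v q i = d i *\<^sub>R q i" by auto
  define g where "g = (\<chi> i j. q j $ i)"
  have cg: "column j g = q j" for j by (simp add: column_def g_def vec_eq_iff)
  have "g \<in> stiefel" by (simp add: stiefel_iff cg q)
  then have g: "orthogonal_matrix g" by (simp add: stiefel_def orthogonal_matrix)
  have "column j (A ** g) = column j (g ** diag_matrix d)" for j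
    by (simp add: column_matrix_mult cg q)
       (simp add: g_def column_def diag_matrix_def matrix_vector_mult_def vec_eq_iff if_distrib cong: if_cong)
  then have "A ** g = g ** diag_matrix d"
    by (metis (no_types, lifting) vec_eq_iff column_def vec_lambda_beta)
  then have "A ** g ** transpose g = g ** diag_matrix d ** transpose g" by simp
  then show ?thesis using g that by (simp add: matrix_mul_assoc[symmetric] orthogonal_matrixD)
qed


section \<open>Positive definite matrices and their square roots\<close>

lemma pos_def_symmetric: "r \<in> pos_def_matrices \<Longrightarrow> transpose r = r"
  and pos_def_pos: "r \<in> pos_def_matrices \<Longrightarrow> y \<noteq> 0 \<Longrightarrow> 0 < y \<bullet> (r *v y)"
  by (auto simp: pos_def_matrices_def)

lemma pos_def_nonneg: "r \<in> pos_def_matrices \<Longrightarrow> 0 \<le> (r *v y) \<bullet> y"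
  using pos_def_pos[of r y] by (cases "y = 0") (simp_all add: inner_commute)

lemma inner_gram: "y \<bullet> ((transpose A ** A) *v y) = (A *v y) \<bullet> ((A :: real^'m^'n) *v y)"
  by (metis dot_lmul_matrix inner_commute matrix_vector_mul_assoc transpose_matrix_vector transpose_transpose)

lemma transpose_gram: "transpose (transpose A ** A) = transpose A ** (A :: real^'m^'n)"
  by (simp add: matrix_transpose_mul)

lemma pos_def_add_gram:
  assumes "r \<in> pos_def_matrices"
  shows "r + transpose A ** A \<in> pos_def_matrices"
  using assms
  by (auto simp: pos_def_matrices_def transpose_add transpose_gram matrix_vector_mult_add_rdistrib inner_add_right inner_gram
      intro!: add_pos_nonneg)

lemma pos_def_congruence:
  assumes "r \<in> pos_def_matrices" "invertible X"
  shows "transpose X ** r ** X \<in> pos_def_matrices"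
proof -
  have "y \<bullet> ((transpose X ** r ** X) *v y) = (X *v y) \<bullet> (r *v (X *v y))" for y
    by (metis dot_lmul_matrix inner_commute matrix_vector_mul_assoc transpose_matrix_vector transpose_transpose)
  moreover have "X *v y \<noteq> 0" if "y \<noteq> 0" for y
    using that assms(2) by (metis invertible_def matrix_left_invertible_ker)
  ultimately show ?thesis
    using assms(1) by (auto simp: pos_def_matrices_def matrix_transpose_mul matrix_mul_assoc)
qed

lemma pos_def_congruence_iff:
  assumes "invertible X"
  shows "transpose X ** r ** X \<in> pos_def_matrices \<longleftrightarrow> r \<in> pos_def_matrices"
proof
  assume *: "transpose X ** r ** X \<in> pos_def_matrices"
  obtain Y where Y: "X ** Y = mat 1" "Y ** X = mat 1" using assms by (auto simp: invertible_def)
  then have "invertible Y" by (auto simp: invertible_def)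
  from pos_def_congruence[OF * this]
  have "transpose (X ** Y) ** r ** (X ** Y) \<in> pos_def_matrices"
    by (simp add: matrix_transpose_mul matrix_mul_assoc)
  then show "r \<in> pos_def_matrices" by (simp add: Y transpose_mat matrix_mul_lid matrix_mul_rid)
qed (use pos_def_congruence assms in blast)

lemma pos_def_diag_iff: "diag_matrix d \<in> pos_def_matrices \<longleftrightarrow> (\<forall>i. 0 < d i)"
proof
  assume *: "diag_matrix d \<in> pos_def_matrices"
  show "\<forall>i. 0 < d i"
  proof
    fix i
    have "0 < axis i 1 \<bullet> (diag_matrix d *v axis i 1)" using * by (intro pos_def_pos) auto
    then show "0 < d i" by (simp add: diag_matrix_mult_vec inner_axis')
  qed
next
  assume *: "\<forall>i. 0 < d i"
  have "0 < y \<bullet> (diag_matrix d *v y)" if y: "y \<noteq> 0" for y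
  proof -
    obtain i where i: "y $ i \<noteq> 0" using y by (auto simp: vec_eq_iff)
    have "0 < (\<Sum>i\<in>UNIV. y $ i * (d i * y $ i))"
      using * i by (intro sum_pos2[of _ i])
        (auto simp: mult.left_commute zero_less_mult_iff less_imp_le zero_le_mult_iff less_le)
    then show ?thesis by (simp add: inner_vec_def diag_matrix_mult_vec)
  qed
  then show "diag_matrix d \<in> pos_def_matrices" by (simp add: pos_def_matrices_def)
qed

lemma pos_def_spectral:
  assumes "r \<in> pos_def_matrices"
  obtains g d where "orthogonal_matrix g" "\<And>i. 0 < d i" "r = g ** diag_matrix d ** transpose g"
proof -
  obtain g d where gd: "orthogonal_matrix g" "r = g ** diag_matrix d ** transpose g"
    using symmetric_matrix_spectral[OF pos_def_symmetric[OF assms]] .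
  have "invertible g" using gd(1) by (auto simp: invertible_def orthogonal_matrix_def)
  from pos_def_congruence[OF assms this] have "diag_matrix d \<in> pos_def_matrices"
    using gd by (simp add: matrix_mul_assoc[symmetric] orthogonal_matrixD)
  then show ?thesis using that[OF gd(1) _ gd(2)] by (simp add: pos_def_diag_iff)
qed

lemma pos_def_det_pos:
  assumes "r \<in> pos_def_matrices"
  shows "0 < det r"
proof -
  obtain g d where gd: "orthogonal_matrix g" "\<And>i. 0 < d i" "r = g ** diag_matrix d ** transpose g"
    using pos_def_spectral[OF assms] by blast
  have "det r = (\<Prod>i\<in>UNIV. d i) * (det g * det g)" by (simp add: gd det_mul det_diag_matrix)
  also have "det g * det g = 1" using det_orthogonal_matrix[OF gd(1)] by auto
  finally show ?thesis using gd(2) by (simp add: prod_pos)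
qed

lemma pos_def_invertible: "r \<in> pos_def_matrices \<Longrightarrow> invertible r"
  using pos_def_det_pos[of r] by (simp add: invertible_det_nz)

lemma pos_def_sqrt_exists:
  assumes "r \<in> pos_def_matrices"
  obtains q where "q \<in> pos_def_matrices" "q ** q = r"
proof -
  obtain g d where gd: "orthogonal_matrix g" "\<And>i. 0 < d i" "r = g ** diag_matrix d ** transpose g"
    using pos_def_spectral[OF assms] by blast
  let ?q = "g ** diag_matrix (\<lambda>i. sqrt (d i)) ** transpose g"
  have "invertible (transpose g)" using gd(1) by (auto simp: invertible_def orthogonal_matrix_def)
  then have "?q \<in> pos_def_matrices"
    using pos_def_congruence[of "diag_matrix (\<lambda>i. sqrt (d i))" "transpose g"] gd(2) by (simp add: pos_def_diag_iff)
  moreover have "?q ** ?q = g ** (diag_matrix (\<lambda>i. sqrt (d i)) ** diag_matrix (\<lambda>i. sqrt (d i))) ** transpose g"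
    by (simp add: matrix_mul_assoc[symmetric] orthogonal_matrixD[OF gd(1)])
  then have "?q ** ?q = r" using gd(2) by (simp add: diag_matrix_mult gd(3) less_imp_le)
  ultimately show ?thesis by (rule that)
qed

lemma pos_def_lower_bound:
  assumes p: "p \<in> pos_def_matrices"
  obtains c where "0 < c" "\<And>y. c * (y \<bullet> y) \<le> y \<bullet> (p *v y)"
proof -
  obtain g d where gd: "orthogonal_matrix g" "\<And>i. 0 < d i" "p = g ** diag_matrix d ** transpose g"
    using pos_def_spectral[OF p] by blast
  have "Min (range d) * (y \<bullet> y) \<le> y \<bullet> (p *v y)" for y
  proof -
    let ?x = "transpose g *v y"
    have "y \<bullet> y = ?x \<bullet> ?x" using gd(1) by (simp add: orthogonal_matrix_inner del: transpose_matrix_vector)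
    moreover have "y \<bullet> (p *v y) = ?x \<bullet> (diag_matrix d *v ?x)"
      unfolding gd(3) matrix_vector_mul_assoc[symmetric] by (metis dot_lmul_matrix transpose_matrix_vector)
    moreover have "Min (range d) * (?x \<bullet> ?x) \<le> ?x \<bullet> (diag_matrix d *v ?x)"
      unfolding inner_vec_def diag_matrix_mult_vec sum_distrib_left
      by (intro sum_mono) (auto simp: mult.left_commute intro!: mult_right_mono)
    ultimately show ?thesis by simp
  qed
  moreover have "0 < Min (range d)" using gd(2) by simp
  ultimately show ?thesis using that by blast
qed

text \<open>
  The difference $q - p$ solves the Sylvester equation $q d + d p = q^2 - p^2$; pairing it with
  $d$ controls $d$ by the smallest eigenvalue of $p$.
\<close>

lemma pos_def_sqrt_diff_bound:
  assumes q: "q \<in> pos_def_matrices" and p: "p \<in> pos_def_matrices"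
    and c: "\<And>y. c * (y \<bullet> y) \<le> y \<bullet> (p *v y)"
  shows "c * norm (q - p) \<le> norm (q ** q - p ** p)"
proof (cases "q = p")
  case False
  let ?d = "q - p"
  have "q ** ?d + ?d ** p = q ** q - p ** p"
    by (simp add: matrix_matrix_mult_def vec_eq_iff algebra_simps sum_subtractf)
  then have "(q ** q - p ** p) \<bullet> ?d = (q ** ?d) \<bullet> ?d + (?d ** p) \<bullet> ?d"
    by (simp flip: inner_add_left)
  moreover have "0 \<le> (q ** ?d) \<bullet> ?d"
    unfolding inner_matrix_columns column_matrix_mult using q
    by (intro sum_nonneg pos_def_nonneg)
  moreover have "c * (?d \<bullet> ?d) \<le> (?d ** p) \<bullet> ?d"
    unfolding inner_matrix_rows row_matrix_mult sum_distrib_left pos_def_symmetric[OF p]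
    by (intro sum_mono) (metis c inner_commute)
  ultimately have "c * (norm ?d * norm ?d) \<le> (q ** q - p ** p) \<bullet> ?d"
    by (simp add: dot_square_norm power2_eq_square)
  also have "\<dots> \<le> norm (q ** q - p ** p) * norm ?d" by (rule norm_cauchy_schwarz)
  finally show ?thesis using False by simp
qed simp

lemma pos_def_sqrt_unique:
  assumes q: "q \<in> pos_def_matrices" and p: "p \<in> pos_def_matrices" and "q ** q = p ** p"
  shows "q = p"
proof -
  obtain c where "0 < c" "\<And>y. c * (y \<bullet> y) \<le> y \<bullet> (p *v y)" using pos_def_lower_bound[OF p] by blast
  with pos_def_sqrt_diff_bound[OF q p, of c] assms(3) show ?thesis
    by (simp add: mult_le_0_iff)
qed

lemma pos_def_sqrt_eq:
  assumes "q \<in> pos_def_matrices" "q ** q = r"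
  shows "pos_def_sqrt r = q"
  unfolding pos_def_sqrt_def using assms by (intro the_equality) (auto intro: pos_def_sqrt_unique)

lemma pos_def_sqrt:
  assumes "r \<in> pos_def_matrices"
  shows "pos_def_sqrt r \<in> pos_def_matrices" "pos_def_sqrt r ** pos_def_sqrt r = r"
  using pos_def_sqrt_exists[OF assms] pos_def_sqrt_eq by metis+

lemma pos_def_square: "q \<in> pos_def_matrices \<Longrightarrow> q ** q \<in> pos_def_matrices"
  using pos_def_congruence[of "mat 1" q] pos_def_invertible[of q] pos_def_symmetric[of q]
  by (simp add: matrix_mul_rid pos_def_matrices_def[of] transpose_mat matrix_vector_mul_lid)

text \<open>\<open>pos_def_sqrt_diff_bound\<close> bounds the difference from the root of a fixed
  \<open>r\<close> by 1/c times the distance to \<open>r\<close>, where \<open>c\<close> bounds that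
  root from below.\<close>

lemma continuous_on_pos_def_sqrt: "continuous_on pos_def_matrices pos_def_sqrt"
  unfolding continuous_on_iff
proof (intro ballI allI impI)
  fix r :: "real^'n^'n" and e :: real assume r: "r \<in> pos_def_matrices" and e: "0 < e"
  obtain c where c: "0 < c" "\<And>y. c * (y \<bullet> y) \<le> y \<bullet> (pos_def_sqrt r *v y)"
    using pos_def_lower_bound[OF pos_def_sqrt(1)[OF r]] by blast
  have "dist (pos_def_sqrt r') (pos_def_sqrt r) < e" if "r' \<in> pos_def_matrices" "dist r' r < c * e" for r'
  proof -
    have "c * norm (pos_def_sqrt r' - pos_def_sqrt r) \<le> norm (r' - r)"
      using pos_def_sqrt_diff_bound[OF pos_def_sqrt(1)[OF that(1)] pos_def_sqrt(1)[OF r] c(2)]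
      by (simp add: pos_def_sqrt that r)
    also have "\<dots> < c * e" using that(2) by (simp add: dist_norm)
    finally show ?thesis using c(1) by (simp add: dist_norm)
  qed
  then show "\<exists>d>0. \<forall>x'\<in>pos_def_matrices. dist x' r < d \<longrightarrow> dist (pos_def_sqrt x') (pos_def_sqrt r) < e"
    using c(1) e by (intro exI[of _ "c * e"]) auto
qed

text \<open>The cone is a countable union of closed sets: with the lower bound 1/(n+1) on the
  quadratic form, the condition over uncountably many \<open>y\<close> is closed. Compactness, in
  the form of \<open>pos_def_lower_bound\<close>, is not repeated here.\<close>

lemma pos_def_matrices_borel [measurable]: "pos_def_matrices \<in> sets (borel :: (real^'n^'n) measure)"
proof -
  let ?C = "\<lambda>n::nat. {r :: real^'n^'n. transpose r = r} \<inter> {r. \<forall>y. (y \<bullet> y) / real (Suc n) \<le> y \<bullet> (r *v y)}"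
  have "r \<in> (\<Union>n. ?C n)" if r: "r \<in> pos_def_matrices" for r
  proof -
    obtain c where c: "0 < c" "\<And>y. c * (y \<bullet> y) \<le> y \<bullet> (r *v y)" using pos_def_lower_bound[OF r] by blast
    obtain n where n: "inverse (real (Suc n)) < c" using reals_Archimedean c(1) by blast
    have "(y \<bullet> y) / real (Suc n) \<le> y \<bullet> (r *v y)" for y
    proof -
      have "(y \<bullet> y) / real (Suc n) = inverse (real (Suc n)) * (y \<bullet> y)" by (rule trans[OF divide_inverse mult.commute])
      also have "\<dots> \<le> c * (y \<bullet> y)" using n by (intro mult_right_mono) auto
      also have "\<dots> \<le> y \<bullet> (r *v y)" by (rule c(2))
      finally show ?thesis .
    qed
    then show ?thesis using pos_def_symmetric[OF r] by auto
  qed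
  moreover have "r \<in> pos_def_matrices" if r: "r \<in> ?C n" for r n
  proof -
    have "0 < y \<bullet> (r *v y)" if "y \<noteq> 0" for y
    proof -
      have "0 < (y \<bullet> y) / real (Suc n)" using that by simp
      also have "\<dots> \<le> y \<bullet> (r *v y)" using r by blast
      finally show ?thesis .
    qed
    then show ?thesis using r by (simp add: pos_def_matrices_def)
  qed
  ultimately have eq: "pos_def_matrices = (\<Union>n. ?C n)" by blast
  have "closed (?C n)" for n
    unfolding transpose_def matrix_vector_mult_def
    by (intro closed_Int closed_Collect_eq closed_Collect_all closed_Collect_le continuous_intros)
  then show ?thesis unfolding eq by (intro sets.countable_UN) auto
qed

text \<open>The square of a positive definite matrix is positive definite, so outside the cone the
  description has no candidate and always denotes the same value. Hence measurability on the cone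
  extends to the whole space.\<close>

lemma pos_def_sqrt_outside: "r \<notin> pos_def_matrices \<Longrightarrow> pos_def_sqrt r = (THE q. False)"
  unfolding pos_def_sqrt_def using pos_def_square by (intro arg_cong[where f=The]) auto

lemma borel_measurable_pos_def_sqrt [measurable]: "pos_def_sqrt \<in> borel_measurable borel"
proof -
  have "(\<lambda>r. if r \<in> pos_def_matrices then pos_def_sqrt r else (THE q. False)) \<in> borel_measurable borel"
    by (intro borel_measurable_continuous_on_if continuous_on_pos_def_sqrt) auto
  also have "(\<lambda>r. if r \<in> pos_def_matrices then pos_def_sqrt r else (THE q. False)) = pos_def_sqrt"
    by (auto simp: fun_eq_iff pos_def_sqrt_outside)
  finally show ?thesis .
qed

lemma borel_measurable_matrix_mult [measurable (raw)]:
  fixes f :: "'a \<Rightarrow> real^'m^'n" and g :: "'a \<Rightarrow> real^'k^'m"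
  assumes "f \<in> borel_measurable M" "g \<in> borel_measurable M"
  shows "(\<lambda>x. f x ** g x) \<in> borel_measurable M"
proof (rule borel_measurable_continuous_Pair[OF assms])
  show "continuous_on UNIV (\<lambda>p. fst p ** snd p :: real^'k^'n)"
    unfolding matrix_matrix_mult_def by (intro continuous_intros)
qed

lemma borel_measurable_matrix_vector_mult [measurable (raw)]:
  fixes f :: "'a \<Rightarrow> real^'m^'n" and g :: "'a \<Rightarrow> real^'m"
  assumes "f \<in> borel_measurable M" "g \<in> borel_measurable M"
  shows "(\<lambda>x. f x *v g x) \<in> borel_measurable M"
proof (rule borel_measurable_continuous_Pair[OF assms])
  show "continuous_on UNIV (\<lambda>p. fst p *v snd p :: real^'n)"
    unfolding matrix_vector_mult_def by (intro continuous_intros)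
qed

lemma borel_measurable_det [measurable]: "det \<in> borel_measurable (borel :: (real^'n^'n) measure)"
  by (intro borel_measurable_continuous_onI) (auto simp: det_def intro!: continuous_intros)

lemma stiefel_borel [measurable]: "stiefel \<in> sets (borel :: (real^'m^'n) measure)"
  unfolding stiefel_def by measurable

lemma polar_decomposition:
  fixes y :: "real^'m^'n"
  assumes "transpose y ** y = r" "r \<in> pos_def_matrices"
  obtains v where "v \<in> stiefel" "v ** pos_def_sqrt r = y"
proof -
  define q where "q = pos_def_sqrt r"
  have q: "q \<in> pos_def_matrices" "r = q ** q" using pos_def_sqrt[OF assms(2)] by (simp_all add: q_def)
  obtain p where inv: "q ** p = mat 1" "p ** q = mat 1"
    using pos_def_invertible[OF q(1)] by (auto simp: invertible_def)
  have tp: "transpose p ** q = mat 1"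
    using arg_cong[OF inv(1), of transpose] pos_def_symmetric[OF q(1)]
    by (simp add: matrix_transpose_mul transpose_mat)
  have "transpose (y ** p) ** (y ** p) = transpose p ** (transpose y ** y) ** p"
    by (simp add: matrix_transpose_mul matrix_mul_assoc)
  also have "\<dots> = (transpose p ** q) ** (q ** p)"
    by (simp only: assms(1) q(2) matrix_mul_assoc)
  finally have "y ** p \<in> stiefel" by (simp add: stiefel_def tp inv matrix_mul_lid)
  moreover have "(y ** p) ** q = y" by (simp add: matrix_mul_assoc[symmetric] inv matrix_mul_rid)
  ultimately show ?thesis unfolding q_def by (rule that)
qed

section \<open>Haar measure and Stiefel manifolds\<close>

text \<open>The determinant is a polynomial in \<open>c\<close>. It is not the zero polynomial,
  because a shift by more than a bound for the operator \<open>A\<close> is injective.\<close>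

lemma finite_singular_shift: "finite {c. det (A + c *\<^sub>R mat 1 :: real^'n^'n) = 0}"
proof -
  define P :: "real poly^'n^'n" where "P = (\<chi> i j. [:A $ i $ j, if i = j then 1 else 0:])"
  have poly_det: "poly (det P) c = det (A + c *\<^sub>R mat 1)" for c
  proof -
    have "poly (P $ i $ j) c = (A + c *\<^sub>R mat 1) $ i $ j" for i j
      by (simp add: P_def mat_def)
    then show ?thesis by (simp add: det_def poly_sum poly_prod)
  qed
  obtain K where K: "\<And>y. norm (A *v y) \<le> norm y * K"
    using bounded_linear.bounded[OF matrix_vector_mul_bounded_linear[of A]] by auto
  have "invertible (A + (\<bar>K\<bar> + 1) *\<^sub>R mat 1)"
  proof -
    have "y = 0" if y: "(A + (\<bar>K\<bar> + 1) *\<^sub>R mat 1) *v y = 0" for y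
    proof (rule ccontr)
      assume "y \<noteq> 0"
      have "A *v y = - ((\<bar>K\<bar> + 1) *\<^sub>R y)"
        using y by (simp add: matrix_vector_mult_add_rdistrib scaleR_matrix_vector_assoc[symmetric] eq_neg_iff_add_eq_0)
      then have "(\<bar>K\<bar> + 1) * norm y \<le> norm y * K"
        using K[of y] by simp
      also have "\<dots> \<le> norm y * \<bar>K\<bar>" by (intro mult_left_mono) auto
      finally show False using \<open>y \<noteq> 0\<close> by (simp add: algebra_simps)
    qed
    then show ?thesis
      by (metis invertible_left_inverse matrix_left_invertible_ker)
  qed
  then have "det P \<noteq> 0" using poly_det[of "\<bar>K\<bar> + 1"] by (auto simp: invertible_det_nz)
  then show ?thesis using poly_roots_finite[of "det P"] by (simp add: poly_det)
qed

text \<open>The volume of the singular set is averaged over its translates by multiples of the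
  identity. By Fubini only its intersections with lines in that direction count, and these are
  finite.\<close>

lemma AE_det_nonzero: "AE A in lborel. det (A :: real^'n^'n) \<noteq> 0"
proof -
  let ?N = "{A :: real^'n^'n. det A = 0}"
  let ?I = "{0..1::real}"
  have [measurable]: "?N \<in> sets borel" by measurable
  have "emeasure lborel ?N = (\<integral>\<^sup>+c. indicator ?I c * emeasure lborel ?N \<partial>lborel)"
    by (simp add: nn_integral_multc)
  also have "\<dots> = (\<integral>\<^sup>+c. \<integral>\<^sup>+A. indicator ?I c * indicator ?N (A + c *\<^sub>R mat 1) \<partial>lborel \<partial>lborel)"
  proof (rule nn_integral_cong)
    fix c
    show "indicator ?I c * emeasure lborel ?N = (\<integral>\<^sup>+A. indicator ?I c * indicator ?N (A + c *\<^sub>R mat 1) \<partial>lborel)"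
      using nn_integral_lborel_shift[of "\<lambda>A. indicator ?I c * indicator ?N A" "c *\<^sub>R mat 1"]
      by (simp add: nn_integral_cmult)
  qed
  also have "\<dots> = (\<integral>\<^sup>+A. \<integral>\<^sup>+c. indicator ?I c * indicator ?N (A + c *\<^sub>R mat 1) \<partial>lborel \<partial>lborel)"
    by (rule lborel_pair_swap) measurable
  also have "\<dots> = (\<integral>\<^sup>+(A :: real^'n^'n). 0 \<partial>lborel)"
  proof (rule nn_integral_cong)
    fix A :: "real^'n^'n"
    have "AE c in lborel. c \<notin> {c. det (A + c *\<^sub>R mat 1) = 0}"
      by (intro AE_not_in finite_imp_null_set_lborel finite_singular_shift)
    then have "AE c in lborel. indicator ?I c * indicator ?N (A + c *\<^sub>R mat 1) = (0 :: ennreal)"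
      by eventually_elim auto
    then show "(\<integral>\<^sup>+c. indicator ?I c * indicator ?N (A + c *\<^sub>R mat 1) \<partial>lborel) = 0"
      by (subst nn_integral_0_iff_AE) auto
  qed
  finally show ?thesis by (intro AE_I'[of ?N]) (auto simp: null_sets_def)
qed

text \<open>The entries are quotients of polynomials in the entries of \<open>q\<close>, so that
  Borel measurability on the whole space, singular matrices included, can be read off.\<close>

definition cramer_inverse :: "real^'n^'n \<Rightarrow> real^'n^'n" where
  "cramer_inverse q = (\<chi> k l. det (\<chi> i j. if j = k then axis l 1 $ i else q $ i $ j) / det q)"

lemma cramer_inverse: "det q \<noteq> 0 \<Longrightarrow> q ** cramer_inverse q = mat 1"
proof -
  assume q: "det q \<noteq> 0"
  have "q *v column l (cramer_inverse q) = axis l 1" for l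
    using cramer[OF q, of "column l (cramer_inverse q)" "axis l 1"]
    by (simp add: cramer_inverse_def column_def)
  then have "column l (q ** cramer_inverse q) = column l (mat 1)" for l
    by (simp add: column_matrix_mult) (auto simp: column_def mat_def axis_def vec_eq_iff)
  then show ?thesis by (simp add: column_def vec_eq_iff)
qed

lemma borel_measurable_cramer_inverse [measurable]: "cramer_inverse \<in> borel_measurable borel"
proof -
  have c: "continuous_on UNIV (\<lambda>q :: real^'n^'n. \<chi> k l. det (\<chi> i j. if j = k then axis l 1 $ i else q $ i $ j))"
  proof -
    have "continuous_on UNIV (\<lambda>q :: real^'n^'n. if j = k then b else q $ i $ j)" for i j k b
      by (cases "j = k") (auto intro!: continuous_intros)
    then show ?thesis unfolding det_def by (auto intro!: continuous_intros)
  qed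
  have "(\<lambda>q. inverse (det q) *\<^sub>R (\<chi> k l. det (\<chi> i j. if j = k then axis l 1 $ i else q $ i $ j))) \<in> borel_measurable borel"
    using borel_measurable_continuous_onI[OF c] by measurable
  then show ?thesis
    by (rule measurable_cong[THEN iffD1, rotated]) (simp add: cramer_inverse_def vec_eq_iff divide_inverse mult.commute)
qed

text \<open>The orthogonal factor \<open>u\<close> in A = u q. The value \<open>mat 1\<close> on the
  null set of singular matrices keeps every value orthogonal, so that the image measure lives on
  O(n).\<close>

definition polar_part :: "real^'n^'n \<Rightarrow> real^'n^'n" where
  "polar_part A = (if det A = 0 then mat 1 else A ** cramer_inverse (pos_def_sqrt (transpose A ** A)))"

lemma borel_measurable_polar_part [measurable]: "polar_part \<in> borel_measurable borel"
  unfolding polar_part_def by measurable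

lemma gram_pos_def:
  assumes "det A \<noteq> 0"
  shows "transpose A ** A \<in> pos_def_matrices"
proof -
  have "mat 1 \<in> pos_def_matrices" by (simp add: pos_def_matrices_def transpose_mat)
  from pos_def_congruence[OF this, of A] assms show ?thesis
    by (simp add: invertible_det_nz matrix_mul_rid)
qed

lemma polar_part_eq:
  assumes u: "orthogonal_matrix u" and q: "q \<in> pos_def_matrices" and A: "A = u ** q"
  shows "polar_part A = u"
proof -
  have d: "det q \<noteq> 0" "det A \<noteq> 0"
    using pos_def_det_pos[OF q] det_orthogonal_matrix[OF u] by (auto simp: A det_mul)
  have "transpose A ** A = q ** q"
    by (simp add: A matrix_transpose_mul pos_def_symmetric[OF q] matrix_mul_assoc[symmetric] orthogonal_matrixD[OF u])
  then have "pos_def_sqrt (transpose A ** A) = q" using q by (simp add: pos_def_sqrt_eq)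
  then show ?thesis using d by (simp add: polar_part_def A matrix_mul_assoc[symmetric] cramer_inverse matrix_mul_rid)
qed

lemma polar_part:
  assumes "det A \<noteq> 0"
  obtains q where "q \<in> pos_def_matrices" "orthogonal_matrix (polar_part A)" "A = polar_part A ** q"
proof -
  let ?r = "transpose A ** A"
  obtain v where v: "v \<in> stiefel" "v ** pos_def_sqrt ?r = A"
    using polar_decomposition[OF refl gram_pos_def[OF assms]] .
  have v': "orthogonal_matrix v" using v(1) by (simp add: stiefel_def orthogonal_matrix)
  have q: "pos_def_sqrt ?r \<in> pos_def_matrices" using gram_pos_def[OF assms] by (rule pos_def_sqrt)
  have "polar_part A = v" using polar_part_eq[OF v' q] v(2) by simp
  then show ?thesis using v' q v(2) that by metis
qed

lemma orthogonal_polar_part: "orthogonal_matrix (polar_part A)"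
proof (cases "det A = 0")
  case False
  show ?thesis by (rule polar_part[OF False])
qed (simp add: polar_part_def orthogonal_matrix_id)

lemma polar_part_mult_left:
  assumes "orthogonal_matrix g" "det A \<noteq> 0"
  shows "polar_part (g ** A) = g ** polar_part A"
proof -
  obtain q where q: "q \<in> pos_def_matrices" "orthogonal_matrix (polar_part A)" "A = polar_part A ** q"
    using polar_part[OF assms(2)] .
  have "g ** A = g ** polar_part A ** q"
    unfolding matrix_mul_assoc[symmetric] by (rule arg_cong[OF q(3)])
  then show ?thesis
    by (intro polar_part_eq[OF _ q(1)]) (simp_all add: orthogonal_matrix_mul assms(1) q(2))
qed

text \<open>From A = u q follows A g = (u g)(g' q g), again orthogonal times positive definite, and
  the decomposition is unique.\<close>

lemma polar_part_mult_right:
  assumes "orthogonal_matrix g" "det A \<noteq> 0"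
  shows "polar_part (A ** g) = polar_part A ** g"
proof -
  obtain q where q: "q \<in> pos_def_matrices" "orthogonal_matrix (polar_part A)" "A = polar_part A ** q"
    using polar_part[OF assms(2)] .
  have "invertible g" using assms(1) by (auto simp: invertible_def orthogonal_matrix_def)
  then have q': "transpose g ** q ** g \<in> pos_def_matrices" by (rule pos_def_congruence[OF q(1)])
  have "A ** g = (polar_part A ** q) ** g" by (rule arg_cong[OF q(3)])
  also have "\<dots> = (polar_part A ** g) ** (transpose g ** q ** g)"
    by (simp add: matrix_mul_assoc[symmetric] orthogonal_matrixD[OF assms(1)])
  finally show ?thesis
    by (intro polar_part_eq[OF _ q']) (simp_all add: orthogonal_matrix_mul assms(1) q(2))
qed

lemma orthogonal_matrices_borel [measurable]: "Collect orthogonal_matrix \<in> sets (borel :: (real^'n^'n) measure)"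
  unfolding orthogonal_matrix_def by measurable

text \<open>The law of the orthogonal factor of a random matrix with a bi-invariant distribution.\<close>

definition haar :: "(real^'n^'n) measure" where
  "haar = distr (uniform_measure lborel (ball 0 1)) (restrict_space borel (Collect orthogonal_matrix)) polar_part"

lemma space_haar [simp]: "space haar = Collect orthogonal_matrix"
  by (simp add: haar_def space_restrict_space)

lemma measurable_polar_part: "polar_part \<in> measurable (uniform_measure lborel (ball 0 1)) (restrict_space borel (Collect orthogonal_matrix))"
  by (intro measurable_restrict_space2) (auto simp: orthogonal_polar_part)

lemma sets_haar: "sets haar = sets (restrict_space borel (Collect orthogonal_matrix))"
  by (simp add: haar_def)

lemma measurable_haar_borel [measurable (raw)]:
  "f \<in> measurable borel N \<Longrightarrow> f \<in> measurable haar N"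
  unfolding measurable_cong_sets[OF sets_haar refl] by (rule measurable_restrict_space1)

lemma haar_ident: "(\<lambda>g. g) \<in> measurable haar borel"
  by (rule measurable_haar_borel) simp

lemma borel_measurable_fst_haar [measurable (raw)]:
  "f \<in> measurable N (haar \<Otimes>\<^sub>M M) \<Longrightarrow> (\<lambda>x. fst (f x)) \<in> borel_measurable N"
  by (rule measurable_compose[OF measurable_compose[OF _ measurable_fst] haar_ident])

lemma borel_measurable_snd_haar [measurable (raw)]:
  "f \<in> measurable N (M \<Otimes>\<^sub>M haar) \<Longrightarrow> (\<lambda>x. snd (f x)) \<in> borel_measurable N"
  by (rule measurable_compose[OF measurable_compose[OF _ measurable_snd] haar_ident])

lemma emeasure_ball_pos_finite:
  "emeasure lborel (ball (0::'a::euclidean_space) 1) \<noteq> 0" "emeasure lborel (ball (0::'a) 1) \<noteq> \<infinity>"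
  using emeasure_lborel_ball_finite[of "0::'a" 1]
  by (auto simp: emeasure_ball unit_ball_vol_pos ennreal_eq_0_iff not_le)

lemma emeasure_haar_orthogonal [simp]:
  "emeasure haar (Collect orthogonal_matrix :: (real^'n^'n) set) = 1"
proof -
  let ?U = "uniform_measure lborel (ball (0 :: real^'n^'n) 1)"
  have "emeasure haar (Collect orthogonal_matrix :: (real^'n^'n) set) = emeasure ?U (polar_part -` Collect orthogonal_matrix \<inter> space ?U)"
    unfolding haar_def by (rule emeasure_distr[OF measurable_polar_part]) (simp add: sets_restrict_space_iff)
  also have "polar_part -` Collect orthogonal_matrix \<inter> space ?U = UNIV"
    by (auto simp: orthogonal_polar_part)
  finally show ?thesis
    using emeasure_ball_pos_finite[where 'a="real^'n^'n"] by (simp add: ennreal_divide_self less_top)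
qed

interpretation haar: finite_measure "haar :: (real^'n^'n) measure"
  by standard simp

lemma nn_integral_haar:
  fixes h :: "real^'n^'n \<Rightarrow> ennreal"
  assumes [measurable]: "h \<in> borel_measurable borel"
  shows "(\<integral>\<^sup>+g. h g \<partial>haar) =
    (\<integral>\<^sup>+A. h (polar_part A) * indicator (ball 0 1) A \<partial>lborel) / emeasure lborel (ball (0::real^'n^'n) 1)"
  unfolding haar_def
  by (subst nn_integral_distr[OF measurable_polar_part])
     (auto intro!: measurable_restrict_space1 simp: nn_integral_uniform_measure)

text \<open>The map \<open>f\<close> preserves Lebesgue measure and the unit ball, and it commutes
  with \<open>polar_part\<close> off the null set of singular matrices. Left and right
  multiplications are both of this kind.\<close>

lemma nn_integral_haar_invariant:
  fixes h :: "real^'n^'n \<Rightarrow> ennreal" and f :: "real^'n^'n \<Rightarrow> real^'n^'n"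
  assumes [measurable]: "h \<in> borel_measurable borel" and f: "orthogonal_transformation f"
    and [measurable]: "f \<in> borel_measurable borel"
    and eq: "\<And>A. det A \<noteq> 0 \<Longrightarrow> polar_part (f A) = f (polar_part A)"
  shows "(\<integral>\<^sup>+g. h (f g) \<partial>haar) = (\<integral>\<^sup>+g. h g \<partial>haar)"
proof -
  have [measurable]: "ball (0::real^'n^'n) 1 \<in> sets borel" by simp
  have "(\<integral>\<^sup>+A. h (polar_part A) * indicator (ball 0 1) A \<partial>lborel)
     = (\<integral>\<^sup>+A. h (polar_part A) * indicator (ball 0 1) A \<partial>distr lborel borel f)"
    by (simp add: lborel_distr_orthogonal[OF f])
  also have "\<dots> = (\<integral>\<^sup>+A. h (polar_part (f A)) * indicator (ball 0 1) (f A) \<partial>lborel)"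
    by (subst nn_integral_distr) simp_all
  also have "\<dots> = (\<integral>\<^sup>+A. h (f (polar_part A)) * indicator (ball 0 1) A \<partial>lborel)"
    using AE_det_nonzero
    by (intro nn_integral_cong_AE) (auto elim!: eventually_mono simp: eq indicator_def orthogonal_transformation_norm[OF f])
  finally show ?thesis by (simp add: nn_integral_haar)
qed

lemma nn_integral_haar_left:
  fixes h :: "real^'n^'n \<Rightarrow> ennreal"
  assumes "h \<in> borel_measurable borel" "orthogonal_matrix \<gamma>"
  shows "(\<integral>\<^sup>+g. h (\<gamma> ** g) \<partial>haar) = (\<integral>\<^sup>+g. h g \<partial>haar)"
  using assms
  by (intro nn_integral_haar_invariant) (auto intro: orthogonal_transformation_matrix_mult_left polar_part_mult_left)

lemma nn_integral_haar_right:
  fixes h :: "real^'n^'n \<Rightarrow> ennreal"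
  assumes "h \<in> borel_measurable borel" "orthogonal_matrix \<gamma>"
  shows "(\<integral>\<^sup>+g. h (g ** \<gamma>) \<partial>haar) = (\<integral>\<^sup>+g. h g \<partial>haar)"
  using assms
  by (intro nn_integral_haar_invariant) (auto intro: orthogonal_transformation_matrix_mult_right polar_part_mult_right)

text \<open>Transitivity writes w as \<gamma> v, and right invariance absorbs \<gamma>. This is the
  freedom to replace one frame by another, even by one that depends on outer variables.\<close>

lemma nn_integral_haar_frame:
  fixes h :: "real^'m^'n \<Rightarrow> ennreal"
  assumes [measurable]: "h \<in> borel_measurable borel" and "v \<in> stiefel" "w \<in> stiefel"
  shows "(\<integral>\<^sup>+g. h (g ** v) \<partial>haar) = (\<integral>\<^sup>+g. h (g ** w) \<partial>haar)"
proof -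
  obtain \<gamma> where g: "orthogonal_matrix \<gamma>" "\<gamma> ** v = w" using orthogonal_matrix_transitive[OF assms(2,3)] .
  have "(\<integral>\<^sup>+g. h ((g ** \<gamma>) ** v) \<partial>haar) = (\<integral>\<^sup>+g. h (g ** v) \<partial>haar)"
    by (rule nn_integral_haar_right) (use g in auto)
  then show ?thesis by (simp add: matrix_mul_assoc[symmetric] g)
qed

section \<open>The invariant measure on a Stiefel manifold as an image of Haar measure\<close>

lemma cone_Gamma_pos:
  assumes "m \<le> n"
  shows "0 < cone_Gamma m (real n / 2)"
  unfolding cone_Gamma_def using assms by (intro mult_pos_pos prod_pos) (auto intro!: Gamma_real_pos)

lemma stiefel_mass_pos: "m \<le> n \<Longrightarrow> 0 < stiefel_mass n m"
  unfolding stiefel_mass_def using cone_Gamma_pos by (intro divide_pos_pos) auto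

text \<open>The candidate for the normalised invariant measure; the dependence on the base frame
  \<open>v\<close> disappears through uniqueness.\<close>

definition frame_measure :: "real^'m^'n \<Rightarrow> (real^'m^'n) measure" where
  "frame_measure v = scale_measure (ennreal (stiefel_mass CARD('n) CARD('m)))
     (distr haar (restrict_space borel stiefel) (\<lambda>g. g ** v))"

lemma measurable_frame_action:
  "v \<in> stiefel \<Longrightarrow> (\<lambda>g. g ** v) \<in> measurable haar (restrict_space borel stiefel)"
  by (intro measurable_restrict_space2) (auto intro: stiefel_mult_left)

lemma sets_frame_measure [simp]: "sets (frame_measure v) = sets (restrict_space borel stiefel)"
  by (simp add: frame_measure_def)

lemma space_frame_measure [simp]: "space (frame_measure v) = stiefel"
  by (simp add: frame_measure_def space_scale_measure space_restrict_space)

lemma nn_integral_frame_measure: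
  fixes h :: "real^'m^'n \<Rightarrow> ennreal"
  assumes "v \<in> stiefel" "h \<in> borel_measurable borel"
  shows "(\<integral>\<^sup>+a. h a \<partial>frame_measure v) = stiefel_mass CARD('n) CARD('m) * (\<integral>\<^sup>+g. h (g ** v) \<partial>haar)"
  unfolding frame_measure_def using assms
  by (simp add: nn_integral_scale_measure measurable_restrict_space1 nn_integral_distr measurable_frame_action)

lemma emeasure_frame_measure:
  fixes v :: "real^'m^'n"
  assumes "v \<in> stiefel" "A \<in> sets (restrict_space borel stiefel)"
  shows "emeasure (frame_measure v) A = stiefel_mass CARD('n) CARD('m) * (\<integral>\<^sup>+g. indicator A (g ** v) \<partial>haar)"
proof -
  have "A \<in> sets borel" using assms(2) by (auto simp: sets_restrict_space)
  then show ?thesis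
    using nn_integral_frame_measure[of v "indicator A"] assms by (simp)
qed

lemma is_stiefel_measure_frame_measure:
  fixes v :: "real^'m^'n"
  assumes v: "v \<in> stiefel"
  shows "is_stiefel_measure (frame_measure v)"
  unfolding is_stiefel_measure_def
proof (intro conjI allI impI)
  have "(\<integral>\<^sup>+g. indicator stiefel (g ** v) \<partial>haar) = (\<integral>\<^sup>+g. 1 \<partial>(haar :: (real^'n^'n) measure))"
    using v by (intro nn_integral_cong) (auto simp: stiefel_mult_left)
  also have "\<dots> = 1" by simp
  finally show "emeasure (frame_measure v) stiefel = ennreal (stiefel_mass CARD('n) CARD('m))"
    using v by (subst emeasure_frame_measure) (auto simp: sets_restrict_space)
next
  fix \<gamma> :: "real^'n^'n" assume g: "orthogonal_matrix \<gamma>"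
  have m: "(\<lambda>v. \<gamma> ** v) \<in> measurable (frame_measure v) (frame_measure v)"
    using g by (subst measurable_cong_sets[OF sets_frame_measure sets_frame_measure])
      (auto intro!: measurable_restrict_space3 stiefel_mult_left)
  show "distr (frame_measure v) (frame_measure v) (\<lambda>v. \<gamma> ** v) = frame_measure v"
  proof (rule measure_eqI)
    fix A assume "A \<in> sets (distr (frame_measure v) (frame_measure v) (\<lambda>v. \<gamma> ** v))"
    then have A: "A \<in> sets (frame_measure v)" by simp
    then have A'[measurable]: "A \<in> sets borel" by (auto simp: sets_restrict_space)
    have "emeasure (distr (frame_measure v) (frame_measure v) (\<lambda>v. \<gamma> ** v)) A
        = (\<integral>\<^sup>+a. indicator A a \<partial>distr (frame_measure v) (frame_measure v) (\<lambda>v. \<gamma> ** v))"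
      using A by simp
    also have "\<dots> = (\<integral>\<^sup>+a. indicator A (\<gamma> ** a) \<partial>frame_measure v)"
      using A m by (subst nn_integral_distr) (auto intro!: borel_measurable_indicator)
    also have "\<dots> = stiefel_mass CARD('n) CARD('m) * (\<integral>\<^sup>+g. indicator A ((\<gamma> ** g) ** v) \<partial>haar)"
      using v by (subst nn_integral_frame_measure) (auto simp: matrix_mul_assoc)
    also have "(\<integral>\<^sup>+g. indicator A ((\<gamma> ** g) ** v) \<partial>haar) = (\<integral>\<^sup>+g. indicator A (g ** v) \<partial>haar)"
      using g by (intro nn_integral_haar_left) auto
    finally show "emeasure (distr (frame_measure v) (frame_measure v) (\<lambda>v. \<gamma> ** v)) A = emeasure (frame_measure v) A"
      using A v by (simp add: emeasure_frame_measure)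
  qed simp
qed simp

text \<open>
  An invariant measure is its own average over $O(n)$, and by right invariance of the Haar measure
  this average only depends on the total mass.
\<close>

lemma is_stiefel_measure_unique:
  fixes \<mu> :: "(real^'m^'n) measure"
  assumes \<mu>: "is_stiefel_measure \<mu>" and v: "v \<in> stiefel"
  shows "\<mu> = frame_measure v"
proof (rule measure_eqI)
  have s: "sets \<mu> = sets (restrict_space borel stiefel)" 
    and mass: "emeasure \<mu> stiefel = ennreal (stiefel_mass CARD('n) CARD('m))"
    and inv: "\<And>\<gamma>. orthogonal_matrix \<gamma> \<Longrightarrow> distr \<mu> \<mu> (\<lambda>v. \<gamma> ** v) = \<mu>"
    using \<mu> by (auto simp: is_stiefel_measure_def)
  have sp: "space \<mu> = stiefel" using sets_eq_imp_space_eq[OF s] by (simp add: space_restrict_space)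
  interpret finite_measure \<mu> by standard (simp add: sp mass)
  interpret P: pair_sigma_finite "haar :: (real^'n^'n) measure" \<mu> ..
  show "sets \<mu> = sets (frame_measure v)" by (simp add: s)
  have id[measurable]: "(\<lambda>v. v) \<in> measurable \<mu> borel"
    by (subst measurable_cong_sets[OF s refl]) (auto intro: measurable_restrict_space1)
  fix A assume A: "A \<in> sets \<mu>"
  then have A'[measurable]: "A \<in> sets borel" by (auto simp: s sets_restrict_space)
  have "emeasure \<mu> A = (\<integral>\<^sup>+g. emeasure \<mu> A \<partial>(haar :: (real^'n^'n) measure))"
    by simp
  also have "\<dots> = (\<integral>\<^sup>+g. \<integral>\<^sup>+a. indicator A (g ** a) \<partial>\<mu> \<partial>haar)"
  proof (rule nn_integral_cong)
    fix g :: "real^'n^'n" assume "g \<in> space haar"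
    then have g: "orthogonal_matrix g" by simp
    have m: "(\<lambda>v. g ** v) \<in> measurable \<mu> \<mu>"
      using g by (subst measurable_cong_sets[OF s s]) (auto intro!: measurable_restrict_space3 stiefel_mult_left)
    have "emeasure \<mu> A = (\<integral>\<^sup>+a. indicator A a \<partial>distr \<mu> \<mu> (\<lambda>v. g ** v))"
      using A by (simp add: inv[OF g])
    also have "\<dots> = (\<integral>\<^sup>+a. indicator A (g ** a) \<partial>\<mu>)"
      using A m by (subst nn_integral_distr) auto
    finally show "emeasure \<mu> A = (\<integral>\<^sup>+a. indicator A (g ** a) \<partial>\<mu>)" .
  qed
  also have "\<dots> = (\<integral>\<^sup>+a. \<integral>\<^sup>+g. indicator A (g ** a) \<partial>haar \<partial>\<mu>)"
    using P.Fubini[of "\<lambda>(g, a). indicator A (g ** a)"] by simp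
  also have "\<dots> = (\<integral>\<^sup>+a. (\<integral>\<^sup>+g. indicator A (g ** v) \<partial>haar) \<partial>\<mu>)"
    using v by (intro nn_integral_cong nn_integral_haar_frame) (auto simp: sp)
  also have "\<dots> = emeasure (frame_measure v) A"
    using A v by (simp add: emeasure_frame_measure s sp mass mult.commute)
  finally show "emeasure \<mu> A = emeasure (frame_measure v) A" .
qed

text \<open>Existence and uniqueness resolve the choice operator, for any base frame. Integrals over
  frames thereby become integrals over rotations.\<close>

lemma stiefel_measure_eq:
  fixes v :: "real^'m^'n"
  assumes "v \<in> stiefel"
  shows "stiefel_measure = completion (frame_measure v)"
  unfolding stiefel_measure_def
  using someI[of is_stiefel_measure, OF is_stiefel_measure_frame_measure[OF assms]]
  by (auto dest: is_stiefel_measure_unique[OF _ assms])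

section \<open>The distribution of Gram matrices\<close>

lemma borel_measurable_vec_lambda [measurable (raw)]:
  fixes f :: "'i::finite \<Rightarrow> 'a \<Rightarrow> 'b::euclidean_space"
  assumes "\<And>i. f i \<in> borel_measurable M"
  shows "(\<lambda>x. \<chi> i. f i x) \<in> borel_measurable M"
  unfolding borel_measurable_euclidean_space[of "\<lambda>x. \<chi> i. f i x"]
  using assms by (auto simp: Basis_vec_def inner_axis)

lemma borel_measurable_vec_nth [measurable (raw)]:
  fixes f :: "'a \<Rightarrow> 'b::euclidean_space ^ 'i::finite"
  assumes "f \<in> borel_measurable M"
  shows "(\<lambda>x. f x $ i) \<in> borel_measurable M"
  by (rule measurable_compose[OF assms]) (intro borel_measurable_continuous_onI continuous_intros)

lemma borel_measurable_linear:
  fixes f :: "'a::euclidean_space \<Rightarrow> 'b::euclidean_space"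
  shows "linear f \<Longrightarrow> f \<in> borel_measurable borel"
  by (intro borel_measurable_continuous_onI linear_continuous_on) (simp add: linear_conv_bounded_linear)

lemma nn_integral_lborel_orthogonal:
  fixes h :: "'a::euclidean_space \<Rightarrow> ennreal" and f :: "'a \<Rightarrow> 'a"
  assumes [measurable]: "h \<in> borel_measurable borel" and f: "orthogonal_transformation f"
  shows "(\<integral>\<^sup>+x. h (f x) \<partial>lborel) = (\<integral>\<^sup>+x. h x \<partial>lborel)"
proof -
  have [measurable]: "f \<in> borel_measurable borel"
    using f by (intro borel_measurable_linear) (simp add: orthogonal_transformation)
  have "(\<integral>\<^sup>+x. h x \<partial>lborel) = (\<integral>\<^sup>+x. h x \<partial>distr lborel borel f)"
    by (simp add: lborel_distr_orthogonal[OF f])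
  also have "\<dots> = (\<integral>\<^sup>+x. h (f x) \<partial>lborel)" by (subst nn_integral_distr) auto
  finally show ?thesis ..
qed

lemma nn_integral_lborel_uminus:
  fixes h :: "'a::euclidean_space \<Rightarrow> ennreal"
  assumes "h \<in> borel_measurable borel"
  shows "(\<integral>\<^sup>+x. h (- x) \<partial>lborel) = (\<integral>\<^sup>+x. h x \<partial>lborel)"
  using assms by (rule nn_integral_lborel_orthogonal) (simp add: orthogonal_transformation_def linear_uminus linear_iff)

text \<open>
  The component \<open>\<pi> a\<close> of the integration variable becomes a variable \<open>b\<close> of its own, while the old
  component is kept as a dummy with weight \<open>\<rho>\<close>.  This lets inductions on the number of coordinates
  run over integrals on one fixed space.
\<close>

lemma nn_integral_split:
  fixes M :: "'a::euclidean_space measure" and T :: "'b::euclidean_space \<Rightarrow> 'a"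
    and h :: "'a \<Rightarrow> ennreal" and \<rho> :: "'b \<Rightarrow> ennreal"
  assumes sf: "sigma_finite_measure M" and sets: "sets M = sets borel"
    and inv: "\<And>h b. h \<in> borel_measurable borel \<Longrightarrow> (\<integral>\<^sup>+a. h (a + T b) \<partial>M) = (\<integral>\<^sup>+a. h a \<partial>M)"
    and T: "linear T" and \<pi>: "linear \<pi>" and \<pi>T: "\<And>b. \<pi> (T b) = b"
    and [measurable]: "\<rho> \<in> borel_measurable borel" and \<rho>1: "(\<integral>\<^sup>+b. \<rho> b \<partial>lborel) = 1"
    and [measurable]: "h \<in> borel_measurable borel"
  shows "(\<integral>\<^sup>+a. h a \<partial>M) = (\<integral>\<^sup>+b. \<integral>\<^sup>+a. \<rho> (\<pi> a) * h (a - T (\<pi> a) + T b) \<partial>M \<partial>lborel)"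
proof -
  interpret M: sigma_finite_measure M by fact
  interpret P: pair_sigma_finite M "lborel :: 'b measure" ..
  note [measurable_cong] = sets
  have [measurable]: "T \<in> borel_measurable borel" "\<pi> \<in> borel_measurable borel"
    using T \<pi> by (auto intro: borel_measurable_linear)
  have "(\<integral>\<^sup>+a. h a \<partial>M) = (\<integral>\<^sup>+a. \<integral>\<^sup>+b. \<rho> (\<pi> a - b) * h a \<partial>lborel \<partial>M)"
  proof (rule nn_integral_cong)
    fix a
    have "(\<integral>\<^sup>+b. \<rho> (\<pi> a - b) \<partial>lborel) = (\<integral>\<^sup>+b. \<rho> (\<pi> a + b) \<partial>lborel)"
      using nn_integral_lborel_uminus[of "\<lambda>b. \<rho> (\<pi> a + b)"] by simp
    also have "\<dots> = 1"
      using nn_integral_lborel_shift[of \<rho> "\<pi> a"] \<rho>1 by (simp add: add.commute)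
    finally show "h a = (\<integral>\<^sup>+b. \<rho> (\<pi> a - b) * h a \<partial>lborel)" by (simp add: nn_integral_multc)
  qed
  also have "\<dots> = (\<integral>\<^sup>+b. \<integral>\<^sup>+a. \<rho> (\<pi> a - b) * h a \<partial>M \<partial>lborel)"
    using P.Fubini[of "\<lambda>(a, b). \<rho> (\<pi> a - b) * h a"] by simp
  also have "\<dots> = (\<integral>\<^sup>+b. \<integral>\<^sup>+a. \<rho> (\<pi> a) * h (a + T b) \<partial>M \<partial>lborel)"
  proof (rule nn_integral_cong)
    fix b
    show "(\<integral>\<^sup>+a. \<rho> (\<pi> a - b) * h a \<partial>M) = (\<integral>\<^sup>+a. \<rho> (\<pi> a) * h (a + T b) \<partial>M)"
      using inv[of "\<lambda>a. \<rho> (\<pi> a - b) * h a" b] by (simp add: linear_add[OF \<pi>] \<pi>T)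
  qed
  also have "\<dots> = (\<integral>\<^sup>+a. \<integral>\<^sup>+b. \<rho> (\<pi> a) * h (a + T b) \<partial>lborel \<partial>M)"
    using P.Fubini[of "\<lambda>(a, b). \<rho> (\<pi> a) * h (a + T b)"] by simp
  also have "\<dots> = (\<integral>\<^sup>+a. \<integral>\<^sup>+b. \<rho> (\<pi> a) * h (a - T (\<pi> a) + T b) \<partial>lborel \<partial>M)"
  proof (rule nn_integral_cong)
    fix a
    show "(\<integral>\<^sup>+b. \<rho> (\<pi> a) * h (a + T b) \<partial>lborel) = (\<integral>\<^sup>+b. \<rho> (\<pi> a) * h (a - T (\<pi> a) + T b) \<partial>lborel)"
      using nn_integral_lborel_shift[of "\<lambda>b. \<rho> (\<pi> a) * h (a + T b)" "- \<pi> a"]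
      by (simp add: linear_diff[OF T] algebra_simps)
  qed
  also have "\<dots> = (\<integral>\<^sup>+b. \<integral>\<^sup>+a. \<rho> (\<pi> a) * h (a - T (\<pi> a) + T b) \<partial>M \<partial>lborel)"
    using P.Fubini[of "\<lambda>(a, b). \<rho> (\<pi> a) * h (a - T (\<pi> a) + T b)"] by simp
  finally show ?thesis .
qed

lemmas nn_integral_lborel_split =
  nn_integral_split[OF sigma_finite_lborel sets_lborel nn_integral_lborel_shift]

text \<open>One coordinate is split off at a time. The restriction to \<open>I\<close> keeps the
  shifted function inside the space of extensional functions.\<close>

lemma nn_integral_PiM_lborel_shift:
  fixes a :: "'i \<Rightarrow> real"
  assumes "finite I" "h \<in> borel_measurable (\<Pi>\<^sub>M i\<in>I. lborel)"
  shows "(\<integral>\<^sup>+c. h (\<lambda>i\<in>I. c i + a i) \<partial>(\<Pi>\<^sub>M i\<in>I. lborel)) = (\<integral>\<^sup>+c. h c \<partial>(\<Pi>\<^sub>M i\<in>I. lborel))"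
  using assms
proof (induction arbitrary: h)
  case empty
  interpret product_sigma_finite "\<lambda>_::'i. lborel :: real measure" ..
  show ?case by (simp add: PiM_empty nn_integral_count_space_finite)
next
  case (insert i I)
  interpret product_sigma_finite "\<lambda>_::'i. lborel :: real measure" ..
  have [measurable]: "h \<in> borel_measurable (Pi\<^sub>M (insert i I) (\<lambda>i. lborel))" by fact
  have "(\<integral>\<^sup>+c. h (\<lambda>k\<in>insert i I. c k + a k) \<partial>(\<Pi>\<^sub>M i\<in>insert i I. lborel))
     = (\<integral>\<^sup>+y. \<integral>\<^sup>+c. h (\<lambda>k\<in>insert i I. (c(i := y)) k + a k) \<partial>(\<Pi>\<^sub>M i\<in>I. lborel) \<partial>lborel)"
    using insert by (intro product_nn_integral_insert_rev) auto
  also have "\<dots> = (\<integral>\<^sup>+y. \<integral>\<^sup>+c. h (c(i := y + a i)) \<partial>(\<Pi>\<^sub>M i\<in>I. lborel) \<partial>lborel)"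
  proof (rule nn_integral_cong)
    fix y :: real
    have "(\<lambda>k\<in>insert i I. (c(i := y)) k + a k) = (\<lambda>k\<in>I. c k + a k)(i := y + a i)" for c
      using insert(2) by (auto simp: fun_eq_iff)
    note eq = this
    show "(\<integral>\<^sup>+c. h (\<lambda>k\<in>insert i I. (c(i := y)) k + a k) \<partial>(\<Pi>\<^sub>M i\<in>I. lborel))
       = (\<integral>\<^sup>+c. h (c(i := y + a i)) \<partial>(\<Pi>\<^sub>M i\<in>I. lborel))"
      unfolding eq using insert(2) by (intro insert.IH[of "\<lambda>c. h (c(i := y + a i))"]) measurable
  qed
  also have "\<dots> = (\<integral>\<^sup>+y. \<integral>\<^sup>+c. h (c(i := y)) \<partial>(\<Pi>\<^sub>M i\<in>I. lborel) \<partial>lborel)"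
  proof -
    interpret I: finite_product_sigma_finite "\<lambda>_::'i. lborel :: real measure" I
      by standard (rule insert(1))
    show ?thesis
      by (rule nn_integral_lborel_shift) measurable
  qed
  also have "\<dots> = (\<integral>\<^sup>+c. h c \<partial>(\<Pi>\<^sub>M i\<in>insert i I. lborel))"
    using insert by (intro product_nn_integral_insert_rev[symmetric]) auto
  finally show ?case .
qed

section \<open>Lebesgue measure on symmetric matrices\<close>

definition edges :: "'m set set" where
  "edges = {{i, j} |i j. True}"

lemma edges_intro [simp]: "{i, j} \<in> edges"
  by (auto simp: edges_def)

lemma edges_cases: "e \<in> edges \<Longrightarrow> (\<And>i j. e = {i, j} \<Longrightarrow> thesis) \<Longrightarrow> thesis"
  by (auto simp: edges_def)

text \<open>The measure before completion. Fubini arguments are carried out here with Borel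
  functions, and the completion is restored only at the end.\<close>

definition sym_lborel :: "(real^'m^'m) measure" where
  "sym_lborel = distr (\<Pi>\<^sub>M e\<in>edges. lborel) borel sym_matrix"

lemma sym_lebesgue_eq: "sym_lebesgue = completion sym_lborel"
  by (simp add: sym_lebesgue_def sym_lborel_def edges_def)

lemma sets_sym_lborel [simp, measurable_cong]: "sets sym_lborel = sets borel"
  by (simp add: sym_lborel_def)

lemma space_sym_lborel [simp]: "space sym_lborel = UNIV"
  by (simp add: sym_lborel_def)

lemma finite_edges: "finite (edges :: 'm::finite set set)"
  by (rule finite_subset[of _ UNIV]) auto

lemma measurable_sym_matrix [measurable]:
  "sym_matrix \<in> measurable (\<Pi>\<^sub>M e\<in>edges. lborel) (borel :: (real^'m::finite^'m) measure)"
proof -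
  have "(\<lambda>c. c {i, j}) \<in> borel_measurable (\<Pi>\<^sub>M e\<in>edges. lborel :: real measure)" for i j :: 'm
    by (rule measurable_component_singleton[of "{i, j}" edges "\<lambda>_. lborel", unfolded measurable_lborel1]) simp
  then show ?thesis
    unfolding sym_matrix_def by measurable
qed

lemma nn_integral_sym_lborel:
  "h \<in> borel_measurable borel \<Longrightarrow>
    (\<integral>\<^sup>+a. h a \<partial>sym_lborel) = (\<integral>\<^sup>+c. h (sym_matrix c) \<partial>(\<Pi>\<^sub>M e\<in>edges. lborel))"
  unfolding sym_lborel_def by (subst nn_integral_distr) auto

lemma AE_sym_lborel_symmetric: "AE a in sym_lborel. transpose a = a"
proof -
  have "transpose (sym_matrix c) = sym_matrix c" for c :: "'a set \<Rightarrow> real"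
    by (simp add: sym_matrix_def transpose_def vec_eq_iff insert_commute)
  then show ?thesis
    unfolding sym_lborel_def by (subst AE_distr_iff) auto
qed

lemma nn_integral_sym_lborel_shift:
  fixes h :: "real^'m^'m \<Rightarrow> ennreal"
  assumes [measurable]: "h \<in> borel_measurable borel" and a: "transpose a = a"
  shows "(\<integral>\<^sup>+c. h (c + a) \<partial>sym_lborel) = (\<integral>\<^sup>+c. h c \<partial>sym_lborel)"
proof -
  \<comment> \<open>An entry of the symmetric matrix \<open>a\<close> depends only on the unordered
    pair of its indices, so the description denotes a unique number.\<close>
  define \<alpha> where "\<alpha> e = (THE x. \<exists>i j. e = {i, j} \<and> x = a $ i $ j)" for e
  have aij: "a $ i $ j = a $ j $ i" for i j using a by (simp add: transpose_def vec_eq_iff)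
  have \<alpha>: "\<alpha> {i, j} = a $ i $ j" for i j
    unfolding \<alpha>_def by (rule the_equality) (auto simp: doubleton_eq_iff aij)
  have sm: "sym_matrix (\<lambda>e\<in>edges. c e + \<alpha> e) = sym_matrix c + a" for c
    by (auto simp: sym_matrix_def vec_eq_iff \<alpha>)
  have "(\<integral>\<^sup>+c. h (c + a) \<partial>sym_lborel) = (\<integral>\<^sup>+c. h (sym_matrix (\<lambda>e\<in>edges. c e + \<alpha> e)) \<partial>(\<Pi>\<^sub>M e\<in>edges. lborel))"
    by (subst nn_integral_sym_lborel) (simp_all add: sm)
  also have "\<dots> = (\<integral>\<^sup>+c. h (sym_matrix c) \<partial>(\<Pi>\<^sub>M e\<in>edges. lborel))"
    by (rule nn_integral_PiM_lborel_shift[where h="\<lambda>c. h (sym_matrix c)"]) (auto simp: finite_edges)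
  finally show ?thesis by (simp add: nn_integral_sym_lborel)
qed

text \<open>The first cube, with r = 1, normalises dummy entries; the second gives an exhaustion by
  sets of finite measure.\<close>

lemma emeasure_sym_lborel_cube:
  assumes "0 \<le> r"
  shows "emeasure sym_lborel {c :: real^'m^'m. \<forall>p q. c $ p $ q \<in> {0..r}} = ennreal r ^ card (edges :: 'm set set)"
    and "emeasure sym_lborel {c :: real^'m^'m. \<forall>p q. c $ p $ q \<in> {-r..r}} = ennreal (2 * r) ^ card (edges :: 'm set set)"
proof -
  interpret product_sigma_finite "\<lambda>_::'m set. lborel :: real measure" ..
  have "emeasure sym_lborel {c :: real^'m^'m. \<forall>p q. c $ p $ q \<in> {l..r}} = ennreal (r - l) ^ card (edges :: 'm set set)"
    if "l \<le> r" for l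
  proof -
    have "sym_matrix -` {c :: real^'m^'m. \<forall>p q. c $ p $ q \<in> {l..r}} \<inter> space (\<Pi>\<^sub>M e\<in>edges. lborel)
       = (\<Pi>\<^sub>E e\<in>edges. {l..r})"
      by (auto simp: sym_matrix_def space_PiM PiE_def Pi_def elim!: edges_cases)
    moreover have "{c :: real^'m^'m. \<forall>p q. c $ p $ q \<in> {l..r}} \<in> sets borel" by measurable
    ultimately show ?thesis
      unfolding sym_lborel_def using that
      by (subst emeasure_distr) (auto simp: emeasure_PiM finite_edges)
  qed
  from this[of 0] this[of "-r"] assms
  show "emeasure sym_lborel {c :: real^'m^'m. \<forall>p q. c $ p $ q \<in> {0..r}} = ennreal r ^ card (edges :: 'm set set)"
    and "emeasure sym_lborel {c :: real^'m^'m. \<forall>p q. c $ p $ q \<in> {-r..r}} = ennreal (2 * r) ^ card (edges :: 'm set set)"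
    by simp_all
qed

lemma sigma_finite_sym_lborel: "sigma_finite_measure (sym_lborel :: (real^'m^'m) measure)"
proof
  let ?A = "\<lambda>n::nat. {c :: real^'m^'m. \<forall>p q. c $ p $ q \<in> {- real n..real n}}"
  have "\<exists>n. c \<in> ?A n" for c
  proof -
    obtain n where n: "norm c \<le> real n" using real_arch_simple by blast
    have "\<bar>c $ p $ q\<bar> \<le> norm c" for p q
      using component_le_norm_cart[of "c $ p" q] Finite_Cartesian_Product.norm_nth_le[of c p] by linarith
    with n have "\<bar>c $ p $ q\<bar> \<le> real n" for p q using order_trans by blast
    then show ?thesis by (auto simp: abs_le_iff minus_le_iff)
  qed
  then have 1: "\<Union>(range ?A) = space sym_lborel" by auto
  have 2: "emeasure sym_lborel (?A n) \<noteq> \<infinity>" for n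
    by (subst emeasure_sym_lborel_cube) (auto simp: power_eq_top_ennreal)
  have 3: "range ?A \<subseteq> sets sym_lborel" by (auto simp: image_subset_iff)
  show "\<exists>A. countable A \<and> A \<subseteq> sets sym_lborel \<and> \<Union>A = (space sym_lborel :: (real^'m^'m) set) \<and> (\<forall>a\<in>A. emeasure sym_lborel a \<noteq> \<infinity>)"
    by (rule exI[where x="range ?A"]) (use 1 2 3 in blast)
qed

interpretation sym_lborel: sigma_finite_measure "sym_lborel :: (real^'m^'m) measure"
  by (rule sigma_finite_sym_lborel)

section \<open>The distribution of the squared norm\<close>

lemma nn_integral_powr_0_to:
  assumes "-1 < a" "0 \<le> r"
  shows "(\<integral>\<^sup>+y. indicator {0<..r} y * ennreal (y powr a) \<partial>lborel) = ennreal (r powr (a + 1) / (a + 1))"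
proof -
  have "(\<integral>\<^sup>+y. indicator {0<..r} y * ennreal (y powr a) \<partial>lborel) = (\<integral>\<^sup>+y. ennreal (y powr a) * indicator {0..r} y \<partial>lborel)"
    by (rule nn_integral_cong_AE, rule AE_I[of _ _ "{0}"]) (auto simp: indicator_def)
  also have "\<dots> = ennreal (r powr (a + 1) / (a + 1))"
    using has_integral_powr_from_0[OF assms] by (intro nn_integral_has_integral_lebesgue') auto
  finally show ?thesis .
qed

text \<open>The coordinates outside \<open>K\<close> contribute a unit cube, the others a ball of
  radius sqrt r in dimension \<open>card K\<close>; the product measure separates them.\<close>

lemma emeasure_dead_ball:
  fixes K :: "'k::finite set"
  assumes "0 < r"
  shows "emeasure lborel {w :: real^'k. (\<forall>i. i \<notin> K \<longrightarrow> w $ i \<in> {0..1}) \<and> (\<Sum>i\<in>K. (w $ i)\<^sup>2) \<le> r}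
     = ennreal (unit_ball_vol (card K) * r powr (card K / 2))"
proof -
  interpret product_sigma_finite "\<lambda>_::'k. lborel :: real measure" ..
  let ?A = "{w :: real^'k. (\<forall>i. i \<notin> K \<longrightarrow> w $ i \<in> {0..1}) \<and> (\<Sum>i\<in>K. (w $ i)\<^sup>2) \<le> r}"
  let ?B = "{f. sqrt (\<Sum>i\<in>K. (f i)\<^sup>2) \<le> sqrt r} \<inter> space (\<Pi>\<^sub>M i\<in>K. lborel)"
  let ?C = "\<Pi>\<^sub>E i\<in>-K. {0..1::real}"
  have [measurable]: "(\<lambda>c. \<chi> i. c i) \<in> measurable (\<Pi>\<^sub>M i\<in>UNIV. lborel) (borel :: (real^'k) measure)"
    by measurable
  have [measurable]: "?A \<in> sets borel" by measurable
  have B[measurable]: "?B \<in> sets (\<Pi>\<^sub>M i\<in>K. lborel)" by measurable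
  have C[measurable]: "?C \<in> sets (\<Pi>\<^sub>M i\<in>-K. lborel)" by (rule sets_PiM_I_finite) auto
  have "emeasure lborel ?A = (\<integral>\<^sup>+w. indicator ?A w \<partial>distr (\<Pi>\<^sub>M i\<in>UNIV. lborel) borel (\<lambda>c. \<chi> i. c i))"
    by (simp add: lborel_vec)
  also have "\<dots> = (\<integral>\<^sup>+c. indicator ?A (\<chi> i. c i) \<partial>(\<Pi>\<^sub>M i\<in>K \<union> -K. lborel))"
    by (subst nn_integral_distr) (simp_all add: Compl_partition)
  also have "\<dots> = (\<integral>\<^sup>+f. \<integral>\<^sup>+g. indicator ?A (\<chi> i. merge K (-K) (f, g) i) \<partial>(\<Pi>\<^sub>M i\<in>-K. lborel) \<partial>(\<Pi>\<^sub>M i\<in>K. lborel))"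
    by (subst product_nn_integral_fold) (auto simp: Compl_partition)
  also have "\<dots> = (\<integral>\<^sup>+f. \<integral>\<^sup>+g. indicator ?B f * indicator ?C g \<partial>(\<Pi>\<^sub>M i\<in>-K. lborel) \<partial>(\<Pi>\<^sub>M i\<in>K. lborel))"
  proof (intro nn_integral_cong)
    fix f g assume f: "f \<in> space (\<Pi>\<^sub>M i\<in>K. lborel :: real measure)" and g: "g \<in> space (\<Pi>\<^sub>M i\<in>-K. lborel :: real measure)"
    have "(\<Sum>i\<in>K. (merge K (-K) (f, g) i)\<^sup>2) = (\<Sum>i\<in>K. (f i)\<^sup>2)"
      by (intro sum.cong) (auto simp: merge_def)
    moreover have "(\<forall>i. i \<notin> K \<longrightarrow> merge K (-K) (f, g) i \<in> {0..1}) \<longleftrightarrow> g \<in> ?C"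
      using g by (auto simp: merge_def space_PiM PiE_def Pi_def)
    ultimately show "indicator ?A (\<chi> i. merge K (-K) (f, g) i) = (indicator ?B f * indicator ?C g :: ennreal)"
      using f by (auto simp: indicator_def)
  qed
  also have "\<dots> = emeasure (\<Pi>\<^sub>M i\<in>K. lborel) ?B * emeasure (\<Pi>\<^sub>M i\<in>-K. lborel) ?C"
    by (simp add: nn_integral_cmult nn_integral_multc del: Int_iff)
  also have "emeasure (\<Pi>\<^sub>M i\<in>-K. lborel) ?C = 1"
    by (subst emeasure_PiM) auto
  also have "emeasure (\<Pi>\<^sub>M i\<in>K. lborel) ?B = ennreal (unit_ball_vol (card K) * sqrt r ^ card K)"
    using assms by (intro emeasure_cball_aux) auto
  also have "sqrt r ^ card K = r powr (card K / 2)"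
    using assms by (simp add: powr_half_sqrt[symmetric] powr_powr flip: powr_realpow)
  finally show ?thesis by simp
qed

text \<open>Half the surface area of the unit sphere in dimension q. The factor one half comes from
  the variable y = \<rho>^2, since \<rho>^(q-1) d\<rho> is one half of y^(q/2-1) dy.\<close>

definition radial_const :: "nat \<Rightarrow> real" where
  "radial_const q = pi powr (q / 2) / Gamma (q / 2)"

lemma radial_const_nonneg: "0 \<le> radial_const q"
  unfolding radial_const_def by (cases "q = 0") (auto intro!: divide_nonneg_nonneg Gamma_real_nonneg)

text \<open>Polar coordinates for functions of the squared norm, obtained without a sphere: the law
  of the squared norm and the proposed density have the same distribution function.\<close>

lemma nn_integral_radial:
  fixes K :: "'k::finite set" and \<Psi> :: "real \<Rightarrow> ennreal"
  assumes K: "K \<noteq> {}" and [measurable]: "\<Psi> \<in> borel_measurable borel"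
  shows "(\<integral>\<^sup>+w. indicator {w :: real^'k. \<forall>i. i \<notin> K \<longrightarrow> w $ i \<in> {0..1}} w * \<Psi> (\<Sum>i\<in>K. (w $ i)\<^sup>2) \<partial>lborel)
     = (\<integral>\<^sup>+y. ennreal (radial_const (card K)) * indicator {0<..} y * ennreal (y powr (card K / 2 - 1)) * \<Psi> y \<partial>lborel)"
proof -
  let ?D = "{w :: real^'k. \<forall>i. i \<notin> K \<longrightarrow> w $ i \<in> {0..1}}"
  let ?n = "\<lambda>w :: real^'k. \<Sum>i\<in>K. (w $ i)\<^sup>2"
  let ?N = "distr (density lborel (indicator ?D)) borel ?n"
  let ?d = "\<lambda>y. ennreal (radial_const (card K)) * indicator {0<..} y * ennreal (y powr (card K / 2 - 1))"
  have q: "0 < card K" using K by (simp add: card_gt_0_iff)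
  have [measurable]: "?D \<in> sets borel" by measurable
  \<comment> \<open>The ball volume is available for r > 0 and the set is empty for r < 0. The value
    r = 0 is left out here; half-lines with nonzero end point still generate the Borel sets.\<close>
  have N: "emeasure ?N {..r} = ennreal (unit_ball_vol (card K) * max 0 r powr (card K / 2))" if "r \<noteq> 0" for r
  proof -
    have "emeasure ?N {..r} = emeasure lborel {w \<in> ?D. ?n w \<le> r}"
    proof -
      have "emeasure ?N {..r} = (\<integral>\<^sup>+w. indicator ?D w * indicator (?n -` {..r}) w \<partial>lborel)"
        by (simp add: emeasure_distr emeasure_density measurable_sets_borel[of _ borel])
      also have "\<dots> = (\<integral>\<^sup>+w. indicator {w \<in> ?D. ?n w \<le> r} w \<partial>lborel)"
        by (intro nn_integral_cong) (simp split: split_indicator)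
      also have "\<dots> = emeasure lborel {w \<in> ?D. ?n w \<le> r}"
        by (intro nn_integral_indicator) measurable
      finally show ?thesis .
    qed
    also have "\<dots> = ennreal (unit_ball_vol (card K) * max 0 r powr (card K / 2))"
    proof (cases "0 < r")
      case True
      then show ?thesis using emeasure_dead_ball[of r K] by (simp add: max_def)
    next
      case False
      with that have "r < 0" by simp
      then have "{w \<in> ?D. ?n w \<le> r} = {}"
        by (auto simp: not_le intro!: less_le_trans[of r 0] sum_nonneg)
      then have "emeasure lborel {w \<in> ?D. ?n w \<le> r} = 0" by (simp only: emeasure_empty)
      then show ?thesis using False that by (simp add: max_def del: mem_Collect_eq)
    qed
    finally show ?thesis .
  qed
  have N': "emeasure (density lborel ?d) {..r} = ennreal (unit_ball_vol (card K) * max 0 r powr (card K / 2))" for r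
  proof -
    have Gam: "Gamma (card K / 2 + 1) = card K / 2 * Gamma (card K / 2)"
      using q by (intro Gamma_plus1) (auto dest: nonpos_Ints_nonpos)
    have "emeasure (density lborel ?d) {..r} = (\<integral>\<^sup>+y. ennreal (radial_const (card K)) * (indicator {0<..max 0 r} y * ennreal (y powr (card K / 2 - 1))) \<partial>lborel)"
      by (subst emeasure_density) (auto intro!: nn_integral_cong split: split_indicator)
    also have "\<dots> = ennreal (radial_const (card K)) * ennreal (max 0 r powr (card K / 2) / (card K / 2))"
      using q nn_integral_powr_0_to[of "card K / 2 - 1" "max 0 r"] by (simp add: nn_integral_cmult)
    also have "\<dots> = ennreal (radial_const (card K) * (max 0 r powr (card K / 2) / (card K / 2)))"
      by (rule ennreal_mult'[symmetric]) (rule radial_const_nonneg)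
    also have "radial_const (card K) * (max 0 r powr (card K / 2) / (card K / 2)) = unit_ball_vol (card K) * max 0 r powr (card K / 2)"
      by (simp add: unit_ball_vol_def radial_const_def Gam mult_ac)
    finally show ?thesis .
  qed
  have "?N = density lborel ?d"
  proof (rule measure_eqI_generator_eq_countable)
    let ?E = "(\<lambda>r. {..r}) ` (UNIV - {0::real})"
    show "Int_stable ?E" by (auto simp: Int_stable_def Int_atMost min_def image_iff)
    show "?E \<subseteq> Pow UNIV" by auto
    show "emeasure ?N X = emeasure (density lborel ?d) X" if "X \<in> ?E" for X
      using that by (elim imageE DiffE) (simp only: N N' singleton_iff simp_thms)
    have "borel = sigma UNIV ?E"
    proof (rule borel_eq_sigmaI1[OF borel_eq_atMost])
      fix X :: "real set" assume "X \<in> range atMost"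
      then obtain r where r: "X = {..r}" by auto
      show "X \<in> sets (sigma UNIV ?E)"
      proof (cases "r = 0")
        case True
        have "X = (\<Inter>n::nat. {..inverse (real (Suc n))})"
        proof -
          have "x \<le> 0" if "\<forall>n::nat. x \<le> inverse (real (Suc n))" for x :: real
            using that by (metis linorder_not_le order_less_le_trans reals_Archimedean verit_comp_simplify1(3) nless_le)
          moreover have "x \<le> inverse (real (Suc n))" if "x \<le> 0" for x :: real and n
            using that by (rule order_trans) simp
          ultimately show ?thesis by (auto simp: r True)
        qed
        also have "\<dots> \<in> sets (sigma UNIV ?E)"
          by (intro sets.countable_INT) (auto intro!: sigma_sets.Basic simp: image_iff)
        finally show ?thesis .
      next
        case False
        then show ?thesis by (auto simp: r intro!: sigma_sets.Basic)
      qed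
    qed auto
    then have s: "sets (borel :: real measure) = sigma_sets UNIV ?E"
      by (metis (no_types, lifting) sets_measure_of top_greatest Pow_UNIV)
    show "sets ?N = sigma_sets UNIV ?E" "sets (density lborel ?d) = sigma_sets UNIV ?E"
      by (simp_all add: s)
    show "range (\<lambda>n::nat. {..real (Suc n)}) \<subseteq> ?E" by auto
    show "countable (range (\<lambda>n::nat. {..real (Suc n)}))" by auto
    show "(\<Union>(range (\<lambda>n::nat. {..real (Suc n)}))) = UNIV"
    proof -
      have "\<exists>n. x \<le> real (Suc n)" for x :: real
        using real_arch_simple[of x] by (metis of_nat_Suc le_add_same_cancel2 order_trans zero_le_one)
      then show ?thesis by auto
    qed
    show "emeasure ?N a \<noteq> \<infinity>" if "a \<in> range (\<lambda>n::nat. {..real (Suc n)})" for a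
      using that by (elim imageE) (simp only: N of_nat_eq_0_iff nat.simps ennreal_neq_top infinity_ennreal_def simp_thms)
  qed
  then have "(\<integral>\<^sup>+y. \<Psi> y \<partial>?N) = (\<integral>\<^sup>+y. \<Psi> y \<partial>density lborel ?d)" by simp
  then show ?thesis
    by (subst (asm) nn_integral_distr) (auto simp: nn_integral_density mult_ac)
qed

text \<open>
  The induction runs over the set \<open>S\<close> of columns and the set \<open>K\<close> of coordinates that enter the Gram
  matrix.  All other coordinates are dummies in $[0,1]$, and matrices indexed by \<open>S\<close> are padded with
  the identity, so that the types and the determinants do not change with \<open>S\<close> and \<open>K\<close>.
\<close>

definition pad :: "'m set \<Rightarrow> real^'m^'m \<Rightarrow> real^'m^'m" where
  "pad S c = (\<chi> p q. if p \<in> S \<and> q \<in> S then c $ p $ q else if p = q then 1 else 0)"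

text \<open>What \<open>pad (insert j S)\<close> looks like once the corner and the border in row
  \<open>j\<close> have become variables of their own.\<close>

definition border :: "'m set \<Rightarrow> 'm \<Rightarrow> real \<Rightarrow> real^'m \<Rightarrow> real^'m^'m \<Rightarrow> real^'m^'m" where
  "border S j y b c = (\<chi> p q.
     if p = j \<and> q = j then y
     else if p = j \<and> q \<in> S then b $ q
     else if p \<in> S \<and> q = j then b $ p
     else if p \<in> S \<and> q \<in> S then c $ p $ q
     else if p = q then 1 else 0)"

text \<open>Here \<open>u\<close> stands for the transpose of \<omega>: the columns of \<omega> are
  the components \<open>u $ p\<close>, which can be split off as vectors.\<close>

definition partial_gram :: "'k::finite set \<Rightarrow> real^'k^'m \<Rightarrow> real^'m^'m" where
  "partial_gram K u = (\<chi> p q. \<Sum>i\<in>K. u $ p $ i * u $ q $ i)"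

definition dead_cols :: "'m set \<Rightarrow> 'k set \<Rightarrow> (real^'k^'m) set" where
  "dead_cols S K = {u. \<forall>p i. \<not> (p \<in> S \<and> i \<in> K) \<longrightarrow> u $ p $ i \<in> {0..1}}"

definition dead_vec :: "'k set \<Rightarrow> (real^'k) set" where
  "dead_vec K = {w. \<forall>i. i \<notin> K \<longrightarrow> w $ i \<in> {0..1}}"

definition dead_sym :: "'m set \<Rightarrow> (real^'m^'m) set" where
  "dead_sym S = {c. \<forall>p q. \<not> (p \<in> S \<and> q \<in> S) \<longrightarrow> c $ p $ q \<in> {0..1}}"

lemma dead_borel [measurable]: "dead_cols S K \<in> sets borel" "dead_vec K \<in> sets borel" "dead_sym S \<in> sets borel"
  unfolding dead_cols_def dead_vec_def dead_sym_def by measurable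

lemma borel_pad [measurable]: "pad S \<in> borel_measurable borel"
  unfolding pad_def by measurable

lemma borel_partial_gram [measurable]: "partial_gram K \<in> borel_measurable borel"
  unfolding partial_gram_def by measurable

lemma borel_border [measurable (raw)]:
  assumes [measurable]: "y \<in> borel_measurable M" "b \<in> borel_measurable M" "c \<in> borel_measurable M"
  shows "(\<lambda>x. border S j (y x) (b x) (c x)) \<in> borel_measurable M"
  unfolding border_def by measurable

definition unit_cube :: "(real^'m^'l) set" where
  "unit_cube = {\<tau>. \<forall>i j. \<tau> $ i $ j \<in> {0..1}}"

lemma unit_cube_borel [measurable]: "unit_cube \<in> sets borel"
  unfolding unit_cube_def by measurable

lemma emeasure_unit_cube: "emeasure lborel (unit_cube :: (real^'m::finite^'l::finite) set) = 1"
proof -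
  have "unit_cube = cbox (0 :: real^'m^'l) (\<chi> p i. 1)"
    by (auto simp: unit_cube_def mem_box Basis_vec_def inner_axis)
  moreover have "emeasure lborel (cbox (0 :: real^'m^'l) (\<chi> p i. 1)) = ennreal (\<Prod>b\<in>Basis. ((\<chi> p i. 1) - (0 :: real^'m^'l)) \<bullet> b)"
    by (rule emeasure_lborel_cbox) (auto simp: Basis_vec_def inner_axis)
  ultimately show ?thesis by (simp add: prod_Basis_vec inner_axis)
qed

lemma nn_integral_cube: "(\<integral>\<^sup>+b. indicator (dead_vec {}) (b :: real^'k::finite) \<partial>lborel) = 1"
proof -
  have "dead_vec {} = cbox (0 :: real^'k) (\<chi> i. 1)"
    by (auto simp: dead_vec_def mem_box_cart)
  then have "(\<integral>\<^sup>+b. indicator (dead_vec {}) (b :: real^'k) \<partial>lborel) = emeasure lborel (cbox (0 :: real^'k) (\<chi> i. 1))"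
    by (simp only: nn_integral_indicator sets_lborel borel_closed[OF closed_cbox])
  also have "\<dots> = ennreal (\<Prod>b\<in>Basis. ((\<chi> i. 1) - (0 :: real^'k)) \<bullet> b)"
    by (rule emeasure_lborel_cbox) (auto simp: Basis_vec_def inner_axis)
  finally show ?thesis by (simp add: prod_Basis_vec inner_axis)
qed

section \<open>Schur complements of bordered matrices\<close>

definition border_factor :: "'m set \<Rightarrow> 'm \<Rightarrow> real \<Rightarrow> real^'m \<Rightarrow> real^'m^'m" where
  "border_factor S j y b = (\<chi> p q. if p = j then (if q = j then sqrt y else if q \<in> S then b $ q / sqrt y else 0)
     else if p = q then 1 else 0)"

text \<open>Only row \<open>j\<close> differs from the identity, and Cramer's lemma for a
  combination of rows leaves its diagonal entry.\<close>

lemma det_border_factor: "det (border_factor S j y b) = sqrt y"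
proof -
  let ?a = "\<chi> q. (if q = j then sqrt y else if q \<in> S then b $ q / sqrt y else 0)"
  have r: "row i (mat 1 :: real^'a^'a) = axis i 1" for i
    by (auto simp: row_def mat_def axis_def vec_eq_iff)
  have "det (\<chi> i. if i = j then (\<Sum>q\<in>UNIV. ?a $ q *s row q (mat 1 :: real^'a^'a)) else row i (mat 1)) = ?a $ j * det (mat 1 :: real^'a^'a)"
    by (rule cramer_lemma_transpose)
  also have "(\<chi> i. if i = j then (\<Sum>q\<in>UNIV. ?a $ q *s row q (mat 1 :: real^'a^'a)) else row i (mat 1)) = border_factor S j y b"
    unfolding r basis_expansion by (auto simp: border_factor_def vec_eq_iff axis_def)
  finally show ?thesis by simp
qed

text \<open>The rank one matrix b b'/y on \<open>S\<close>; subtracting it from the block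
  \<open>c\<close> leaves the Schur complement of the corner \<open>y\<close>.\<close>

definition schur :: "'m set \<Rightarrow> real \<Rightarrow> real^'m \<Rightarrow> real^'m^'m" where
  "schur S y b = (\<chi> p q. if p \<in> S \<and> q \<in> S then b $ p * b $ q / y else 0)"

text \<open>One step of a Cholesky factorisation with pivot \<open>y\<close>. Positivity and
  determinant of the bordered matrix are thereby reduced to those of the Schur complement, whose
  padding puts 1 in the place of the pivot.\<close>

lemma border_congruence:
  assumes j: "j \<notin> S" and y: "0 < y"
  shows "border S j y b c = transpose (border_factor S j y b) ** pad S (c - schur S y b) ** border_factor S j y b"
proof -
  let ?X = "border_factor S j y b" and ?D = "pad S (c - schur S y b)"
  have sx: "(\<Sum>r\<in>UNIV. ?X $ r $ p * f r) = ?X $ j $ p * f j + (if p \<noteq> j then f p else 0)" for p and f :: "'a \<Rightarrow> real"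
  proof -
    have "(\<Sum>r\<in>UNIV. ?X $ r $ p * f r) = ?X $ j $ p * f j + (\<Sum>r\<in>UNIV - {j}. ?X $ r $ p * f r)"
      by (simp add: sum.remove)
    also have "(\<Sum>r\<in>UNIV - {j}. ?X $ r $ p * f r) = (\<Sum>r\<in>UNIV - {j}. if r = p then f r else 0)"
      by (intro sum.cong) (auto simp: border_factor_def)
    finally show ?thesis by (simp add: sum.delta)
  qed
  have "(transpose ?X ** ?D ** ?X) $ p $ q = border S j y b c $ p $ q" for p q
  proof -
    have "(transpose ?X ** ?D ** ?X) $ p $ q = (\<Sum>r\<in>UNIV. ?X $ r $ q * (\<Sum>s\<in>UNIV. ?X $ s $ p * ?D $ s $ r))"
      by (simp add: matrix_matrix_mult_def transpose_def mult.commute)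
    also have "\<dots> = border S j y b c $ p $ q"
      unfolding sx using j y
      by (cases "p = j"; cases "q = j"; cases "p \<in> S"; cases "q \<in> S")
         (auto simp: border_def border_factor_def pad_def schur_def)
    finally show ?thesis .
  qed
  then show ?thesis by (simp add: vec_eq_iff)
qed

lemma border_pos_def_iff:
  assumes "j \<notin> S" "0 < y"
  shows "border S j y b c \<in> pos_def_matrices \<longleftrightarrow> pad S (c - schur S y b) \<in> pos_def_matrices"
  unfolding border_congruence[OF assms]
  using assms by (intro pos_def_congruence_iff) (simp add: invertible_det_nz det_border_factor)

lemma det_border:
  assumes "j \<notin> S" "0 < y"
  shows "det (border S j y b c) = y * det (pad S (c - schur S y b))"
  unfolding border_congruence[OF assms] using assms(2)
  by (simp add: det_mul det_transpose det_border_factor)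

lemma border_pos_def_imp_pos: "border S j y b c \<in> pos_def_matrices \<Longrightarrow> 0 < y"
  using pos_def_pos[of "border S j y b c" "axis j 1"]
  by (simp add: matrix_vector_mul_component inner_axis' border_def matrix_vector_mult_basis column_def)

definition gram_weight :: "(real^'m^'m \<Rightarrow> ennreal) \<Rightarrow> real \<Rightarrow> real^'m^'m \<Rightarrow> ennreal" where
  "gram_weight F e A = indicator pos_def_matrices A * ennreal (det A powr e) * F A"

lemma borel_gram_weight [measurable]:
  assumes [measurable]: "F \<in> borel_measurable borel"
  shows "gram_weight F e \<in> borel_measurable borel"
  unfolding gram_weight_def by measurable

text \<open>The determinant factors as the pivot times that of the Schur complement.
  \<open>F\<close> is pulled back along the same congruence, so that it still sees the bordered
  matrix.\<close>

lemma gram_weight_border: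
  assumes "j \<notin> S" "0 < y"
  shows "gram_weight F e (border S j y b c) = ennreal (y powr e) *
    gram_weight (\<lambda>A. F (border S j y b (A + schur S y b))) e (pad S (c - schur S y b))"
proof -
  have b: "border S j y b (pad S (c - schur S y b) + schur S y b) = border S j y b c"
    using assms by (auto simp: border_def pad_def schur_def vec_eq_iff)
  show ?thesis
  proof (cases "pad S (c - schur S y b) \<in> pos_def_matrices")
    case True
    then show ?thesis
      using pos_def_det_pos[OF True] assms
      by (simp add: gram_weight_def border_pos_def_iff det_border b powr_mult ennreal_mult mult_ac)
  qed (simp add: gram_weight_def border_pos_def_iff assms)
qed

section \<open>The induction on columns\<close>

lemma nn_integral_split_row:
  fixes h :: "real^'k^'m \<Rightarrow> ennreal"
  assumes [measurable]: "h \<in> borel_measurable borel"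
  shows "(\<integral>\<^sup>+u. h u \<partial>lborel) = (\<integral>\<^sup>+w. \<integral>\<^sup>+u. indicator (dead_vec {}) (u $ j) * h (\<chi> p. if p = j then w else u $ p) \<partial>lborel \<partial>lborel)"
proof -
  define T :: "real^'k \<Rightarrow> real^'k^'m" where "T w = (\<chi> p. if p = j then w else 0)" for w
  have "linear T" by (rule linearI) (auto simp: T_def vec_eq_iff)
  then have "(\<integral>\<^sup>+u. h u \<partial>lborel) = (\<integral>\<^sup>+w. \<integral>\<^sup>+u. indicator (dead_vec {}) (u $ j) * h (u - T (u $ j) + T w) \<partial>lborel \<partial>lborel)"
    by (intro nn_integral_lborel_split) (simp_all add: nn_integral_cube linear_iff, simp add: T_def)
  moreover have "u - T (u $ j) + T w = (\<chi> p. if p = j then w else u $ p)" for u w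
    by (auto simp: T_def vec_eq_iff)
  ultimately show ?thesis by simp
qed

lemma nn_integral_split_coordinate:
  fixes h :: "real^'k^'m \<Rightarrow> ennreal"
  assumes [measurable]: "h \<in> borel_measurable borel"
  shows "(\<integral>\<^sup>+u. h u \<partial>lborel) = (\<integral>\<^sup>+t. \<integral>\<^sup>+u. indicator (dead_vec {}) (\<chi> p. u $ p $ i) * h (\<chi> p q. if q = i then t $ p else u $ p $ q) \<partial>lborel \<partial>lborel)"
proof -
  define T :: "real^'m \<Rightarrow> real^'k^'m" where "T t = (\<chi> p q. if q = i then t $ p else 0)" for t
  have "linear T" by (rule linearI) (auto simp: T_def vec_eq_iff)
  then have "(\<integral>\<^sup>+u. h u \<partial>lborel) = (\<integral>\<^sup>+t. \<integral>\<^sup>+u. indicator (dead_vec {}) (\<chi> p. u $ p $ i) * h (u - T (\<chi> p. u $ p $ i) + T t) \<partial>lborel \<partial>lborel)"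
    by (intro nn_integral_lborel_split) (simp_all add: nn_integral_cube linear_iff vec_eq_iff, simp add: T_def)
  moreover have "u - T (\<chi> p. u $ p $ i) + T t = (\<chi> p q. if q = i then t $ p else u $ p $ q)" for u t
    by (auto simp: T_def vec_eq_iff)
  ultimately show ?thesis by simp
qed

text \<open>A reflection takes sqrt y times the \<kappa>-th unit vector to the part of
  \<open>w\<close> in \<open>K\<close>, and fixes the directions outside \<open>K\<close>. Applied
  to all rows in \<open>S\<close> it preserves their mutual products, while products with
  \<open>w\<close> collapse to a single coordinate.\<close>

lemma rotate_columns:
  fixes K :: "'k::finite set" and w :: "real^'k" and S :: "'m::finite set"
  defines "y \<equiv> \<Sum>i\<in>K. (w $ i)\<^sup>2"
  assumes \<kappa>: "\<kappa> \<in> K"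
  obtains \<phi> :: "real^'k^'m \<Rightarrow> real^'k^'m" where "orthogonal_transformation \<phi>"
    "\<And>u p. p \<notin> S \<Longrightarrow> \<phi> u $ p = u $ p"
    "\<And>u p i. i \<notin> K \<Longrightarrow> \<phi> u $ p $ i = u $ p $ i"
    "\<And>u p q. p \<in> S \<Longrightarrow> q \<in> S \<Longrightarrow> (\<Sum>i\<in>K. \<phi> u $ p $ i * \<phi> u $ q $ i) = (\<Sum>i\<in>K. u $ p $ i * u $ q $ i)"
    "\<And>u p. p \<in> S \<Longrightarrow> (\<Sum>i\<in>K. w $ i * \<phi> u $ p $ i) = sqrt y * u $ p $ \<kappa>"
proof -
  define a where "a = sqrt y *\<^sub>R axis \<kappa> (1::real)"
  define b where "b = (\<chi> i. if i \<in> K then w $ i else 0)"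
  have sumb: "b \<bullet> x = (\<Sum>i\<in>K. w $ i * x $ i)" for x
    by (simp add: b_def inner_vec_def if_distrib[of "\<lambda>a. a * _"] sum.If_cases)
  have "0 \<le> y" by (simp add: y_def sum_nonneg)
  moreover have "b \<bullet> b = y"
    unfolding sumb y_def by (intro sum.cong) (auto simp: b_def power2_eq_square)
  ultimately have "norm a = norm b" by (simp add: a_def norm_eq_sqrt_inner inner_axis' flip: power2_eq_square)
  then obtain g where g: "orthogonal_matrix g" "g *v a = b" "\<And>x. x \<bullet> a = x \<bullet> b \<Longrightarrow> g *v x = x"
    by (metis orthogonal_matrix_reflection)
  have ge: "g *v axis i 1 = axis i 1" if "i \<notin> K" for i
    using that \<kappa> by (intro g(3)) (auto simp: a_def b_def inner_axis', auto simp: axis_def split: if_splits)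
  have gi: "(g *v x) $ i = x $ i" if "i \<notin> K" for x i
    using orthogonal_matrix_inner[OF g(1), of x "axis i 1"] ge[OF that] by (simp add: inner_axis)
  have split: "x \<bullet> z = (\<Sum>i\<in>K. x $ i * z $ i) + (\<Sum>i\<in>-K. x $ i * z $ i)" for x z :: "real^'k"
    unfolding inner_vec_def using sum.subset_diff[of K UNIV "\<lambda>i. x $ i * z $ i"] by (simp add: Compl_eq_Diff_UNIV)
  have gK: "(\<Sum>i\<in>K. (g *v x) $ i * (g *v z) $ i) = (\<Sum>i\<in>K. x $ i * z $ i)" for x z
    using split[of "g *v x" "g *v z"] split[of x z] by (simp add: orthogonal_matrix_inner[OF g(1)] gi)
  have ga: "(\<Sum>i\<in>K. w $ i * (g *v x) $ i) = sqrt y * x $ \<kappa>" for x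
    using orthogonal_matrix_inner[OF g(1), of a x] by (simp add: g(2) sumb) (simp add: a_def inner_axis')
  define \<phi> where "\<phi> u = (\<chi> p. if p \<in> S then g *v (u $ p) else u $ p)" for u :: "real^'k^'m"
  have "orthogonal_transformation \<phi>"
    unfolding orthogonal_transformation_def
  proof (intro conjI allI)
    show "linear \<phi>"
      by (rule linearI) (auto simp: \<phi>_def vec_eq_iff matrix_vector_right_distrib matrix_vector_mult_scaleR)
    show "\<phi> v \<bullet> \<phi> u = v \<bullet> u" for v u
      unfolding inner_matrix_rows by (intro sum.cong) (auto simp: \<phi>_def orthogonal_matrix_inner[OF g(1)])
  qed
  then show ?thesis
    by (rule that) (auto simp: \<phi>_def gi gK ga)
qed

text \<open>
  The column \<open>w\<close> is rotated into the coordinate direction \<open>\<kappa>\<close>.  Its products with the other columns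
  are then multiples of their \<open>\<kappa>\<close>-coordinates \<open>t\<close>, which are split off as well.
\<close>

lemma gram_column_step:
  fixes K :: "'k::finite set" and S :: "'m::finite set" and F :: "real^'m^'m \<Rightarrow> ennreal"
  defines "n \<equiv> \<lambda>w :: real^'k. \<Sum>i\<in>K. (w $ i)\<^sup>2"
  assumes \<kappa>: "\<kappa> \<in> K" and j: "j \<notin> S" and [measurable]: "F \<in> borel_measurable borel"
  shows "(\<integral>\<^sup>+u. indicator (dead_cols (insert j S) K) u * F (pad (insert j S) (partial_gram K u)) \<partial>lborel)
    = (\<integral>\<^sup>+w. indicator (dead_vec K) w *
        (\<integral>\<^sup>+t. indicator (dead_vec S) t * (\<integral>\<^sup>+u. indicator (dead_cols S (K - {\<kappa>})) u *
          F (border S j (n w) (sqrt (n w) *\<^sub>R t) (pad S (partial_gram (K - {\<kappa>}) u) + (\<chi> p q. t $ p * t $ q)))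
        \<partial>lborel) \<partial>lborel) \<partial>lborel)"
proof -
  let ?U = "\<lambda>u w. (\<chi> p. if p = j then w else u $ p) :: real^'k^'m"
  let ?V = "\<lambda>u t. (\<chi> p q. if q = \<kappa> then t $ p else u $ p $ q) :: real^'k^'m"
  let ?K = "K - {\<kappa>}"
  have "(\<integral>\<^sup>+u. indicator (dead_cols (insert j S) K) u * F (pad (insert j S) (partial_gram K u)) \<partial>lborel)
    = (\<integral>\<^sup>+w. \<integral>\<^sup>+u. indicator (dead_vec {}) (u $ j) * (indicator (dead_cols (insert j S) K) (?U u w) *
         F (pad (insert j S) (partial_gram K (?U u w)))) \<partial>lborel \<partial>lborel)"
    by (rule nn_integral_split_row) measurable
  \<comment> \<open>The two cube conditions change places: row \<open>j\<close> of \<open>u\<close>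
    turns into a dummy of the smaller set \<open>S\<close>, and \<open>w\<close> carries the
    conditions that row \<open>j\<close> had.\<close>
  also have "\<dots> = (\<integral>\<^sup>+w. \<integral>\<^sup>+u. indicator (dead_vec K) w * (indicator (dead_cols S K) u *
         F (pad (insert j S) (partial_gram K (?U u w)))) \<partial>lborel \<partial>lborel)"
  proof (intro nn_integral_cong)
    fix w :: "real^'k" and u :: "real^'k^'m"
    have "u $ j \<in> dead_vec {} \<and> ?U u w \<in> dead_cols (insert j S) K \<longleftrightarrow> w \<in> dead_vec K \<and> u \<in> dead_cols S K"
      using j unfolding dead_vec_def dead_cols_def mem_Collect_eq vec_lambda_beta
      by (smt (verit, best) empty_iff insert_iff)
    then show "indicator (dead_vec {}) (u $ j) * (indicator (dead_cols (insert j S) K) (?U u w) * F (pad (insert j S) (partial_gram K (?U u w))))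
      = indicator (dead_vec K) w * (indicator (dead_cols S K) u * F (pad (insert j S) (partial_gram K (?U u w))))"
      by (auto simp: indicator_def)
  qed
  also have "\<dots> = (\<integral>\<^sup>+w. indicator (dead_vec K) w * (\<integral>\<^sup>+u. indicator (dead_cols S K) u *
         F (pad (insert j S) (partial_gram K (?U u w))) \<partial>lborel) \<partial>lborel)"
    by (intro nn_integral_cong nn_integral_cmult) measurable
  also have "\<dots> = (\<integral>\<^sup>+w. indicator (dead_vec K) w *
        (\<integral>\<^sup>+t. indicator (dead_vec S) t * (\<integral>\<^sup>+u. indicator (dead_cols S ?K) u *
          F (border S j (n w) (sqrt (n w) *\<^sub>R t) (pad S (partial_gram ?K u) + (\<chi> p q. t $ p * t $ q)))
        \<partial>lborel) \<partial>lborel) \<partial>lborel)"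
  proof (intro nn_integral_cong arg_cong2[where f="(*)"] refl)
    fix w :: "real^'k"
    obtain \<phi> :: "real^'k^'m \<Rightarrow> real^'k^'m" where \<phi>: "orthogonal_transformation \<phi>"
      "\<And>u p. p \<notin> S \<Longrightarrow> \<phi> u $ p = u $ p"
      "\<And>u p i. i \<notin> K \<Longrightarrow> \<phi> u $ p $ i = u $ p $ i"
      "\<And>u p q. p \<in> S \<Longrightarrow> q \<in> S \<Longrightarrow> (\<Sum>i\<in>K. \<phi> u $ p $ i * \<phi> u $ q $ i) = (\<Sum>i\<in>K. u $ p $ i * u $ q $ i)"
      "\<And>u p. p \<in> S \<Longrightarrow> (\<Sum>i\<in>K. w $ i * \<phi> u $ p $ i) = sqrt (n w) * u $ p $ \<kappa>"
      using rotate_columns[OF \<kappa>, of S w] unfolding n_def by blast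
    have [measurable]: "\<phi> \<in> borel_measurable borel"
      using \<phi>(1) by (intro borel_measurable_linear) (simp add: orthogonal_transformation)
    have "(\<integral>\<^sup>+u. indicator (dead_cols S K) u * F (pad (insert j S) (partial_gram K (?U u w))) \<partial>lborel)
      = (\<integral>\<^sup>+u. indicator (dead_cols S K) u * F (pad (insert j S) (partial_gram K (?U u w))) \<partial>distr lborel borel \<phi>)"
      by (simp add: lborel_distr_orthogonal[OF \<phi>(1)])
    also have "\<dots> = (\<integral>\<^sup>+u. indicator (dead_cols S K) (\<phi> u) * F (pad (insert j S) (partial_gram K (?U (\<phi> u) w))) \<partial>lborel)"
      by (subst nn_integral_distr) simp_all
    also have "\<dots> = (\<integral>\<^sup>+u. indicator (dead_cols S K) u *
        F (border S j (n w) (sqrt (n w) *\<^sub>R (\<chi> p. u $ p $ \<kappa>)) (partial_gram K u)) \<partial>lborel)"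
    proof (intro nn_integral_cong)
      fix u
      have "\<phi> u \<in> dead_cols S K \<longleftrightarrow> u \<in> dead_cols S K"
        unfolding dead_cols_def mem_Collect_eq using \<phi>(2,3) by (metis (no_types, lifting))
      moreover have "pad (insert j S) (partial_gram K (?U (\<phi> u) w)) = border S j (n w) (sqrt (n w) *\<^sub>R (\<chi> p. u $ p $ \<kappa>)) (partial_gram K u)"
        using j \<phi>(4,5)
        by (auto simp: vec_eq_iff pad_def border_def partial_gram_def n_def power2_eq_square mult.commute)
      ultimately show "indicator (dead_cols S K) (\<phi> u) * F (pad (insert j S) (partial_gram K (?U (\<phi> u) w)))
         = indicator (dead_cols S K) u * F (border S j (n w) (sqrt (n w) *\<^sub>R (\<chi> p. u $ p $ \<kappa>)) (partial_gram K u))"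
        by (simp add: indicator_def)
    qed
    \<comment> \<open>Taking out the \<kappa>-coordinates adds the rank one matrix t t' to the Gram
      matrix and makes \<kappa> a dummy, whence \<open>K - {\<kappa>}\<close>.\<close>
    also have "\<dots> = (\<integral>\<^sup>+t. \<integral>\<^sup>+u. indicator (dead_vec {}) (\<chi> p. u $ p $ \<kappa>) * (indicator (dead_cols S K) (?V u t) *
        F (border S j (n w) (sqrt (n w) *\<^sub>R (\<chi> p. ?V u t $ p $ \<kappa>)) (partial_gram K (?V u t)))) \<partial>lborel \<partial>lborel)"
      by (rule nn_integral_split_coordinate) measurable
    also have "\<dots> = (\<integral>\<^sup>+t. \<integral>\<^sup>+u. indicator (dead_vec S) t * (indicator (dead_cols S ?K) u *
          F (border S j (n w) (sqrt (n w) *\<^sub>R t) (pad S (partial_gram ?K u) + (\<chi> p q. t $ p * t $ q)))) \<partial>lborel \<partial>lborel)"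
    proof (intro nn_integral_cong)
      fix t and u :: "real^'k^'m"
      have "(\<chi> p. u $ p $ \<kappa>) \<in> dead_vec {} \<and> ?V u t \<in> dead_cols S K \<longleftrightarrow> t \<in> dead_vec S \<and> u \<in> dead_cols S ?K"
        using \<kappa> unfolding dead_vec_def dead_cols_def mem_Collect_eq vec_lambda_beta
        by (smt (verit, best) Diff_iff empty_iff insert_iff)
      moreover have "partial_gram K (?V u t) = partial_gram ?K u + (\<chi> p q. t $ p * t $ q)"
        using \<kappa> by (auto simp: partial_gram_def vec_eq_iff sum.remove[of K \<kappa>] intro!: sum.cong)
      moreover have "border S j (n w) (sqrt (n w) *\<^sub>R t) (partial_gram ?K u + (\<chi> p q. t $ p * t $ q))
         = border S j (n w) (sqrt (n w) *\<^sub>R t) (pad S (partial_gram ?K u) + (\<chi> p q. t $ p * t $ q))"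
        by (auto simp: border_def pad_def vec_eq_iff)
      ultimately show "indicator (dead_vec {}) (\<chi> p. u $ p $ \<kappa>) * (indicator (dead_cols S K) (?V u t) *
           F (border S j (n w) (sqrt (n w) *\<^sub>R (\<chi> p. ?V u t $ p $ \<kappa>)) (partial_gram K (?V u t))))
         = indicator (dead_vec S) t * (indicator (dead_cols S ?K) u *
           F (border S j (n w) (sqrt (n w) *\<^sub>R t) (pad S (partial_gram ?K u) + (\<chi> p q. t $ p * t $ q))))"
        by (auto simp: indicator_def)
    qed
    also have "\<dots> = (\<integral>\<^sup>+t. indicator (dead_vec S) t * (\<integral>\<^sup>+u. indicator (dead_cols S ?K) u *
          F (border S j (n w) (sqrt (n w) *\<^sub>R t) (pad S (partial_gram ?K u) + (\<chi> p q. t $ p * t $ q))) \<partial>lborel) \<partial>lborel)"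
      by (intro nn_integral_cong nn_integral_cmult) measurable
    finally show "(\<integral>\<^sup>+u. indicator (dead_cols S K) u * F (pad (insert j S) (partial_gram K (?U u w))) \<partial>lborel) = \<dots>" .
  qed
  finally show ?thesis .
qed

text \<open>The counterpart of \<open>gram_column_step\<close> on the side of the cone: row
  \<open>j\<close> of the symmetric matrix is split off as the border \<open>b\<close>, and then the
  corner \<open>y\<close> is split off from \<open>b\<close>.\<close>

lemma sym_column_step:
  fixes S :: "'m::finite set" and G :: "real^'m^'m \<Rightarrow> ennreal"
  assumes j: "j \<notin> S" and [measurable]: "G \<in> borel_measurable borel"
  shows "(\<integral>\<^sup>+c. indicator (dead_sym (insert j S)) c * G (pad (insert j S) c) \<partial>sym_lborel)
    = (\<integral>\<^sup>+y. \<integral>\<^sup>+b. indicator (dead_vec S) b * (\<integral>\<^sup>+c. indicator (dead_sym S) c * G (border S j y b c) \<partial>sym_lborel) \<partial>lborel \<partial>lborel)"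
proof -
  \<comment> \<open>The vector fills row and column \<open>j\<close> at once. The result is
    symmetric, so that translation by it preserves \<open>sym_lborel\<close>.\<close>
  define T :: "real^'m \<Rightarrow> real^'m^'m" where "T b = (\<chi> p q. if p = j then b $ q else if q = j then b $ p else 0)" for b
  define T' :: "real \<Rightarrow> real^'m" where "T' y = axis j y" for y
  have T: "linear T" by (rule linearI) (auto simp: T_def vec_eq_iff)
  have T': "linear T'" by (rule linearI) (auto simp: T'_def axis_def vec_eq_iff)
  have tT: "transpose (T b) = T b" for b by (simp add: T_def transpose_def vec_eq_iff)
  have [measurable]: "T \<in> borel_measurable borel" "T' \<in> borel_measurable borel"
    using T T' by (auto intro: borel_measurable_linear)
  let ?h = "\<lambda>c. indicator (dead_sym (insert j S)) c * G (pad (insert j S) c)"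
  have "(\<integral>\<^sup>+c. ?h c \<partial>sym_lborel) = (\<integral>\<^sup>+b. \<integral>\<^sup>+c. indicator (dead_vec {}) (c $ j) * ?h (c - T (c $ j) + T b) \<partial>sym_lborel \<partial>lborel)"
    by (rule nn_integral_split[where \<pi>="\<lambda>c. c $ j", OF sigma_finite_sym_lborel])
       (simp_all add: T nn_integral_sym_lborel_shift tT nn_integral_cube linear_iff vec_eq_iff, simp_all add: T_def)
  also have "\<dots> = (\<integral>\<^sup>+b. indicator (dead_vec (insert j S)) b * (\<integral>\<^sup>+c. indicator (dead_sym S) c * G (border S j (b $ j) b c) \<partial>sym_lborel) \<partial>lborel)"
  proof (rule nn_integral_cong)
    fix b :: "real^'m"
    have "(\<integral>\<^sup>+c. indicator (dead_vec {}) (c $ j) * ?h (c - T (c $ j) + T b) \<partial>sym_lborel)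
      = (\<integral>\<^sup>+c. indicator (dead_vec (insert j S)) b * (indicator (dead_sym S) c * G (border S j (b $ j) b c)) \<partial>sym_lborel)"
    \<comment> \<open>The symmetry of \<open>c\<close> is essential: subtracting row
      \<open>j\<close> clears column \<open>j\<close> only for symmetric matrices, and these carry
      the whole measure.\<close>
    proof (rule nn_integral_cong_AE, use AE_sym_lborel_symmetric in eventually_elim)
      fix c :: "real^'m^'m" assume "transpose c = c"
      then have c: "c $ p $ q = c $ q $ p" for p q by (simp add: transpose_def vec_eq_iff)
      let ?c = "c - T (c $ j) + T b"
      have c': "?c $ p $ q = (if p = j then b $ q else if q = j then b $ p else c $ p $ q)" for p q
        by (auto simp: T_def c[of j p])
      have "pad (insert j S) ?c = border S j (b $ j) b c"
        using j by (auto simp: pad_def border_def vec_eq_iff c' simp del: vector_add_component vector_minus_component)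
      moreover have "c $ j \<in> dead_vec {} \<and> ?c \<in> dead_sym (insert j S) \<longleftrightarrow> b \<in> dead_vec (insert j S) \<and> c \<in> dead_sym S"
        unfolding dead_vec_def dead_sym_def mem_Collect_eq c' using j c
        by (smt (verit, best) empty_iff insert_iff)
      ultimately show "indicator (dead_vec {}) (c $ j) * ?h ?c = indicator (dead_vec (insert j S)) b * (indicator (dead_sym S) c * G (border S j (b $ j) b c))"
        by (auto simp: indicator_def)
    qed
    also have "\<dots> = indicator (dead_vec (insert j S)) b * (\<integral>\<^sup>+c. indicator (dead_sym S) c * G (border S j (b $ j) b c) \<partial>sym_lborel)"
      by (rule nn_integral_cmult) measurable
    finally show "(\<integral>\<^sup>+c. indicator (dead_vec {}) (c $ j) * ?h (c - T (c $ j) + T b) \<partial>sym_lborel) = \<dots>" .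
  qed
  \<comment> \<open>Second splitting, of the corner entry from \<open>b\<close>, with the interval
    [0,1] as dummy weight.\<close>
  also have "\<dots> = (\<integral>\<^sup>+y. \<integral>\<^sup>+b. indicator {0..1} (b $ j) *
      (indicator (dead_vec (insert j S)) (b - T' (b $ j) + T' y) * (\<integral>\<^sup>+c. indicator (dead_sym S) c * G (border S j ((b - T' (b $ j) + T' y) $ j) (b - T' (b $ j) + T' y) c) \<partial>sym_lborel)) \<partial>lborel \<partial>lborel)"
  proof (rule nn_integral_lborel_split[where \<pi>="\<lambda>b. b $ j"])
    show "linear (\<lambda>b :: real^'m. b $ j)" by (simp add: linear_iff)
    show "T' y $ j = y" for y by (simp add: T'_def)
  qed (simp_all add: T')
  also have "\<dots> = (\<integral>\<^sup>+y. \<integral>\<^sup>+b. indicator (dead_vec S) b * (\<integral>\<^sup>+c. indicator (dead_sym S) c * G (border S j y b c) \<partial>sym_lborel) \<partial>lborel \<partial>lborel)"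
  proof (intro nn_integral_cong)
    fix y b
    have b': "(b - T' (b $ j) + T' y) $ i = (if i = j then y else b $ i)" for i
      by (simp add: T'_def axis_def)
    have "border S j ((b - T' (b $ j) + T' y) $ j) (b - T' (b $ j) + T' y) c = border S j y b c" for c
      using j unfolding border_def b' by (auto simp: vec_eq_iff)
    moreover have "b $ j \<in> {0..1} \<and> b - T' (b $ j) + T' y \<in> dead_vec (insert j S) \<longleftrightarrow> b \<in> dead_vec S"
      unfolding dead_vec_def mem_Collect_eq b' using j by (smt (verit, best) insert_iff)
    ultimately show "indicator {0..1} (b $ j) *
      (indicator (dead_vec (insert j S)) (b - T' (b $ j) + T' y) * (\<integral>\<^sup>+c. indicator (dead_sym S) c * G (border S j ((b - T' (b $ j) + T' y) $ j) (b - T' (b $ j) + T' y) c) \<partial>sym_lborel))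
      = indicator (dead_vec S) b * (\<integral>\<^sup>+c. indicator (dead_sym S) c * G (border S j y b c) \<partial>sym_lborel)"
      by (auto simp: indicator_def)
  qed
  finally show ?thesis .
qed

lemma nn_integral_coordinate_scale:
  fixes g :: "real^'m::finite \<Rightarrow> ennreal"
  assumes [measurable]: "g \<in> borel_measurable borel" and a: "\<And>p. a p \<noteq> 0"
  shows "(\<integral>\<^sup>+b. g b \<partial>lborel) = ennreal \<bar>\<Prod>p\<in>UNIV. a p\<bar> * (\<integral>\<^sup>+t. g (\<chi> p. a p * t $ p) \<partial>lborel)"
proof -
  define c where "c b = (\<Sum>p\<in>UNIV. a p * b $ p)" for b :: "real^'m"
  define T where "T x = 0 + (\<Sum>j\<in>Basis. (c j * (x \<bullet> j)) *\<^sub>R j)" for x :: "real^'m"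
  have ca: "c (axis p 1) = a p" for p
    by (simp add: c_def axis_def if_distrib[of "\<lambda>x. _ * x"] cong: if_cong)
  have inj: "inj_on (\<lambda>p :: 'm. axis p (1::real)) UNIV" by (auto simp: inj_on_def axis_eq_axis)
  have B: "(Basis :: (real^'m) set) = range (\<lambda>p. axis p 1)" by (auto simp: Basis_vec_def)
  have T: "T x = (\<chi> p. a p * x $ p)" for x
    unfolding T_def B by (subst sum.reindex[OF inj])
      (simp add: ca inner_axis vec_eq_iff, simp add: axis_def if_distrib[of "\<lambda>x. _ * x"] cong: if_cong)
  have [measurable]: "T \<in> borel_measurable borel" unfolding T by measurable
  have pr: "(\<Prod>j\<in>Basis. \<bar>c j\<bar>) = \<bar>\<Prod>p\<in>UNIV. a p\<bar>"
    unfolding B by (subst prod.reindex[OF inj]) (simp add: ca abs_prod)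
  have "lborel = density (distr lborel borel T) (\<lambda>_. (\<Prod>j\<in>Basis. \<bar>c j\<bar>))"
    unfolding T_def using a by (intro lborel_affine_euclidean) (auto simp: B ca)
  then have "(\<integral>\<^sup>+b. g b \<partial>lborel) = (\<integral>\<^sup>+b. g b \<partial>density (distr lborel borel T) (\<lambda>_. (\<Prod>j\<in>Basis. \<bar>c j\<bar>)))"
    by simp
  also have "\<dots> = ennreal \<bar>\<Prod>p\<in>UNIV. a p\<bar> * (\<integral>\<^sup>+t. g (T t) \<partial>lborel)"
    by (simp add: nn_integral_density nn_integral_distr nn_integral_cmult pr)
  finally show ?thesis unfolding T .
qed

lemma pad_empty: "pad {} c = mat 1"
  by (simp add: pad_def mat_def)

lemma mat_1_pos_def: "mat 1 \<in> pos_def_matrices"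
  by (simp add: pos_def_matrices_def transpose_mat)

text \<open>For b = sqrt y t on \<open>S\<close> the matrix t t' is exactly
  \<open>schur S y b\<close>. So the Gram matrix that remains after removing \<open>w\<close> and
  \<open>t\<close> is the Schur complement of the full one.\<close>

lemma border_rescale:
  assumes b: "\<And>p. p \<in> S \<Longrightarrow> b $ p = sqrt y * t $ p" and y: "0 < y"
  shows "border S j y (sqrt y *\<^sub>R t) (A + (\<chi> p q. t $ p * t $ q)) = border S j y b (A + schur S y b)"
proof -
  have "schur S y b $ p $ q = t $ p * t $ q" if "p \<in> S" "q \<in> S" for p q
  proof -
    have "schur S y b $ p $ q = (sqrt y * sqrt y) * (t $ p * t $ q) / y"
      using that by (simp add: schur_def b mult_ac)
    then show ?thesis using y by simp
  qed
  then show ?thesis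
    using b by (simp add: border_def vec_eq_iff)
qed

text \<open>Removing a column also uses up one coordinate, so the column number i is a vector in
  dimension \<open>card K - i\<close>; this explains the product of constants. The exponent is
  stable because both cardinalities drop by one. \<open>F\<close> is arbitrary in the induction, as
  each step replaces it by a function of the Schur complement.\<close>

lemma nn_integral_gram_partial:
  fixes S :: "'m::finite set" and K :: "'k::finite set" and F :: "real^'m^'m \<Rightarrow> ennreal"
  assumes "finite S" "card S \<le> card K" "F \<in> borel_measurable borel"
  shows "(\<integral>\<^sup>+u. indicator (dead_cols S K) u * F (pad S (partial_gram K u)) \<partial>lborel)
    = ennreal (\<Prod>i<card S. radial_const (card K - i)) *
      (\<integral>\<^sup>+c. indicator (dead_sym S) c * gram_weight F ((real (card K) - real (card S) - 1) / 2) (pad S c) \<partial>sym_lborel)"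
  using assms
proof (induction S arbitrary: K F)
  case (empty K F)
  have "dead_cols {} K = (unit_cube :: (real^'k^'m) set)" by (auto simp: dead_cols_def unit_cube_def)
  then have 1: "(\<integral>\<^sup>+u. indicator (dead_cols ({} :: 'm set) K) u \<partial>lborel) = 1"
    using dead_borel(1)[of "{} :: 'm set" K] by (simp add: emeasure_unit_cube)
  have "dead_sym {} = {c :: real^'m^'m. \<forall>p q. c $ p $ q \<in> {0..1}}"
    by (auto simp: dead_sym_def)
  then have 2: "(\<integral>\<^sup>+c. indicator (dead_sym ({} :: 'm set)) c \<partial>sym_lborel) = 1"
    using emeasure_sym_lborel_cube(1)[of 1, where 'm='m] dead_borel(3)[of "{} :: 'm set"] by simp
  \<comment> \<open>Without columns the Gram matrix is the identity, with determinant 1, and the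
    dummies have mass 1 on both sides.\<close>
  show ?case
    by (simp add: pad_empty gram_weight_def mat_1_pos_def nn_integral_multc 1 2)
next
  case (insert j S K F)
  note [measurable] = insert.prems(2)
  have "K \<noteq> {}" using insert by auto
  then obtain \<kappa> where \<kappa>: "\<kappa> \<in> K" by auto
  define q where "q = card (K - {\<kappa>})"
  have cK: "card K = Suc q" using \<kappa> unfolding q_def by (intro card.remove) auto
  define e where "e = (real (card K) - real (card (insert j S)) - 1) / 2"
  \<comment> \<open>The same exponent for \<open>S\<close> and \<open>K - {\<kappa>}\<close>, as
    required for matching the induction hypothesis with the goal.\<close>
  have e: "e = (real q - real (card S) - 1) / 2"
    using insert cK by (simp add: e_def)
  define C where "C = (\<Prod>i<card S. radial_const (q - i))"
  have C0: "0 \<le> C" unfolding C_def by (intro prod_nonneg) (auto simp: radial_const_nonneg)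
  define R where "R y = (\<integral>\<^sup>+b. indicator (dead_vec S) b * (\<integral>\<^sup>+c. indicator (dead_sym S) c * gram_weight F e (border S j y b c) \<partial>sym_lborel) \<partial>lborel)" for y
  have [measurable]: "R \<in> borel_measurable borel" unfolding R_def by measurable
  define \<Theta> where "\<Theta> y = (\<integral>\<^sup>+t. indicator (dead_vec S) t * (\<integral>\<^sup>+u. indicator (dead_cols S (K - {\<kappa>})) u *
     F (border S j y (sqrt y *\<^sub>R t) (pad S (partial_gram (K - {\<kappa>}) u) + (\<chi> p q. t $ p * t $ q))) \<partial>(lborel :: (real^'k^'m) measure)) \<partial>lborel)" for y
  have [measurable]: "\<Theta> \<in> borel_measurable borel" unfolding \<Theta>_def by measurable
  have \<Theta>: "ennreal (y powr (card K / 2 - 1)) * \<Theta> y = ennreal C * R y" if y: "0 < y" for y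
  proof -
    define g where "g b = indicator (dead_vec S) b * (\<integral>\<^sup>+c. indicator (dead_sym S) c *
        gram_weight (\<lambda>A. F (border S j y b (A + schur S y b))) e (pad S (c - schur S y b)) \<partial>sym_lborel)" for b
    have [measurable]: "(\<lambda>b. schur S y b) \<in> borel_measurable borel" unfolding schur_def by measurable
    have gw: "(\<lambda>c. indicator (dead_sym S) c * gram_weight (\<lambda>A. F (border S j y b (A + schur S y b))) e (pad S c)) \<in> borel_measurable borel" for b
      by measurable
    \<comment> \<open>A translation by the symmetric matrix \<open>schur S y b\<close> turns the
      Schur complement into a free variable; dummies are unaffected, since that matrix vanishes off
      \<open>S\<close>.\<close>
    have g: "g b = indicator (dead_vec S) b * (\<integral>\<^sup>+c. indicator (dead_sym S) c *
        gram_weight (\<lambda>A. F (border S j y b (A + schur S y b))) e (pad S c) \<partial>sym_lborel)" for b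
    proof -
      have "transpose (- schur S y b) = - schur S y b"
        by (auto simp: schur_def transpose_def vec_eq_iff mult.commute)
      moreover have "c + - schur S y b \<in> dead_sym S \<longleftrightarrow> c \<in> dead_sym S" for c
        by (auto simp: dead_sym_def schur_def)
      ultimately show ?thesis
        using nn_integral_sym_lborel_shift[OF gw, of "- schur S y b" b] unfolding g_def by (simp add: indicator_def)
    qed
    \<comment> \<open>The substitution b = sqrt y t on \<open>S\<close>, with scale 1 for the
      dummies. Its Jacobian is \<open>y powr (card S / 2)\<close>.\<close>
    define a where "a p = (if p \<in> S then sqrt y else 1)" for p
    have a: "\<And>p. a p \<noteq> 0" using y by (simp add: a_def)
    have "(\<Prod>p\<in>UNIV. a p) = sqrt y ^ card S" by (simp add: a_def prod.If_cases)
    then have pa: "\<bar>\<Prod>p\<in>UNIV. a p\<bar> = y powr (card S / 2)"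
      using y by (simp add: powr_half_sqrt[symmetric] powr_powr flip: powr_realpow)
    have "\<Theta> y = (\<integral>\<^sup>+t. ennreal C * g (\<chi> p. a p * t $ p) \<partial>lborel)"
      unfolding \<Theta>_def
    proof (rule nn_integral_cong)
      fix t :: "real^'m"
      let ?b = "\<chi> p. a p * t $ p"
      have b: "border S j y (sqrt y *\<^sub>R t) (A + (\<chi> p q. t $ p * t $ q)) = border S j y ?b (A + schur S y ?b)" for A
        using y by (intro border_rescale) (simp_all add: a_def)
      have d: "?b \<in> dead_vec S \<longleftrightarrow> t \<in> dead_vec S"
        by (auto simp: dead_vec_def a_def)
      have "(\<integral>\<^sup>+u. indicator (dead_cols S (K - {\<kappa>})) u *
        F (border S j y (sqrt y *\<^sub>R t) (pad S (partial_gram (K - {\<kappa>}) u) + (\<chi> p q. t $ p * t $ q))) \<partial>(lborel :: (real^'k^'m) measure))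
        = ennreal C * (\<integral>\<^sup>+c. indicator (dead_sym S) c * gram_weight (\<lambda>A. F (border S j y ?b (A + schur S y ?b))) e (pad S c) \<partial>sym_lborel)"
        unfolding b e C_def q_def
      proof (rule insert.IH)
        show "card S \<le> card (K - {\<kappa>})"
          using insert.prems(1) insert.hyps cK by (simp add: q_def[symmetric])
        show "(\<lambda>A. F (border S j y ?b (A + schur S y ?b))) \<in> borel_measurable borel" by measurable
      qed
      moreover have "indicator (dead_vec S) t = (indicator (dead_vec S) ?b :: ennreal)"
        by (simp add: indicator_def d)
      ultimately show "indicator (dead_vec S) t * (\<integral>\<^sup>+u. indicator (dead_cols S (K - {\<kappa>})) u *
        F (border S j y (sqrt y *\<^sub>R t) (pad S (partial_gram (K - {\<kappa>}) u) + (\<chi> p q. t $ p * t $ q))) \<partial>(lborel :: (real^'k^'m) measure))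
        = ennreal C * g ?b"
        unfolding g by (simp only: mult.left_commute)
    qed
    moreover have [measurable]: "g \<in> borel_measurable borel"
    proof -
      have "(\<lambda>(b, c). indicator (dead_sym S) c *
        gram_weight (\<lambda>A. F (border S j y b (A + schur S y b))) e (pad S (c - schur S y b))) \<in> borel_measurable (borel \<Otimes>\<^sub>M sym_lborel)"
        unfolding gram_weight_def by measurable
      then show ?thesis unfolding g_def by measurable
    qed
    ultimately have "\<Theta> y = ennreal C * (\<integral>\<^sup>+t. g (\<chi> p. a p * t $ p) \<partial>lborel)"
      by (simp add: nn_integral_cmult)
    then have "ennreal (y powr (card S / 2)) * \<Theta> y
        = ennreal C * (ennreal (y powr (card S / 2)) * (\<integral>\<^sup>+t. g (\<chi> p. a p * t $ p) \<partial>lborel))"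
      by (simp only: mult.left_commute)
    also have "\<dots> = ennreal C * (\<integral>\<^sup>+b. g b \<partial>lborel)"
      unfolding pa[symmetric] by (subst nn_integral_coordinate_scale[of g a, OF _ a]) simp_all
    finally have 1: "ennreal (y powr (card S / 2)) * \<Theta> y = ennreal C * (\<integral>\<^sup>+b. g b \<partial>lborel)" .
    have 2: "R y = ennreal (y powr e) * (\<integral>\<^sup>+b. g b \<partial>lborel)"
    proof -
      have "R y = (\<integral>\<^sup>+b. ennreal (y powr e) * g b \<partial>lborel)"
        unfolding R_def
      proof (rule nn_integral_cong)
        fix b :: "real^'m"
        have "(\<integral>\<^sup>+c. indicator (dead_sym S) c * gram_weight F e (border S j y b c) \<partial>sym_lborel)
           = (\<integral>\<^sup>+c. ennreal (y powr e) * (indicator (dead_sym S) c *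
                gram_weight (\<lambda>A. F (border S j y b (A + schur S y b))) e (pad S (c - schur S y b))) \<partial>sym_lborel)"
          unfolding gram_weight_border[OF insert.hyps(2) y] by (simp add: mult_ac)
        also have "\<dots> = ennreal (y powr e) * (\<integral>\<^sup>+c. indicator (dead_sym S) c *
                gram_weight (\<lambda>A. F (border S j y b (A + schur S y b))) e (pad S (c - schur S y b)) \<partial>sym_lborel)"
          by (rule nn_integral_cmult) measurable
        finally show "indicator (dead_vec S) b * (\<integral>\<^sup>+c. indicator (dead_sym S) c * gram_weight F e (border S j y b c) \<partial>sym_lborel)
          = ennreal (y powr e) * g b"
          unfolding g_def by (simp add: mult_ac)
      qed
      then show ?thesis by (simp add: nn_integral_cmult)
    qed
    \<comment> \<open>The powers of \<open>y\<close> balance: the left one belongs to the radial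
      density of the column, on the right \<open>e\<close> comes from the determinant and
      \<open>card S / 2\<close> from the Jacobian.\<close>
    have 3: "ennreal (y powr (card K / 2 - 1)) = ennreal (y powr e) * ennreal (y powr (card S / 2))"
    proof -
      have "card K / 2 - 1 = e + card S / 2" using insert(1,2) by (simp add: e_def field_simps)
      then show ?thesis by (simp add: powr_add ennreal_mult)
    qed
    have "ennreal (y powr (card K / 2 - 1)) * \<Theta> y = ennreal (y powr e) * (ennreal (y powr (card S / 2)) * \<Theta> y)"
      unfolding 3 by (rule mult.assoc)
    also have "\<dots> = ennreal C * R y"
      unfolding 1 2 by (rule mult.left_commute)
    finally show ?thesis .
  qed
  have "(\<integral>\<^sup>+u. indicator (dead_cols (insert j S) K) u * F (pad (insert j S) (partial_gram K u)) \<partial>lborel)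
    = (\<integral>\<^sup>+w. indicator (dead_vec K) w * \<Theta> (\<Sum>i\<in>K. (w $ i)\<^sup>2) \<partial>lborel)"
    unfolding \<Theta>_def using \<kappa> insert.hyps by (intro gram_column_step) auto
  also have "\<dots> = (\<integral>\<^sup>+y. ennreal (radial_const (card K)) * indicator {0<..} y * ennreal (y powr (card K / 2 - 1)) * \<Theta> y \<partial>lborel)"
    unfolding dead_vec_def by (rule nn_integral_radial) (auto simp: \<open>K \<noteq> {}\<close>)
  also have "\<dots> = (\<integral>\<^sup>+y. ennreal (radial_const (card K)) * ennreal C * R y \<partial>lborel)"
  proof (rule nn_integral_cong)
    fix y :: real
    show "ennreal (radial_const (card K)) * indicator {0<..} y * ennreal (y powr (card K / 2 - 1)) * \<Theta> y
       = ennreal (radial_const (card K)) * ennreal C * R y"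
    proof (cases "0 < y")
      case True
      then show ?thesis using \<Theta>[OF True] by (simp add: mult.assoc)
    next
      case False
      \<comment> \<open>For y <= 0 the radial density vanishes on the left, and on the right no
        bordered matrix is positive definite.\<close>
      then have "border S j y b c \<notin> pos_def_matrices" for b c using border_pos_def_imp_pos by blast
      then show ?thesis using False by (simp add: R_def gram_weight_def)
    qed
  qed
  also have "\<dots> = ennreal (radial_const (card K)) * ennreal C * (\<integral>\<^sup>+y. R y \<partial>lborel)"
    by (rule nn_integral_cmult) measurable
  also have "(\<integral>\<^sup>+y. R y \<partial>lborel) = (\<integral>\<^sup>+c. indicator (dead_sym (insert j S)) c * gram_weight F e (pad (insert j S) c) \<partial>sym_lborel)"
    unfolding R_def using insert.hyps by (intro sym_column_step[symmetric]) auto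
  also have "ennreal (radial_const (card K)) * ennreal C = ennreal (\<Prod>i<card (insert j S). radial_const (card K - i))"
    using insert.hyps C0 by (simp add: C_def ennreal_mult radial_const_nonneg prod.lessThan_Suc_shift cK del: prod.lessThan_Suc)
  finally show ?case unfolding e_def .
qed

text \<open>The exponents (k-i)/2 add up to km/2 - m(m-1)/4, and the second term is the power of pi
  built into \<open>cone_Gamma\<close>.\<close>

lemma prod_radial_const:
  assumes "m \<le> k"
  shows "(\<Prod>i<m. radial_const (k - i)) = pi powr (real k * real m / 2) / cone_Gamma m (real k / 2)"
proof -
  have "(\<Prod>i<m. radial_const (k - i)) = (\<Prod>i<m. pi powr ((real k - real i) / 2)) / (\<Prod>i<m. Gamma (real k / 2 - real i / 2))"
    unfolding prod_dividef[symmetric] using assms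
    by (intro prod.cong) (auto simp: radial_const_def of_nat_diff diff_divide_distrib)
  also have "(\<Prod>i<m. pi powr ((real k - real i) / 2)) = pi powr (real k * real m / 2 - real m * (real m - 1) / 4)"
    by (induction m) (simp_all add: powr_add[symmetric] field_simps)
  finally show ?thesis by (simp add: cone_Gamma_def powr_diff)
qed

text \<open>The case in which \<open>S\<close> and \<open>K\<close> are everything and no dummies
  remain; the transposition turns the rows of \<open>u\<close> back into columns of
  \<omega>.\<close>

theorem nn_integral_gram:
  fixes F :: "real^'m^'m \<Rightarrow> ennreal"
  assumes "CARD('m) \<le> CARD('k::finite)" and [measurable]: "F \<in> borel_measurable borel"
  shows "(\<integral>\<^sup>+\<omega>. F (transpose \<omega> ** \<omega>) \<partial>(lborel :: (real^'m^'k) measure))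
    = ennreal (pi powr (real CARD('k) * real CARD('m) / 2) / cone_Gamma CARD('m) (real CARD('k) / 2)) *
      (\<integral>\<^sup>+r. gram_weight F (real CARD('k) / 2 - (real CARD('m) + 1) / 2) r \<partial>sym_lborel)"
proof -
  have p: "pad UNIV c = c" for c :: "real^'m^'m" by (simp add: pad_def vec_eq_iff)
  have g: "partial_gram UNIV (transpose \<omega>) = transpose \<omega> ** \<omega>" for \<omega> :: "real^'m^'k"
    by (simp add: partial_gram_def transpose_def matrix_matrix_mult_def)
  have d: "indicator (dead_cols UNIV UNIV) u = (1::ennreal)" "indicator (dead_sym UNIV) c = (1::ennreal)" for u :: "real^'k^'m" and c :: "real^'m^'m"
    by (simp_all add: dead_cols_def dead_sym_def)
  have e: "(real CARD('k) - real CARD('m) - 1) / 2 = real CARD('k) / 2 - (real CARD('m) + 1) / 2" by (simp add: field_simps)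
  have "(\<integral>\<^sup>+\<omega>. F (transpose \<omega> ** \<omega>) \<partial>(lborel :: (real^'m^'k) measure))
     = (\<integral>\<^sup>+u. F (partial_gram UNIV u) \<partial>distr (lborel :: (real^'m^'k) measure) borel transpose)"
    by (subst nn_integral_distr) (simp_all add: g)
  also have "\<dots> = (\<integral>\<^sup>+u. F (partial_gram UNIV u) \<partial>(lborel :: (real^'k^'m) measure))"
    by (simp add: lborel_transpose)
  also have "\<dots> = ennreal (\<Prod>i<CARD('m). radial_const (CARD('k) - i)) *
      (\<integral>\<^sup>+r. gram_weight F (real CARD('k) / 2 - (real CARD('m) + 1) / 2) r \<partial>sym_lborel)"
    using nn_integral_gram_partial[of "UNIV :: 'm set" "UNIV :: 'k set" F] assms by (simp add: p d e)
  finally show ?thesis by (simp add: prod_radial_const assms)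
qed

section \<open>Integrals over Stiefel manifolds and fractional integrals\<close>

text \<open>Together with the next two facts this moves integrals over completed measures to Borel
  representatives. Nothing is assumed about \<open>f\<close> beyond agreement with \<open>f0\<close>
  almost everywhere.\<close>

lemma borel_measurable_completion_cong:
  fixes f f0 :: "'a \<Rightarrow> 'b::{second_countable_topology, t2_space}"
  assumes AE: "AE x in M. f x = f0 x" and f0: "f0 \<in> borel_measurable M"
  shows "f \<in> borel_measurable (completion M)"
proof (rule borel_measurableI)
  fix B :: "'b set" assume B: "open B"
  show "f -` B \<inter> space (completion M) \<in> sets (completion M)"
  proof (rule completion.in_sets_AE)
    show "f0 -` B \<inter> space M \<in> sets (completion M)"
      using f0 B by (auto intro: sets_completionI_sets measurable_sets)
    show "AE x in completion M. (x \<in> f0 -` B \<inter> space M) = (x \<in> f -` B \<inter> space (completion M))"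
      using AE by (auto simp: AE_completion_iff)
  qed auto
qed

lemma
  fixes f f0 :: "'a \<Rightarrow> 'b::{banach, second_countable_topology}"
  assumes AE: "AE x in M. f x = f0 x" and f0: "f0 \<in> borel_measurable M"
  shows integrable_completion_cong: "integrable (completion M) f \<longleftrightarrow> integrable M f0"
    and integral_completion_cong: "integral\<^sup>L (completion M) f = integral\<^sup>L M f0"
proof -
  have f: "f \<in> borel_measurable (completion M)" by (rule borel_measurable_completion_cong[OF AE f0])
  have AE': "AE x in completion M. f x = f0 x" using AE by (simp add: AE_completion_iff)
  show "integrable (completion M) f \<longleftrightarrow> integrable M f0"
    using integrable_cong_AE[OF f measurable_completion[OF f0] AE'] by (simp add: integrable_completion f0)
  show "integral\<^sup>L (completion M) f = integral\<^sup>L M f0"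
    using integral_cong_AE[OF f measurable_completion[OF f0] AE'] by (simp add: integral_completion f0)
qed

lemma integrable_scaleR_iff:
  fixes f :: "'a \<Rightarrow> 'b::{banach, second_countable_topology}"
  assumes "c \<noteq> 0"
  shows "integrable M (\<lambda>x. c *\<^sub>R f x) \<longleftrightarrow> integrable M f"
proof
  assume "integrable M (\<lambda>x. c *\<^sub>R f x)"
  then have "integrable M (\<lambda>x. inverse c *\<^sub>R (c *\<^sub>R f x))" by (rule integrable_scaleR_right)
  moreover have "inverse c *\<^sub>R (c *\<^sub>R f x) = f x" for x using assms by simp
  ultimately show "integrable M f" by (simp only:)
qed simp

lemma borel_measurable_vstack' [measurable (raw)]:
  assumes "f \<in> borel_measurable M" "g \<in> borel_measurable M"
  shows "(\<lambda>p. vstack (f p) (g p) :: real^'m^('k::finite + 'l::finite)) \<in> borel_measurable M"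
  using measurable_compose[OF measurable_Pair[OF assms] borel_measurable_vstack] by simp

lemma stiefel_card:
  assumes "v \<in> (stiefel :: (real^'m^'n) set)"
  shows "CARD('m) \<le> CARD('n)"
proof -
  have "inj ((*v) v)" using assms by (auto simp: stiefel_def matrix_left_invertible_injective[symmetric])
  then have "dim (range ((*v) v)) = CARD('m)"
    using dim_image_eq[of "(*v) v" UNIV] by (simp add: matrix_vector_mul_linear)
  then show ?thesis using dim_subset_UNIV[of "range ((*v) v)"] by simp
qed

lemma frame_measure_density:
  fixes v :: "real^'m^'n"
  shows "frame_measure v = density (distr haar (restrict_space borel stiefel) (\<lambda>g. g ** v)) (\<lambda>_. ennreal (stiefel_mass CARD('n) CARD('m)))"
  unfolding frame_measure_def
  by (rule measure_eqI) (simp_all add: emeasure_density nn_integral_cmult_indicator)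

lemma
  fixes v :: "real^'m^'n" and h :: "real^'m^'n \<Rightarrow> 'b::{banach, second_countable_topology}"
  assumes v: "v \<in> stiefel" and h[measurable]: "h \<in> borel_measurable borel"
  shows integrable_stiefel_iff: "integrable stiefel_measure h \<longleftrightarrow> integrable haar (\<lambda>g. h (g ** v))"
    and integral_stiefel: "(1 / stiefel_mass CARD('n) CARD('m)) *\<^sub>R integral\<^sup>L stiefel_measure h = (\<integral>g. h (g ** v) \<partial>haar)"
proof -
  have "CARD('m) \<le> CARD('n)" using v by (rule stiefel_card)
  then have mass: "0 < stiefel_mass CARD('n) CARD('m)" by (rule stiefel_mass_pos)
  have h': "h \<in> borel_measurable (restrict_space borel stiefel)" by (rule measurable_restrict_space1) fact
  then have h'': "h \<in> borel_measurable (frame_measure v)" by (simp cong: measurable_cong_sets)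
  note m = measurable_frame_action[OF v]
  show "integrable stiefel_measure h \<longleftrightarrow> integrable haar (\<lambda>g. h (g ** v))"
  proof -
    have "integrable stiefel_measure h \<longleftrightarrow> integrable (frame_measure v) h"
      unfolding stiefel_measure_eq[OF v] by (rule integrable_completion[OF h''])
    also have "\<dots> \<longleftrightarrow> integrable haar (\<lambda>g. h (g ** v))"
      unfolding frame_measure_density using mass h'
      by (subst integrable_density) (auto simp: integrable_distr_eq[OF m] integrable_scaleR_iff)
    finally show ?thesis .
  qed
  show "(1 / stiefel_mass CARD('n) CARD('m)) *\<^sub>R integral\<^sup>L stiefel_measure h = (\<integral>g. h (g ** v) \<partial>haar)"
  proof -
    have "integral\<^sup>L stiefel_measure h = integral\<^sup>L (frame_measure v) h"
      unfolding stiefel_measure_eq[OF v] by (rule integral_completion[OF h''])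
    also have "\<dots> = stiefel_mass CARD('n) CARD('m) *\<^sub>R (\<integral>g. h (g ** v) \<partial>haar)"
      unfolding frame_measure_density using mass h'
      by (subst integral_density) (auto simp: integral_distr[OF m])
    finally show ?thesis using mass by simp
  qed
qed

lemma AE_stiefel_iff:
  fixes v :: "real^'m^'n"
  assumes v: "v \<in> stiefel" and P: "{a. P a} \<in> sets borel"
  shows "(AE a in stiefel_measure. P a) \<longleftrightarrow> (AE g in haar. P (g ** v))"
proof -
  have mass: "0 < stiefel_mass CARD('n) CARD('m)"
    using stiefel_card[OF v] by (rule stiefel_mass_pos)
  have "{a \<in> space (restrict_space borel stiefel). P a} \<in> sets (restrict_space borel stiefel)"
    using P by (auto simp: sets_restrict_space space_restrict_space intro!: image_eqI[of _ _ "{a. P a}"])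
  then show ?thesis
    unfolding stiefel_measure_eq[OF v] AE_completion_iff frame_measure_density using mass
    by (subst AE_density) (simp_all add: AE_distr_iff[OF measurable_frame_action[OF v]])
qed

section \<open>Fractional integrals as integrals over \<omega>\<close>

definition frac_AE :: "'k::finite itself \<Rightarrow> (real^'m^'m \<Rightarrow> bool) \<Rightarrow> real^'m^'m \<Rightarrow> bool" where
  "frac_AE (_ :: 'k itself) P s \<longleftrightarrow>
     (if CARD('m) \<le> CARD('k) then AE r in sym_lebesgue. r - s \<in> pos_def_matrices \<longrightarrow> P r
      else AE (\<omega> :: real^'m^'k) in lebesgue. P (s + transpose \<omega> ** \<omega>))"

definition frac_integrable ::
  "'k::finite itself \<Rightarrow> (real^'m^'m \<Rightarrow> 'b::{banach, second_countable_topology}) \<Rightarrow> real^'m^'m \<Rightarrow> bool" where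
  "frac_integrable (_ :: 'k itself) F s \<longleftrightarrow>
     (if CARD('m) \<le> CARD('k) then
        set_integrable sym_lebesgue {r. r - s \<in> pos_def_matrices}
          (\<lambda>r. \<bar>det (r - s)\<bar> powr (real CARD('k) / 2 - (real CARD('m) + 1) / 2) *\<^sub>R F r)
      else integrable lebesgue (\<lambda>\<omega> :: real^'m^'k. F (s + transpose \<omega> ** \<omega>)))"

lemma frac_mean_converges_iff:
  "frac_mean_converges TYPE('k::finite) f x s \<longleftrightarrow>
     frac_AE TYPE('k) (\<lambda>r. integrable stiefel_measure (\<lambda>v. f (x + v ** pos_def_sqrt r))) s \<and>
     frac_integrable TYPE('k) (sph_mean (\<lambda>a. norm (f a)) x) s"
  by (simp add: frac_mean_converges_def frac_AE_def frac_integrable_def)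

text \<open>The origin of the factor \<open>pi powr (k m / 2)\<close> in the theorem: for m <= k the
  density of s + \<omega>'\<omega> is this factor times the normalised kernel of the fractional
  integral.\<close>

definition gram_density :: "'k::finite itself \<Rightarrow> real^'m^'m \<Rightarrow> real^'m^'m \<Rightarrow> real" where
  "gram_density (_ :: 'k itself) s r =
     pi powr (real CARD('k) * real CARD('m) / 2) / cone_Gamma CARD('m) (real CARD('k) / 2) *
     (indicator {r. r - s \<in> pos_def_matrices} r * \<bar>det (r - s)\<bar> powr (real CARD('k) / 2 - (real CARD('m) + 1) / 2))"

lemma gram_density_borel [measurable]: "gram_density TYPE('k::finite) s \<in> borel_measurable borel"
  unfolding gram_density_def by measurable

lemma gram_density_nonneg: "CARD('m) \<le> CARD('k) \<Longrightarrow> 0 \<le> gram_density TYPE('k::finite) (s :: real^'m^'m) r"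
  using cone_Gamma_pos[of "CARD('m)" "CARD('k)"] by (simp add: gram_density_def)

lemma gram_density_pos_iff:
  "CARD('m) \<le> CARD('k) \<Longrightarrow> 0 < gram_density TYPE('k::finite) (s :: real^'m^'m) r \<longleftrightarrow> r - s \<in> pos_def_matrices"
  using cone_Gamma_pos[of "CARD('m)" "CARD('k)"] pos_def_det_pos[of "r - s"]
  by (auto simp: gram_density_def indicator_def zero_less_mult_iff)

text \<open>\<open>nn_integral_gram\<close> translated by \<open>s\<close>. Stated as an equality of
  measures, it transports null sets, integrability and integrals at once; with s = 0 it is used
  again for the Gram matrix of \<open>z\<close>.\<close>

lemma distr_gram:
  fixes s :: "real^'m^'m"
  assumes mk: "CARD('m) \<le> CARD('k::finite)" and s: "transpose s = s"
  shows "distr (lborel :: (real^'m^'k) measure) borel (\<lambda>\<omega>. s + transpose \<omega> ** \<omega>) = density sym_lborel (gram_density TYPE('k) s)"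
proof (rule measure_eqI)
  fix A :: "(real^'m^'m) set"
  assume "A \<in> sets (distr (lborel :: (real^'m^'k) measure) borel (\<lambda>\<omega>. s + transpose \<omega> ** \<omega>))"
  then have A[measurable]: "A \<in> sets borel" by simp
  let ?c = "pi powr (real CARD('k) * real CARD('m) / 2) / cone_Gamma CARD('m) (real CARD('k) / 2)"
  let ?e = "real CARD('k) / 2 - (real CARD('m) + 1) / 2"
  have c: "0 \<le> ?c" using cone_Gamma_pos[OF mk] by simp
  have ts: "transpose (- s) = - s" using s by (simp add: transpose_def vec_eq_iff)
  have "emeasure (distr (lborel :: (real^'m^'k) measure) borel (\<lambda>\<omega>. s + transpose \<omega> ** \<omega>)) A
     = (\<integral>\<^sup>+r. indicator A r \<partial>distr (lborel :: (real^'m^'k) measure) borel (\<lambda>\<omega>. s + transpose \<omega> ** \<omega>))"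
    by simp
  also have "\<dots> = (\<integral>\<^sup>+\<omega>. indicator A (s + transpose \<omega> ** \<omega>) \<partial>(lborel :: (real^'m^'k) measure))"
    by (subst nn_integral_distr) simp_all
  also have "\<dots> = ennreal ?c * (\<integral>\<^sup>+r. gram_weight (\<lambda>r. indicator A (s + r)) ?e r \<partial>sym_lborel)"
    by (rule nn_integral_gram[OF mk]) measurable
  also have "(\<integral>\<^sup>+r. gram_weight (\<lambda>r. indicator A (s + r)) ?e r \<partial>sym_lborel)
      = (\<integral>\<^sup>+r. gram_weight (\<lambda>r. indicator A (s + r)) ?e (r + - s) \<partial>sym_lborel)"
    by (rule nn_integral_sym_lborel_shift[symmetric, OF _ ts]) measurable
  also have "ennreal ?c * \<dots> = (\<integral>\<^sup>+r. ennreal ?c * gram_weight (\<lambda>r. indicator A (s + r)) ?e (r + - s) \<partial>sym_lborel)"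
    by (rule nn_integral_cmult[symmetric]) measurable
  also have "\<dots> = (\<integral>\<^sup>+r. ennreal (gram_density TYPE('k) s r) * indicator A r \<partial>sym_lborel)"
  proof (rule nn_integral_cong)
    fix r :: "real^'m^'m"
    show "ennreal ?c * gram_weight (\<lambda>r. indicator A (s + r)) ?e (r + - s) = ennreal (gram_density TYPE('k) s r) * indicator A r"
    proof (cases "r - s \<in> pos_def_matrices")
      case True
      have "ennreal (gram_density TYPE('k) s r) = ennreal ?c * ennreal (det (r - s) powr ?e)"
        using True c pos_def_det_pos[OF True] by (simp add: gram_density_def ennreal_mult' del: times_divide_eq_left)
      then show ?thesis using True by (simp add: gram_weight_def mult.assoc)
    qed (simp add: gram_density_def gram_weight_def)
  qed
  also have "\<dots> = emeasure (density sym_lborel (gram_density TYPE('k) s)) A"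
    by (subst emeasure_density) auto
  finally show "emeasure (distr (lborel :: (real^'m^'k) measure) borel (\<lambda>\<omega>. s + transpose \<omega> ** \<omega>)) A
     = emeasure (density sym_lborel (gram_density TYPE('k) s)) A" .
qed simp

lemma frac_AE_iff:
  fixes s :: "real^'m^'m"
  assumes s: "transpose s = s" and P: "{r. P r} \<in> sets borel"
  shows "frac_AE TYPE('k::finite) P s \<longleftrightarrow> (AE (\<omega> :: real^'m^'k) in lborel. P (s + transpose \<omega> ** \<omega>))"
proof (cases "CARD('m) \<le> CARD('k)")
  case True
  have "(AE (\<omega> :: real^'m^'k) in lborel. P (s + transpose \<omega> ** \<omega>)) \<longleftrightarrow> (AE r in density sym_lborel (gram_density TYPE('k) s). P r)"
    unfolding distr_gram[OF True s, symmetric] using P by (subst AE_distr_iff) auto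
  also have "\<dots> \<longleftrightarrow> (AE r in sym_lborel. r - s \<in> pos_def_matrices \<longrightarrow> P r)"
    by (subst AE_density) (simp_all add: gram_density_pos_iff True)
  finally show ?thesis using True unfolding frac_AE_def sym_lebesgue_eq AE_completion_iff by simp
qed (simp add: frac_AE_def AE_completion_iff)

text \<open>From here on the cases k >= m and k < m look alike: the first is a change of variables
  by \<open>distr_gram\<close>, in the second only the two powers of pi cancel.\<close>

lemma
  fixes s :: "real^'m^'m" and F :: "real^'m^'m \<Rightarrow> 'b::{banach, second_countable_topology}"
  assumes s: "transpose s = s" and [measurable]: "F \<in> borel_measurable borel"
  shows frac_integrable_iff: "frac_integrable TYPE('k::finite) F s \<longleftrightarrow> integrable lborel (\<lambda>\<omega> :: real^'m^'k. F (s + transpose \<omega> ** \<omega>))"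
    and frac_integral_eq: "pi powr (real CARD('k) * real CARD('m) / 2) *\<^sub>R frac_integral TYPE('k) F s =
      (\<integral>(\<omega> :: real^'m^'k). F (s + transpose \<omega> ** \<omega>) \<partial>lborel)"
proof -
  let ?c = "pi powr (real CARD('k) * real CARD('m) / 2) / cone_Gamma CARD('m) (real CARD('k) / 2)"
  have [measurable]: "(\<lambda>\<omega> :: real^'m^'k. s + transpose \<omega> ** \<omega>) \<in> borel_measurable lborel" by measurable
  have *: "(frac_integrable TYPE('k) F s \<longleftrightarrow> integrable lborel (\<lambda>\<omega> :: real^'m^'k. F (s + transpose \<omega> ** \<omega>))) \<and>
     pi powr (real CARD('k) * real CARD('m) / 2) *\<^sub>R frac_integral TYPE('k) F s =
      (\<integral>(\<omega> :: real^'m^'k). F (s + transpose \<omega> ** \<omega>) \<partial>lborel)"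
  proof (cases "CARD('m) \<le> CARD('k)")
    case True
    let ?G = "\<lambda>r. indicator {r. r - s \<in> pos_def_matrices} r *\<^sub>R (\<bar>det (r - s)\<bar> powr (real CARD('k) / 2 - (real CARD('m) + 1) / 2) *\<^sub>R F r)"
    have c: "0 < ?c" using cone_Gamma_pos[OF True] by simp
    have G: "gram_density TYPE('k) s r *\<^sub>R F r = ?c *\<^sub>R ?G r" for r
      by (simp add: gram_density_def)
    have G_borel: "?G \<in> borel_measurable sym_lborel" by measurable
    have "integrable lborel (\<lambda>\<omega> :: real^'m^'k. F (s + transpose \<omega> ** \<omega>)) \<longleftrightarrow> integrable (density sym_lborel (gram_density TYPE('k) s)) F"
      unfolding distr_gram[OF True s, symmetric] by (subst integrable_distr_eq) auto
    also have "\<dots> \<longleftrightarrow> integrable sym_lborel (\<lambda>r. ?c *\<^sub>R ?G r)"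
      unfolding G[symmetric] by (subst integrable_density) (auto simp: gram_density_nonneg True)
    also have "\<dots> \<longleftrightarrow> integrable sym_lborel ?G"
      using c by (subst integrable_scaleR_iff) auto
    finally have 1: "integrable lborel (\<lambda>\<omega> :: real^'m^'k. F (s + transpose \<omega> ** \<omega>)) \<longleftrightarrow> integrable sym_lborel ?G" .
    have "(\<integral>(\<omega> :: real^'m^'k). F (s + transpose \<omega> ** \<omega>) \<partial>lborel) = integral\<^sup>L (density sym_lborel (gram_density TYPE('k) s)) F"
      unfolding distr_gram[OF True s, symmetric] by (subst integral_distr) auto
    also have "\<dots> = (\<integral>r. ?c *\<^sub>R ?G r \<partial>sym_lborel)"
      unfolding G[symmetric] by (subst integral_density) (auto simp: gram_density_nonneg True)
    also have "\<dots> = ?c *\<^sub>R (\<integral>r. ?G r \<partial>sym_lborel)"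
      by (rule integral_scaleR_right)
    finally have 2: "(\<integral>(\<omega> :: real^'m^'k). F (s + transpose \<omega> ** \<omega>) \<partial>lborel) = ?c *\<^sub>R (\<integral>r. ?G r \<partial>sym_lborel)" .
    show ?thesis
      unfolding 1 2 frac_integrable_def frac_integral_def set_integrable_def set_lebesgue_integral_def sym_lebesgue_eq
        if_P[OF True] integrable_completion[OF G_borel] integral_completion[OF G_borel]
      by simp
  next
    case False
    have G_borel: "(\<lambda>\<omega> :: real^'m^'k. F (s + transpose \<omega> ** \<omega>)) \<in> borel_measurable lborel" by measurable
    show ?thesis
      unfolding frac_integrable_def frac_integral_def if_not_P[OF False]
        integrable_completion[OF G_borel] integral_completion[OF G_borel]
      by (simp add: powr_add[symmetric])
  qed
  from * show "frac_integrable TYPE('k::finite) F s \<longleftrightarrow> integrable lborel (\<lambda>\<omega> :: real^'m^'k. F (s + transpose \<omega> ** \<omega>))"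
    and "pi powr (real CARD('k) * real CARD('m) / 2) *\<^sub>R frac_integral TYPE('k) F s =
      (\<integral>(\<omega> :: real^'m^'k). F (s + transpose \<omega> ** \<omega>) \<partial>lborel)" by auto
qed

text \<open>Meant for spherical means of a function that is not Borel: \<open>F\<close> itself need
  not be measurable.\<close>

lemma
  fixes s :: "real^'m^'m" and F F0 :: "real^'m^'m \<Rightarrow> 'b::{banach, second_countable_topology}"
  assumes F0[measurable]: "F0 \<in> borel_measurable borel" and AE: "frac_AE TYPE('k::finite) (\<lambda>r. F r = F0 r) s"
  shows frac_integrable_cong: "frac_integrable TYPE('k) F s \<longleftrightarrow> frac_integrable TYPE('k) F0 s"
    and frac_integral_cong: "frac_integral TYPE('k) F s = frac_integral TYPE('k) F0 s"
proof -
  have "(frac_integrable TYPE('k) F s \<longleftrightarrow> frac_integrable TYPE('k) F0 s) \<and> frac_integral TYPE('k) F s = frac_integral TYPE('k) F0 s"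
  proof (cases "CARD('m) \<le> CARD('k)")
    case True
    let ?G = "\<lambda>F r. indicator {r. r - s \<in> pos_def_matrices} r *\<^sub>R (\<bar>det (r - s)\<bar> powr (real CARD('k) / 2 - (real CARD('m) + 1) / 2) *\<^sub>R F r)"
    have "AE r in sym_lborel. r - s \<in> pos_def_matrices \<longrightarrow> F r = F0 r"
      using AE True unfolding frac_AE_def sym_lebesgue_eq AE_completion_iff by simp
    then have 1: "AE r in sym_lborel. ?G F r = ?G F0 r" by eventually_elim (auto simp: indicator_def)
    have 2: "?G F0 \<in> borel_measurable sym_lborel" by measurable
    show ?thesis
      unfolding frac_integrable_def frac_integral_def set_integrable_def set_lebesgue_integral_def sym_lebesgue_eq
        if_P[OF True] integrable_completion_cong[OF 1 2] integral_completion_cong[OF 1 2]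
        integrable_completion[OF 2] integral_completion[OF 2]
      by simp
  next
    case False
    let ?G = "\<lambda>F \<omega>. F (s + transpose \<omega> ** (\<omega> :: real^'m^'k))"
    have 1: "AE \<omega> in lborel. ?G F \<omega> = ?G F0 \<omega>"
      using AE False by (simp add: frac_AE_def AE_completion_iff)
    have 2: "?G F0 \<in> borel_measurable lborel" by measurable
    show ?thesis
      unfolding frac_integrable_def frac_integral_def
        if_not_P[OF False] integrable_completion_cong[OF 1 2] integral_completion_cong[OF 1 2]
        integrable_completion[OF 2] integral_completion[OF 2]
      by simp
  qed
  then show "frac_integrable TYPE('k) F s \<longleftrightarrow> frac_integrable TYPE('k) F0 s"
    and "frac_integral TYPE('k) F s = frac_integral TYPE('k) F0 s" by auto
qed

section \<open>The two sides as integrals over rotations\<close>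

abbreviation bottom_frame :: "real^'l^('k::finite + 'l::finite)" where
  "bottom_frame \<equiv> vstack 0 (mat 1)"

lemma vstack_add: "vstack a b + vstack c d = vstack (a + c) (b + d)"
  and vstack_diff: "vstack a b - vstack c d = vstack (a - c) (b - d)"
  by (auto simp: vstack_def vec_eq_iff split: sum.splits)

lemma vstack_mult_right: "vstack a b ** c = vstack (a ** c) (b ** c)"
  by (auto simp: vstack_def matrix_matrix_mult_def vec_eq_iff split: sum.splits)

lemma bottom_frame_mult: "bottom_frame ** b = vstack 0 b"
  by (simp add: vstack_mult_right matrix_mul_lid)

lemma transpose_bottom_frame_mult: "transpose bottom_frame ** vstack a b = b"
proof -
  have "transpose (0 :: real^'b^'c) = 0" by (simp add: transpose_def vec_eq_iff)
  then show ?thesis by (simp add: vstack_mult transpose_mat matrix_mul_lid)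
qed

lemma matrix_vstack_cases:
  obtains a b where "(y :: real^'m^('k::finite + 'l::finite)) = vstack a b"
proof
  show "y = vstack (\<chi> i. y $ Inl i) (\<chi> i. y $ Inr i)"
    by (auto simp: vstack_def vec_eq_iff split: sum.splits)
qed

lemma matrix_mult_linear:
  fixes A :: "real^'m^'n"
  shows "A ** (B + C) = A ** B + A ** C" "A ** (B - C) = A ** B - A ** C"
  by (simp_all add: matrix_matrix_mult_def vec_eq_iff algebra_simps sum.distrib sum_subtractf)

lemma nn_integral_lborel_vstack:
  fixes h :: "real^'m^('k::finite + 'l::finite) \<Rightarrow> ennreal"
  assumes [measurable]: "h \<in> borel_measurable borel"
  shows "(\<integral>\<^sup>+y. h y \<partial>lborel) = (\<integral>\<^sup>+\<tau>. \<integral>\<^sup>+\<omega>. h (vstack \<omega> \<tau>) \<partial>lborel \<partial>lborel)"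
proof -
  have "(\<integral>\<^sup>+y. h y \<partial>lborel) = (\<integral>\<^sup>+y. h y \<partial>distr (lborel \<Otimes>\<^sub>M lborel) borel (\<lambda>(\<omega>, t). vstack \<omega> t))"
    by (simp add: lborel_vstack)
  also have "\<dots> = (\<integral>\<^sup>+p. h (vstack (fst p) (snd p)) \<partial>(lborel \<Otimes>\<^sub>M lborel))"
    by (subst nn_integral_distr) (auto simp: case_prod_beta)
  also have "\<dots> = (\<integral>\<^sup>+\<tau>. \<integral>\<^sup>+\<omega>. h (vstack \<omega> \<tau>) \<partial>lborel \<partial>lborel)"
    by (subst lborel_pair.nn_integral_snd[symmetric]) auto
  finally show ?thesis .
qed

lemma nn_integral_lborel_mult_left:
  fixes h :: "real^'m^'n \<Rightarrow> ennreal"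
  assumes "h \<in> borel_measurable borel" "orthogonal_matrix g"
  shows "(\<integral>\<^sup>+y. h (g ** y) \<partial>lborel) = (\<integral>\<^sup>+y. h y \<partial>lborel)"
  using assms by (intro nn_integral_lborel_orthogonal orthogonal_transformation_matrix_mult_left)

text \<open>
  The image of Lebesgue measure on the affine plane through \<open>x\<close> and \<open>\<xi> ** z\<close>, written without a
  choice of the rotation \<open>g\<close>: the components of \<open>y\<close> along \<open>\<xi>\<close> are dummies with weight on a cube.
\<close>

definition plane_point :: "real^'m^'n \<Rightarrow> real^'m^'l \<Rightarrow> real^'l^'n \<Rightarrow> real^'m^'n \<Rightarrow> real^'m^'n" where
  "plane_point x z \<xi> y = x + y - \<xi> ** (transpose \<xi> ** y) + \<xi> ** z"

definition plane_measure :: "real^'m^'n \<Rightarrow> real^'m^'l \<Rightarrow> real^'l^'n \<Rightarrow> (real^'m^'n) measure" where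
  "plane_measure x z \<xi> = distr (density lborel (\<lambda>y. ennreal (indicator unit_cube (transpose \<xi> ** y)))) borel (plane_point x z \<xi>)"

lemma borel_measurable_transpose' [measurable (raw)]:
  fixes f :: "'a \<Rightarrow> real^'m^'n"
  shows "f \<in> borel_measurable M \<Longrightarrow> (\<lambda>p. transpose (f p)) \<in> borel_measurable M"
  by (rule measurable_compose[OF _ borel_measurable_transpose])

lemma borel_plane_point [measurable (raw)]:
  assumes [measurable]: "a \<in> borel_measurable M" "b \<in> borel_measurable M"
  shows "(\<lambda>p. plane_point x z (a p) (b p)) \<in> borel_measurable M"
  unfolding plane_point_def by measurable

lemma sets_plane_measure [simp, measurable_cong]: "sets (plane_measure x z \<xi>) = sets borel"
  by (simp add: plane_measure_def)

lemma nn_integral_plane_measure: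
  assumes [measurable]: "h \<in> borel_measurable borel"
  shows "(\<integral>\<^sup>+a. h a \<partial>plane_measure x z \<xi>) = (\<integral>\<^sup>+y. indicator unit_cube (transpose \<xi> ** y) * h (plane_point x z \<xi> y) \<partial>lborel)"
  unfolding plane_measure_def
  by (subst nn_integral_distr) (auto simp: nn_integral_density ennreal_indicator)

text \<open>In the coordinates y = g [\<omega>; \<tau>] the block \<tau> is the component along
  \<xi>; it is confined to the cube of mass 1 and replaced by \<open>z\<close>. The right side uses
  any \<open>g\<close> whose last block is \<xi>, the left side only \<xi>.\<close>

lemma plane_measure_eq:
  fixes g :: "real^('k::finite + 'l::finite)^('k + 'l)" and z :: "real^'m^'l"
  assumes g: "orthogonal_matrix g"
  shows "plane_measure x z (g ** bottom_frame) = distr lborel borel (\<lambda>\<omega>. x + g ** vstack \<omega> z)"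
proof (rule measure_eqI)
  let ?\<xi> = "g ** bottom_frame :: real^'l^('k + 'l)"
  fix A :: "(real^'m^('k + 'l)) set" assume "A \<in> sets (plane_measure x z ?\<xi>)"
  then have [measurable]: "A \<in> sets borel" by simp
  have t: "transpose ?\<xi> ** (g ** vstack \<omega> \<tau>) = \<tau>" for \<omega> :: "real^'m^'k" and \<tau>
    by (simp add: matrix_transpose_mul matrix_mul_assoc[symmetric] orthogonal_matrixD[OF g] transpose_bottom_frame_mult)
  have p: "plane_point x z ?\<xi> (g ** vstack \<omega> \<tau>) = x + g ** vstack \<omega> z" for \<omega> :: "real^'m^'k" and \<tau>
  proof -
    have "plane_point x z ?\<xi> (g ** vstack \<omega> \<tau>) = x + (g ** vstack \<omega> \<tau> - g ** vstack 0 \<tau> + g ** vstack 0 z)"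
      unfolding plane_point_def t by (simp add: matrix_mul_assoc[symmetric] bottom_frame_mult)
    also have "\<dots> = x + g ** (vstack \<omega> \<tau> - vstack 0 \<tau> + vstack 0 z)"
      by (simp only: matrix_mult_linear)
    finally show ?thesis by (simp add: vstack_diff vstack_add)
  qed
  have "emeasure (plane_measure x z ?\<xi>) A = (\<integral>\<^sup>+a. indicator A a \<partial>plane_measure x z ?\<xi>)" by simp
  also have "\<dots> = (\<integral>\<^sup>+y. indicator unit_cube (transpose ?\<xi> ** y) * indicator A (plane_point x z ?\<xi> y) \<partial>lborel)"
    by (rule nn_integral_plane_measure) measurable
  also have "\<dots> = (\<integral>\<^sup>+y. indicator unit_cube (transpose ?\<xi> ** (g ** y)) * indicator A (plane_point x z ?\<xi> (g ** y)) \<partial>lborel)"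
    by (rule nn_integral_lborel_mult_left[OF _ g, symmetric]) measurable
  also have "\<dots> = (\<integral>\<^sup>+\<tau>. \<integral>\<^sup>+\<omega>. indicator unit_cube (\<tau> :: real^'m^'l) * indicator A (x + g ** vstack (\<omega> :: real^'m^'k) z) \<partial>lborel \<partial>lborel)"
    by (subst nn_integral_lborel_vstack) (simp_all add: t p)
  also have "\<dots> = (\<integral>\<^sup>+\<omega>. indicator A (x + g ** vstack (\<omega> :: real^'m^'k) z) \<partial>lborel)"
    by (simp add: nn_integral_cmult nn_integral_multc emeasure_unit_cube)
  also have "\<dots> = (\<integral>\<^sup>+a. indicator A a \<partial>distr lborel borel (\<lambda>\<omega> :: real^'m^'k. x + g ** vstack \<omega> z))"
    by (subst nn_integral_distr) auto
  also have "\<dots> = emeasure (distr lborel borel (\<lambda>\<omega> :: real^'m^'k. x + g ** vstack \<omega> z)) A" by simp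
  finally show "emeasure (plane_measure x z ?\<xi>) A = emeasure (distr lborel borel (\<lambda>\<omega> :: real^'m^'k. x + g ** vstack \<omega> z)) A" .
qed simp

text \<open>Let \<open>a\<close> be the upper block of g'x. Translating \<omega> by \<open>a\<close>
  accounts for the upper part of \<open>x\<close>, and the lower block of g'x is \<xi>'x; so the
  shift \<xi>'x + z relative to the origin is the shift \<open>z\<close> relative to
  \<open>x\<close>.\<close>

lemma plane_measure_frame_rotation:
  fixes \<xi> :: "real^'l^('k::finite + 'l::finite)" and z :: "real^'m^'l"
  assumes \<xi>: "\<xi> \<in> stiefel"
  shows "plane_measure x z \<xi> = distr lborel borel (\<lambda>\<omega>. frame_rotation \<xi> ** vstack \<omega> (transpose \<xi> ** x + z))"
proof -
  let ?g = "frame_rotation \<xi>"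
  have g: "orthogonal_matrix ?g" "?g ** bottom_frame = \<xi>" using frame_rotation[OF \<xi>] by auto
  obtain a b where ab: "transpose ?g ** x = vstack a b" by (rule matrix_vstack_cases)
  have x: "x = ?g ** vstack a b" using ab orthogonal_matrixD(4)[OF g(1), of x] by simp
  have b: "transpose \<xi> ** x = b"
  proof -
    have "transpose \<xi> ** x = transpose (?g ** bottom_frame) ** x" by (simp only: g(2))
    then show ?thesis by (simp add: matrix_transpose_mul matrix_mul_assoc[symmetric] ab transpose_bottom_frame_mult)
  qed
  have shift: "?g ** vstack \<omega> (transpose \<xi> ** x + z) = x + ?g ** vstack (- a + \<omega>) z" for \<omega>
  proof -
    have "x + ?g ** vstack (- a + \<omega>) z = ?g ** (vstack a b + vstack (- a + \<omega>) z)"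
      unfolding matrix_mult_linear(1) by (simp only: x[symmetric])
    then show ?thesis by (simp add: vstack_add b)
  qed
  have "distr lborel borel (\<lambda>\<omega>. ?g ** vstack \<omega> (transpose \<xi> ** x + z)) =
      distr (distr lborel borel ((+) (- a))) borel (\<lambda>\<omega>. x + ?g ** vstack \<omega> z)"
    unfolding shift by (subst distr_distr) (simp_all add: o_def)
  also have "\<dots> = plane_measure x z (?g ** bottom_frame)"
    unfolding plane_measure_eq[OF g(1)] by (simp add: lborel_distr_plus)
  finally show ?thesis by (simp add: g)
qed

lemma
  fixes f :: "real^'m^('k::finite + 'l::finite) \<Rightarrow> 'b::{banach, second_countable_topology}"
  assumes f[measurable]: "f \<in> borel_measurable borel" and \<xi>: "\<xi> \<in> stiefel"
  shows integrable_radon_iff: "integrable lebesgue (\<lambda>\<omega>. f (frame_rotation \<xi> ** vstack \<omega> (transpose \<xi> ** x + z)))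
      \<longleftrightarrow> integrable (plane_measure x z \<xi>) f"
    and radon_eq: "radon f \<xi> (transpose \<xi> ** x + z) = integral\<^sup>L (plane_measure x z \<xi>) f"
proof -
  have 1: "(\<lambda>\<omega>. f (frame_rotation \<xi> ** vstack \<omega> (transpose \<xi> ** x + z))) \<in> borel_measurable lborel" by measurable
  show "integrable lebesgue (\<lambda>\<omega>. f (frame_rotation \<xi> ** vstack \<omega> (transpose \<xi> ** x + z))) \<longleftrightarrow> integrable (plane_measure x z \<xi>) f"
    unfolding plane_measure_frame_rotation[OF \<xi>] integrable_completion[OF 1]
    by (rule integrable_distr_eq[symmetric]) auto
  show "radon f \<xi> (transpose \<xi> ** x + z) = integral\<^sup>L (plane_measure x z \<xi>) f"
    unfolding radon_def plane_measure_frame_rotation[OF \<xi>] integral_completion[OF 1]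
    by (rule integral_distr[symmetric]) auto
qed

lemma integral_plane_measure:
  fixes f :: "real^'m^'n \<Rightarrow> 'b::{banach, second_countable_topology}"
  assumes [measurable]: "f \<in> borel_measurable borel"
  shows "integral\<^sup>L (plane_measure x z \<xi>) f = (\<integral>y. indicator unit_cube (transpose \<xi> ** y) *\<^sub>R f (plane_point x z \<xi> y) \<partial>lborel)"
  unfolding plane_measure_def by (subst integral_distr) (auto simp: integral_density)

text \<open>As an integral over a fixed Lebesgue space it depends measurably on \<xi>. The
  expression with \<open>frame_rotation\<close> would not show this, since that rotation is an
  arbitrary choice.\<close>

lemma borel_integral_plane_measure [measurable]:
  fixes f :: "real^'m^'n \<Rightarrow> 'b::{banach, second_countable_topology}"
  assumes [measurable]: "f \<in> borel_measurable borel"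
  shows "(\<lambda>\<xi>. integral\<^sup>L (plane_measure x z \<xi>) f) \<in> borel_measurable borel"
  unfolding integral_plane_measure[OF assms] by measurable

lemma borel_nn_integral_plane_measure [measurable]:
  assumes [measurable]: "h \<in> borel_measurable borel"
  shows "(\<lambda>\<xi>. \<integral>\<^sup>+a. h a \<partial>plane_measure x z \<xi>) \<in> borel_measurable borel"
  unfolding nn_integral_plane_measure[OF assms] by measurable

lemma integrable_plane_measure_borel [measurable]:
  fixes f :: "real^'m^'n \<Rightarrow> 'b::{banach, second_countable_topology}"
  assumes [measurable]: "f \<in> borel_measurable borel"
  shows "{\<xi>. integrable (plane_measure x z \<xi>) f} \<in> sets borel"
proof -
  have "f \<in> borel_measurable (plane_measure x z \<xi>)" for \<xi> by measurable
  then show ?thesis unfolding integrable_iff_bounded by simp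
qed

definition rotation_integrand ::
  "(real^'m^('k::finite + 'l::finite) \<Rightarrow> 'b) \<Rightarrow> real^'m^'l \<Rightarrow> real^'m^('k + 'l) \<Rightarrow>
    (real^('k + 'l)^('k + 'l)) \<times> (real^'m^'k) \<Rightarrow> 'b" where
  "rotation_integrand f z x = (\<lambda>(g, \<omega>). f (x + g ** vstack \<omega> z))"

lemma borel_rotation_integrand [measurable]:
  assumes [measurable]: "f \<in> borel_measurable borel"
  shows "rotation_integrand f z x \<in> borel_measurable (haar \<Otimes>\<^sub>M lborel)"
  unfolding rotation_integrand_def by measurable

interpretation haar_lborel: pair_sigma_finite "haar :: (real^'n^'n) measure" "lborel :: 'b::euclidean_space measure" ..

text \<open>Both clauses of \<open>dual_radon_converges\<close> are rewritten over rotations, with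
  planes parametrised by the rotation itself; Fubini then applies on the product of O(n) and the
  space of \<omega>.\<close>

lemma
  fixes f :: "real^'m^('k::finite + 'l::finite) \<Rightarrow> 'b::{banach, second_countable_topology}"
  assumes f[measurable]: "f \<in> borel_measurable borel"
  shows dual_radon_converges_iff: "dual_radon_converges f z x \<longleftrightarrow> integrable (haar \<Otimes>\<^sub>M lborel) (rotation_integrand f z x)"
    and shifted_dual_radon_eq: "integrable (haar \<Otimes>\<^sub>M lborel) (rotation_integrand f z x) \<Longrightarrow>
      shifted_dual (radon f) z x = integral\<^sup>L (haar \<Otimes>\<^sub>M lborel) (rotation_integrand f z x)"
proof -
  let ?S = "stiefel_measure :: (real^'l^('k + 'l)) measure"
  let ?E = "bottom_frame :: real^'l^('k + 'l)"
  let ?B = "rotation_integrand f z x"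
  have E: "?E \<in> stiefel" by (rule stiefel_vstack)
  have sp: "\<xi> \<in> stiefel" if "\<xi> \<in> space ?S" for \<xi>
    using that by (simp add: stiefel_measure_eq[OF E])
  have fn[measurable]: "(\<lambda>a. norm (f a)) \<in> borel_measurable borel" by measurable
  have plane: "integrable (plane_measure x z (g ** ?E)) F \<longleftrightarrow> integrable lborel (\<lambda>\<omega>. F (x + g ** vstack \<omega> z))"
      "integral\<^sup>L (plane_measure x z (g ** ?E)) F = (\<integral>\<omega>. F (x + g ** vstack \<omega> z) \<partial>lborel)"
    if "g \<in> space haar" "F \<in> borel_measurable borel"
    for g and F :: "real^'m^('k + 'l) \<Rightarrow> 'c::{banach, second_countable_topology}"
  proof -
    have g: "orthogonal_matrix g" using that by simp
    show "integrable (plane_measure x z (g ** ?E)) F \<longleftrightarrow> integrable lborel (\<lambda>\<omega>. F (x + g ** vstack \<omega> z))"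
      unfolding plane_measure_eq[OF g] using that(2) by (intro integrable_distr_eq) auto
    show "integral\<^sup>L (plane_measure x z (g ** ?E)) F = (\<integral>\<omega>. F (x + g ** vstack \<omega> z) \<partial>lborel)"
      unfolding plane_measure_eq[OF g] using that(2) by (intro integral_distr) auto
  qed
  have "(AE \<xi> in ?S. integrable lebesgue (\<lambda>\<omega>. f (frame_rotation \<xi> ** vstack \<omega> (transpose \<xi> ** x + z))))
     \<longleftrightarrow> (AE \<xi> in ?S. integrable (plane_measure x z \<xi>) f)"
    by (rule AE_cong) (simp add: integrable_radon_iff sp)
  also have "\<dots> \<longleftrightarrow> (AE g in haar. integrable (plane_measure x z (g ** ?E)) f)"
    by (rule AE_stiefel_iff[OF E]) measurable
  also have "\<dots> \<longleftrightarrow> (AE g in haar. integrable lborel (\<lambda>\<omega>. f (x + g ** vstack \<omega> z)))"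
    by (rule AE_cong) (simp add: plane del: space_haar)
  finally have 1: "(AE \<xi> in ?S. integrable lebesgue (\<lambda>\<omega>. f (frame_rotation \<xi> ** vstack \<omega> (transpose \<xi> ** x + z))))
     \<longleftrightarrow> (AE g in haar. integrable lborel (\<lambda>\<omega>. f (x + g ** vstack \<omega> z)))" .
  have "integrable ?S (\<lambda>\<xi>. radon (\<lambda>a. norm (f a)) \<xi> (transpose \<xi> ** x + z))
     \<longleftrightarrow> integrable ?S (\<lambda>\<xi>. integral\<^sup>L (plane_measure x z \<xi>) (\<lambda>a. norm (f a)))"
    by (rule Bochner_Integration.integrable_cong) (simp_all add: radon_eq[OF fn] sp)
  also have "\<dots> \<longleftrightarrow> integrable haar (\<lambda>g. integral\<^sup>L (plane_measure x z (g ** ?E)) (\<lambda>a. norm (f a)))"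
    by (rule integrable_stiefel_iff[OF E]) measurable
  also have "\<dots> \<longleftrightarrow> integrable haar (\<lambda>g. \<integral>\<omega>. norm (f (x + g ** vstack \<omega> z)) \<partial>lborel)"
    by (rule Bochner_Integration.integrable_cong) (simp_all add: plane del: space_haar)
  finally have 2: "integrable ?S (\<lambda>\<xi>. radon (\<lambda>a. norm (f a)) \<xi> (transpose \<xi> ** x + z))
     \<longleftrightarrow> integrable haar (\<lambda>g. \<integral>\<omega>. norm (f (x + g ** vstack \<omega> z)) \<partial>lborel)" .
  \<comment> \<open>Integrability on a product is equivalent to integrability of almost all sections
    together with integrability of the iterated norm, which is precisely the shape of the
    definition.\<close>
  show "dual_radon_converges f z x \<longleftrightarrow> integrable (haar \<Otimes>\<^sub>M lborel) ?B"
    unfolding dual_radon_converges_def 1 2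
    using haar_lborel.Fubini_integrable[OF borel_rotation_integrand[OF f, of z x]]
      haar_lborel.AE_integrable_fst'[of ?B] haar_lborel.integrable_fst'[of "\<lambda>p. norm (?B p)"]
    by (auto simp: rotation_integrand_def)
  assume int: "integrable (haar \<Otimes>\<^sub>M lborel) ?B"
  have "shifted_dual (radon f) z x = (1 / stiefel_mass CARD('k + 'l) CARD('l)) *\<^sub>R
      (\<integral>\<xi>. integral\<^sup>L (plane_measure x z \<xi>) f \<partial>?S)"
    unfolding shifted_dual_def by (intro arg_cong2[where f="(*\<^sub>R)"] refl Bochner_Integration.integral_cong) (simp_all add: radon_eq sp)
  also have "\<dots> = (\<integral>g. integral\<^sup>L (plane_measure x z (g ** ?E)) f \<partial>haar)"
    by (rule integral_stiefel[OF E]) measurable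
  also have "\<dots> = (\<integral>g. (\<integral>\<omega>. f (x + g ** vstack \<omega> z) \<partial>lborel) \<partial>haar)"
    by (rule Bochner_Integration.integral_cong) (simp_all add: plane del: space_haar)
  also have "\<dots> = integral\<^sup>L (haar \<Otimes>\<^sub>M lborel) ?B"
    using haar_lborel.integral_fst'[OF int] by (simp add: rotation_integrand_def)
  finally show "shifted_dual (radon f) z x = integral\<^sup>L (haar \<Otimes>\<^sub>M lborel) ?B" .
qed

section \<open>The side of the spherical means\<close>

lemma polar_vstack:
  fixes z :: "real^'m^'l" and \<omega> :: "real^'m^'k"
  assumes "transpose z ** z \<in> pos_def_matrices"
  obtains v where "v \<in> stiefel" "v ** pos_def_sqrt (transpose z ** z + transpose \<omega> ** \<omega>) = vstack \<omega> z"
proof (rule polar_decomposition)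
  show "transpose (vstack \<omega> z) ** vstack \<omega> z = transpose z ** z + transpose \<omega> ** \<omega>"
    by (simp add: vstack_mult add.commute)
  show "transpose z ** z + transpose \<omega> ** \<omega> \<in> pos_def_matrices"
    using assms by (rule pos_def_add_gram)
qed (rule that)

lemma
  fixes f :: "real^'m^'n \<Rightarrow> 'b::{banach, second_countable_topology}"
  assumes f[measurable]: "f \<in> borel_measurable borel" and v: "v \<in> stiefel"
  shows sph_mean_eq: "sph_mean f x r = (\<integral>g. f (x + (g ** v) ** pos_def_sqrt r) \<partial>haar)"
    and integrable_sph_mean_iff: "integrable stiefel_measure (\<lambda>a. f (x + a ** pos_def_sqrt r)) \<longleftrightarrow>
      integrable haar (\<lambda>g. f (x + (g ** v) ** pos_def_sqrt r))"
  unfolding sph_mean_def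
  by (subst integral_stiefel[OF v] integrable_stiefel_iff[OF v]; measurable)+

lemma borel_sph_mean:
  fixes f :: "real^'m^'n \<Rightarrow> 'b::{banach, second_countable_topology}"
  assumes f[measurable]: "f \<in> borel_measurable borel" and v: "v \<in> (stiefel :: (real^'m^'n) set)"
  shows "sph_mean f x \<in> borel_measurable borel"
  unfolding sph_mean_eq[OF assms] by measurable

lemma integrable_sph_mean_borel:
  fixes f :: "real^'m^'n \<Rightarrow> 'b::{banach, second_countable_topology}"
  assumes f[measurable]: "f \<in> borel_measurable borel" and v: "v \<in> (stiefel :: (real^'m^'n) set)"
  shows "{r. integrable stiefel_measure (\<lambda>a. f (x + a ** pos_def_sqrt r))} \<in> sets borel"
proof -
  have "(\<lambda>g. f (x + (g ** v) ** pos_def_sqrt r)) \<in> borel_measurable haar" for r by measurable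
  then have "{r. integrable haar (\<lambda>g. f (x + (g ** v) ** pos_def_sqrt r))} \<in> sets borel"
    unfolding integrable_iff_bounded by simp
  then show ?thesis unfolding integrable_sph_mean_iff[OF assms] .
qed

text \<open>The same product integral in the other order. For each \<omega> the spherical mean is
  computed with the polar frame of [\<omega>; z], which may vary with \<omega> because every base
  frame gives the same mean.\<close>

lemma
  fixes f :: "real^'m^('k::finite + 'l::finite) \<Rightarrow> 'b::{banach, second_countable_topology}" and z :: "real^'m^'l"
  assumes f[measurable]: "f \<in> borel_measurable borel" and z: "transpose z ** z \<in> pos_def_matrices"
  shows frac_mean_converges_product: "frac_mean_converges TYPE('k) f x (transpose z ** z) \<longleftrightarrow> integrable (haar \<Otimes>\<^sub>M lborel) (rotation_integrand f z x)"
    and frac_integral_product: "integrable (haar \<Otimes>\<^sub>M lborel) (rotation_integrand f z x) \<Longrightarrow>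
      pi powr (real CARD('k) * real CARD('m) / 2) *\<^sub>R frac_integral TYPE('k) (sph_mean f x) (transpose z ** z) =
        integral\<^sup>L (haar \<Otimes>\<^sub>M lborel) (rotation_integrand f z x)"
proof -
  let ?B = "rotation_integrand f z x" and ?s = "transpose z ** z"
  let ?r = "\<lambda>\<omega> :: real^'m^'k. ?s + transpose \<omega> ** \<omega>"
  obtain v where v: "v \<in> (stiefel :: (real^'m^('k + 'l)) set)" using polar_vstack[OF z, of "0 :: real^'m^'k"] by blast
  have s: "transpose ?s = ?s" by (rule transpose_gram)
  have fn[measurable]: "(\<lambda>a. norm (f a)) \<in> borel_measurable borel" by measurable
  have int: "integrable stiefel_measure (\<lambda>a. f (x + a ** pos_def_sqrt (?r \<omega>))) \<longleftrightarrow> integrable haar (\<lambda>g. f (x + g ** vstack \<omega> z))" for \<omega>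
  proof -
    obtain v where "v \<in> (stiefel :: (real^'m^('k + 'l)) set)" "v ** pos_def_sqrt (?r \<omega>) = vstack \<omega> z" using polar_vstack[OF z] .
    then show ?thesis by (simp add: integrable_sph_mean_iff[OF f] matrix_mul_assoc[symmetric])
  qed
  have mean: "sph_mean F x (?r \<omega>) = (\<integral>g. F (x + g ** vstack \<omega> z) \<partial>haar)"
    if "F \<in> borel_measurable borel" for \<omega> and F :: "real^'m^('k + 'l) \<Rightarrow> 'c::{banach, second_countable_topology}"
  proof -
    obtain v where "v \<in> (stiefel :: (real^'m^('k + 'l)) set)" "v ** pos_def_sqrt (?r \<omega>) = vstack \<omega> z" using polar_vstack[OF z] .
    then show ?thesis by (simp add: sph_mean_eq[OF that] matrix_mul_assoc[symmetric])
  qed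
  let ?B' = "\<lambda>(\<omega>, g). ?B (g, \<omega>)"
  interpret Q: pair_sigma_finite "lborel :: (real^'m^'k) measure" "haar :: (real^('k + 'l)^('k + 'l)) measure" ..
  have swap: "integrable (lborel \<Otimes>\<^sub>M haar) ?B' \<longleftrightarrow> integrable (haar \<Otimes>\<^sub>M lborel) ?B"
    by (rule haar_lborel.integrable_product_swap_iff)
  have B'[measurable]: "?B' \<in> borel_measurable (lborel \<Otimes>\<^sub>M haar)"
    unfolding rotation_integrand_def by measurable
  show "frac_mean_converges TYPE('k) f x ?s \<longleftrightarrow> integrable (haar \<Otimes>\<^sub>M lborel) ?B"
    unfolding frac_mean_converges_iff swap[symmetric]
      frac_AE_iff[OF s integrable_sph_mean_borel[OF f v]] frac_integrable_iff[OF s borel_sph_mean[OF fn v]] int mean[OF fn]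
    using Q.Fubini_integrable[OF B'] Q.AE_integrable_fst'[of ?B'] Q.integrable_fst'[of "\<lambda>p. norm (?B' p)"]
    by (auto simp: rotation_integrand_def)
  assume "integrable (haar \<Otimes>\<^sub>M lborel) ?B"
  then have "(\<integral>\<omega>. (\<integral>g. f (x + g ** vstack \<omega> z) \<partial>haar) \<partial>lborel) = integral\<^sup>L (haar \<Otimes>\<^sub>M lborel) ?B"
    using haar_lborel.integral_snd[of "\<lambda>g \<omega>. f (x + g ** vstack \<omega> z)"] by (simp add: rotation_integrand_def)
  then show "pi powr (real CARD('k) * real CARD('m) / 2) *\<^sub>R frac_integral TYPE('k) (sph_mean f x) ?s =
        integral\<^sup>L (haar \<Otimes>\<^sub>M lborel) ?B"
    unfolding frac_integral_eq[OF s borel_sph_mean[OF f v]] mean[OF f] .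
qed

section \<open>Convergence for almost all shifts\<close>

lemma orthogonal_transformation_matrix_vector:
  "orthogonal_matrix (g :: real^'n^'n) \<Longrightarrow> orthogonal_transformation ((*v) g)"
  by (simp add: orthogonal_transformation_def orthogonal_matrix_inner)

text \<open>In an eigenbasis of \<open>B\<close> the substitution is a scaling of the coordinates by
  the roots of the eigenvalues; the two rotations around it preserve volume.\<close>

lemma nn_integral_pos_def_substitution:
  fixes h :: "real^'n::finite \<Rightarrow> ennreal"
  assumes [measurable]: "h \<in> borel_measurable borel" and B: "B \<in> pos_def_matrices"
  shows "(\<integral>\<^sup>+w. h w \<partial>lborel) = ennreal (sqrt (det B)) * (\<integral>\<^sup>+v. h (pos_def_sqrt B *v v) \<partial>lborel)"
proof -
  obtain g d where gd: "orthogonal_matrix g" "\<And>i. 0 < d i" "B = g ** diag_matrix d ** transpose g"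
    using pos_def_spectral[OF B] by blast
  let ?D = "diag_matrix (\<lambda>i. sqrt (d i))"
  have "invertible (transpose g)" using gd(1) by (auto simp: invertible_def orthogonal_matrix_def)
  then have "g ** ?D ** transpose g \<in> pos_def_matrices"
    using pos_def_congruence[of ?D "transpose g"] gd(2) by (simp add: pos_def_diag_iff)
  moreover have "(g ** ?D ** transpose g) ** (g ** ?D ** transpose g) = g ** (?D ** ?D) ** transpose g"
    by (simp add: matrix_mul_assoc[symmetric] orthogonal_matrixD[OF gd(1)])
  then have "(g ** ?D ** transpose g) ** (g ** ?D ** transpose g) = B"
    using gd(2) by (simp add: diag_matrix_mult gd(3) less_imp_le)
  ultimately have X: "pos_def_sqrt B = g ** ?D ** transpose g" by (rule pos_def_sqrt_eq)
  have "det B = (\<Prod>i\<in>UNIV. d i) * (det g * det g)" by (simp add: gd det_mul det_diag_matrix)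
  also have "det g * det g = 1" using det_orthogonal_matrix[OF gd(1)] by auto
  finally have "det B = (\<Prod>i\<in>UNIV. sqrt (d i))\<^sup>2"
    using gd(2) by (simp add: prod_power_distrib less_imp_le)
  then have detB: "\<bar>\<Prod>i\<in>UNIV. sqrt (d i)\<bar> = sqrt (det B)" by simp
  have tg: "orthogonal_matrix (transpose g)" using gd(1) by simp
  have "(\<integral>\<^sup>+w. h w \<partial>lborel) = (\<integral>\<^sup>+w. h (g *v w) \<partial>lborel)"
    by (rule nn_integral_lborel_orthogonal[symmetric]) (auto intro: orthogonal_transformation_matrix_vector gd)
  also have "\<dots> = ennreal (sqrt (det B)) * (\<integral>\<^sup>+t. h (g *v (?D *v t)) \<partial>lborel)"
    unfolding diag_matrix_mult_vec detB[symmetric]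
    by (rule nn_integral_coordinate_scale) (use gd(2) in \<open>auto simp: less_imp_neq[symmetric]\<close>)
  also have "(\<integral>\<^sup>+t. h (g *v (?D *v t)) \<partial>lborel) = (\<integral>\<^sup>+v. h (g *v (?D *v (transpose g *v v))) \<partial>lborel)"
    by (rule nn_integral_lborel_orthogonal[symmetric, OF _ orthogonal_transformation_matrix_vector[OF tg]]) measurable
  finally show ?thesis by (simp add: X matrix_vector_mul_assoc matrix_mul_assoc del: transpose_matrix_vector)
qed

definition outer :: "real^'n \<Rightarrow> real^'n^'n" where
  "outer v = (\<chi> i j. v $ i * v $ j)"

lemma borel_outer [measurable]: "outer \<in> borel_measurable borel"
  unfolding outer_def by measurable

lemma outer_mult_vec: "outer v *v y = (v \<bullet> y) *\<^sub>R v"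
  by (simp add: outer_def matrix_vector_mult_def vec_eq_iff inner_vec_def sum_distrib_left mult_ac)

lemma transpose_outer: "transpose (outer v) = outer v"
  by (simp add: outer_def transpose_def vec_eq_iff mult.commute)

lemma outer_congruence: "outer (A *v v) = A ** outer v ** transpose A"
proof -
  have "(A ** outer v ** transpose A) $ i $ j = (A *v v) $ i * (A *v v) $ j" for i j
  proof -
    have "(A ** outer v) $ i $ k = (A *v v) $ i * v $ k" for k
      by (simp add: matrix_matrix_mult_def matrix_vector_mult_def outer_def sum_distrib_left sum_distrib_right mult_ac)
    then show ?thesis
      by (simp add: matrix_matrix_mult_def[of "A ** outer v"] transpose_def matrix_vector_mult_def[of A] sum_distrib_left sum_distrib_right mult_ac)
  qed
  then show ?thesis by (simp add: outer_def vec_eq_iff)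
qed

lemma pos_def_add_outer:
  assumes "B \<in> pos_def_matrices"
  shows "B + outer v \<in> pos_def_matrices"
  using assms
  by (auto simp: pos_def_matrices_def transpose_add transpose_outer matrix_vector_mult_add_rdistrib inner_add_right
      outer_mult_vec inner_commute intro!: add_pos_nonneg)

lemma matrix_congruence_add: "A ** (B + C) ** (D :: real^'a^'b) = A ** B ** D + A ** C ** (D :: real^'a^'b)"
  for A :: "real^'n^'m" and B :: "real^'b^'n"
  by (simp add: matrix_matrix_mult_def vec_eq_iff algebra_simps sum.distrib)

text \<open>After a rotation of \<open>v\<close> onto a coordinate axis the matrix is diagonal with
  a single entry different from 1.\<close>

lemma det_mat_1_add_outer: "det (mat 1 + outer v) = 1 + v \<bullet> (v :: real^'n)"
proof -
  define i :: 'n where "i = (SOME i. True)"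
  obtain g where g: "orthogonal_matrix g" "g *v v = norm v *\<^sub>R axis i 1"
    using orthogonal_matrix_reflection[of v "norm v *\<^sub>R axis i 1"] by auto
  have "g ** (mat 1 + outer v) ** transpose g = mat 1 + outer (norm v *\<^sub>R axis i 1)"
    unfolding matrix_congruence_add outer_congruence[symmetric] g(2) by (simp add: matrix_mul_rid orthogonal_matrixD[OF g(1)])
  also have "\<dots> = diag_matrix (\<lambda>j. if j = i then 1 + v \<bullet> v else 1)"
    by (auto simp: outer_def diag_matrix_def mat_def axis_def vec_eq_iff dot_square_norm power2_eq_square)
  finally have "det (g ** (mat 1 + outer v) ** transpose g) = det (diag_matrix (\<lambda>j. if j = i then 1 + v \<bullet> v else 1))"
    by (rule arg_cong)
  moreover have "det (g ** (mat 1 + outer v) ** transpose g) = det (mat 1 + outer v) * (det g * det g)"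
    by (simp add: det_mul)
  moreover have "det g * det g = 1" using det_orthogonal_matrix[OF g(1)] by auto
  ultimately show ?thesis by (simp add: det_diag_matrix prod.If_cases)
qed

text \<open>The integral of the power -q of the Japanese bracket, the square root of 1 +
  |v|^2.\<close>

definition japanese_integral :: "'n::finite itself \<Rightarrow> real \<Rightarrow> ennreal" where
  "japanese_integral (_ :: 'n itself) q = (\<integral>\<^sup>+v. ennreal ((1 + v \<bullet> (v :: real^'n)) powr (- q / 2)) \<partial>lborel)"

text \<open>The substitution by the root of \<open>B\<close> factors the determinant as det B times
  1 + |v|^2. The Jacobian raises the exponent of det B by one half, from -q/2 to -(q-1)/2.\<close>

lemma nn_integral_det_add_outer:
  assumes B: "(B :: real^'n^'n) \<in> pos_def_matrices"
  shows "(\<integral>\<^sup>+w. ennreal (det (B + outer w) powr (- q / 2)) \<partial>lborel) =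
    ennreal (det B powr (- (q - 1) / 2)) * japanese_integral TYPE('n) q"
proof -
  let ?X = "pos_def_sqrt B"
  have X: "transpose ?X = ?X" "?X ** ?X = B" using pos_def_sqrt[OF B] pos_def_symmetric by auto
  have dB: "0 < det B" by (rule pos_def_det_pos[OF B])
  have d: "det (B + outer (?X *v v)) = det B * (1 + v \<bullet> v)" for v
  proof -
    have "B + outer (?X *v v) = ?X ** (mat 1 + outer v) ** ?X"
      unfolding matrix_congruence_add outer_congruence X(1) by (simp add: matrix_mul_rid X(2))
    then have "det (B + outer (?X *v v)) = det (?X ** ?X) * det (mat 1 + outer v)" by (simp add: det_mul)
    then show ?thesis by (simp add: X(2) det_mat_1_add_outer)
  qed
  have "(\<integral>\<^sup>+w. ennreal (det (B + outer w) powr (- q / 2)) \<partial>lborel)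
     = ennreal (sqrt (det B)) * (\<integral>\<^sup>+v. ennreal (det (B + outer (?X *v v)) powr (- q / 2)) \<partial>lborel)"
    by (rule nn_integral_pos_def_substitution[OF _ B]) measurable
  also have "\<dots> = ennreal (sqrt (det B)) * (\<integral>\<^sup>+v. ennreal (det B powr (- q / 2)) * ennreal ((1 + v \<bullet> (v :: real^'n)) powr (- q / 2)) \<partial>lborel)"
    unfolding d using dB by (simp add: powr_mult ennreal_mult[symmetric])
  also have "\<dots> = ennreal (sqrt (det B)) * (ennreal (det B powr (- q / 2)) * japanese_integral TYPE('n) q)"
    unfolding japanese_integral_def by (subst nn_integral_cmult) auto
  also have "\<dots> = ennreal (sqrt (det B) * det B powr (- q / 2)) * japanese_integral TYPE('n) q"
    using dB by (simp add: ennreal_mult mult.assoc)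
  also have "sqrt (det B) * det B powr (- q / 2) = det B powr (- (q - 1) / 2)"
    using dB by (simp add: powr_half_sqrt[symmetric] powr_add[symmetric] field_simps)
  finally show ?thesis .
qed

lemma nn_integral_japanese_1d:
  assumes a: "1 < (a::real)"
  shows "(\<integral>\<^sup>+t. ennreal ((1 + t\<^sup>2) powr (- a / 2)) \<partial>lborel) < \<infinity>"
proof -
  let ?p = "\<lambda>t::real. ennreal (t powr (- a)) * indicator {1..} t"
  have p: "(\<integral>\<^sup>+t. ?p t \<partial>lborel) = ennreal (1 / (a - 1))"
  proof -
    have "((\<lambda>t. t powr (- a)) has_integral 1 / (a - 1)) {1..}"
    proof -
      have "- (1 powr (- a + 1)) / (- a + 1) = 1 / (a - 1)"
        using a by (simp add: divide_simps)
      then show ?thesis using has_integral_powr_to_inf[of "- a" 1] a by (simp only:)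
    qed
    then show ?thesis by (intro nn_integral_has_integral_lebesgue') auto
  qed
  have "(\<integral>\<^sup>+t. ennreal ((1 + t\<^sup>2) powr (- a / 2)) \<partial>lborel) \<le> (\<integral>\<^sup>+t. indicator {-1..1} t + (?p t + ?p (- t)) \<partial>lborel)"
  proof (rule nn_integral_mono)
    fix t :: real
    have b: "(1 + t\<^sup>2) powr (- a / 2) \<le> \<bar>t\<bar> powr (- a)" if "1 \<le> \<bar>t\<bar>"
    proof -
      have "(1 + t\<^sup>2) powr (- a / 2) \<le> (t\<^sup>2) powr (- a / 2)"
        using that a by (intro powr_mono2') auto
      also have "(t\<^sup>2) powr (- a / 2) = (\<bar>t\<bar> powr 2) powr (- a / 2)" using that by (simp add: powr_numeral)
      also have "\<dots> = \<bar>t\<bar> powr (- a)" unfolding powr_powr by simp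
      finally show ?thesis .
    qed
    have c: "(1 + t\<^sup>2) powr (- a / 2) \<le> 1"
      using powr_mono2'[of "- a / 2" 1 "1 + t\<^sup>2"] a by simp
    consider "t \<in> {-1..1}" | "1 \<le> t" | "1 \<le> - t" by fastforce
    then show "ennreal ((1 + t\<^sup>2) powr (- a / 2)) \<le> indicator {-1..1} t + (?p t + ?p (- t))"
    proof cases
      case 1
      then show ?thesis using c by (simp add: add_increasing2)
    next
      case 2
      then have "ennreal ((1 + t\<^sup>2) powr (- a / 2)) \<le> ?p t" using b by (auto intro: ennreal_leI)
      then show ?thesis by (simp add: add_increasing add_increasing2)
    next
      case 3
      then have "ennreal ((1 + t\<^sup>2) powr (- a / 2)) \<le> ?p (- t)" using b by (auto intro: ennreal_leI)
      then show ?thesis by (meson add_increasing order_trans zero_le)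
    qed
  qed
  also have "\<dots> = 2 + (ennreal (1 / (a - 1)) + ennreal (1 / (a - 1)))"
    using nn_integral_lborel_uminus[of ?p] by (simp add: nn_integral_add p)
  also have "\<dots> < \<infinity>" by simp
  finally show ?thesis .
qed

lemma nn_integral_prod_coordinates:
  fixes \<phi> :: "'a::euclidean_space \<Rightarrow> ennreal"
  assumes [measurable]: "\<phi> \<in> borel_measurable borel"
  shows "(\<integral>\<^sup>+v. (\<Prod>i\<in>UNIV. \<phi> (v $ i)) \<partial>(lborel :: ('a^'n::finite) measure)) = (\<integral>\<^sup>+t. \<phi> t \<partial>lborel) ^ CARD('n)"
proof -
  interpret product_sigma_finite "\<lambda>_::'n. lborel :: 'a measure" ..
  have [measurable]: "(\<lambda>c. \<chi> i. c i) \<in> measurable (\<Pi>\<^sub>M i\<in>UNIV. lborel) (borel :: ('a^'n) measure)"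
    by measurable
  have "(\<integral>\<^sup>+v. (\<Prod>i\<in>UNIV. \<phi> (v $ i)) \<partial>(lborel :: ('a^'n) measure)) = (\<integral>\<^sup>+v. (\<Prod>i\<in>UNIV. \<phi> (v $ i)) \<partial>distr (\<Pi>\<^sub>M i\<in>(UNIV :: 'n set). lborel) borel (\<lambda>c. \<chi> i. c i))"
    by (simp add: lborel_vec)
  also have "\<dots> = (\<integral>\<^sup>+c. (\<Prod>i\<in>UNIV. \<phi> (c i)) \<partial>(\<Pi>\<^sub>M i\<in>(UNIV :: 'n set). lborel))"
    by (subst nn_integral_distr) simp_all
  also have "\<dots> = (\<integral>\<^sup>+t. \<phi> t \<partial>lborel) ^ CARD('n)"
    by (subst product_nn_integral_prod) auto
  finally show ?thesis .
qed

text \<open>The n-th power of 1 + |v|^2 dominates the product of all 1 + v_i^2. This leaves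
  one-dimensional integrals with exponent q/n > 1.\<close>

lemma japanese_integral_finite:
  assumes q: "real CARD('n) < q"
  shows "japanese_integral TYPE('n::finite) q < \<infinity>"
proof -
  let ?a = "q / CARD('n)"
  have a: "1 < ?a" using q by (simp add: field_simps)
  have "japanese_integral TYPE('n) q \<le> (\<integral>\<^sup>+(v :: real^'n). (\<Prod>i\<in>UNIV. ennreal ((1 + (v $ i)\<^sup>2) powr (- ?a / 2))) \<partial>lborel)"
    unfolding japanese_integral_def
  proof (rule nn_integral_mono)
    fix v :: "real^'n"
    have i: "(v $ i)\<^sup>2 \<le> v \<bullet> v" for i
      unfolding inner_vec_def by (rule order_trans[OF _ member_le_sum[of i UNIV "\<lambda>i. v $ i \<bullet> v $ i"]]) (auto simp: power2_eq_square)
    have pos: "0 < 1 + v \<bullet> v" by (simp add: add_pos_nonneg)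
    have "(1 + v \<bullet> v) powr (- q / 2) = ((1 + v \<bullet> v) ^ CARD('n)) powr (- ?a / 2)"
      using pos by (simp add: powr_powr flip: powr_realpow)
    also have "(1 + v \<bullet> v) ^ CARD('n) = (\<Prod>i\<in>(UNIV :: 'n set). 1 + v \<bullet> v)" by simp
    also have "\<dots> powr (- ?a / 2) \<le> (\<Prod>i\<in>(UNIV :: 'n set). 1 + (v $ i)\<^sup>2) powr (- ?a / 2)"
      using a i by (intro powr_mono2' prod_mono prod_pos) (auto intro: add_pos_nonneg)
    also have "\<dots> = (\<Prod>i\<in>UNIV. (1 + (v $ i)\<^sup>2) powr (- ?a / 2))"
      by (rule prod_powr_distrib)
    finally show "ennreal ((1 + v \<bullet> v) powr (- q / 2)) \<le> (\<Prod>i\<in>UNIV. ennreal ((1 + (v $ i)\<^sup>2) powr (- ?a / 2)))"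
      by (simp add: prod_ennreal ennreal_leI)
  qed
  also have "\<dots> = (\<integral>\<^sup>+t. ennreal ((1 + t\<^sup>2) powr (- ?a / 2)) \<partial>lborel) ^ CARD('n)"
    by (rule nn_integral_prod_coordinates) measurable
  also have "\<dots> < \<infinity>" using nn_integral_japanese_1d[OF a] by (simp add: power_less_top_ennreal)
  finally show ?thesis .
qed

definition outer_sum :: "'m set \<Rightarrow> real^'n^'m \<Rightarrow> real^'n^'n" where
  "outer_sum S u = mat 1 + (\<Sum>j\<in>S. outer (u $ j))"

lemma borel_outer_sum [measurable]: "outer_sum S \<in> borel_measurable borel"
  unfolding outer_sum_def by measurable

lemma outer_sum_pos_def: "finite S \<Longrightarrow> outer_sum S u \<in> pos_def_matrices"
  unfolding outer_sum_def
proof (induction S rule: finite_induct)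
  case (insert j S)
  then show ?case
    using pos_def_add_outer[OF insert.IH, of "u $ j"] by (simp add: add_ac)
qed (simp add: mat_1_pos_def)

text \<open>Each vector that is integrated out lowers \<open>q\<close> by 1 and needs q > n at that
  moment. With \<open>card S\<close> vectors the last one requires q - (card S - 1) > n, which is
  the stated threshold.\<close>

lemma nn_integral_det_outer_sum:
  fixes S :: "'m::finite set"
  assumes "finite S" "real CARD('n::finite) + real (card S) - 1 < q"
  shows "(\<integral>\<^sup>+(u :: real^'n^'m). indicator (dead_cols S UNIV) u * ennreal (det (outer_sum S u) powr (- q / 2)) \<partial>lborel) < \<infinity>"
  using assms
proof (induction S arbitrary: q rule: finite_induct)
  case empty
  have "dead_cols {} UNIV = (unit_cube :: (real^'n^'m) set)"
    by (auto simp: dead_cols_def unit_cube_def)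
  then have "emeasure lborel (dead_cols {} UNIV :: (real^'n^'m) set) < \<infinity>"
    by (simp add: emeasure_unit_cube)
  then show ?case by (simp add: outer_sum_def)
next
  case (insert j S q)
  let ?U = "\<lambda>u w. (\<chi> p. if p = j then w else u $ p) :: real^'n^'m"
  have "(\<integral>\<^sup>+(u :: real^'n^'m). indicator (dead_cols (insert j S) UNIV) u * ennreal (det (outer_sum (insert j S) u) powr (- q / 2)) \<partial>lborel)
    = (\<integral>\<^sup>+w. \<integral>\<^sup>+u. indicator (dead_vec {}) (u $ j) * (indicator (dead_cols (insert j S) UNIV) (?U u w) *
         ennreal (det (outer_sum (insert j S) (?U u w)) powr (- q / 2))) \<partial>lborel \<partial>lborel)"
    by (rule nn_integral_split_row) measurable
  also have "\<dots> = (\<integral>\<^sup>+(w :: real^'n). \<integral>\<^sup>+u. indicator (dead_cols S UNIV) u * ennreal (det (outer_sum S u + outer w) powr (- q / 2)) \<partial>lborel \<partial>lborel)"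
  proof (intro nn_integral_cong)
    fix w :: "real^'n" and u :: "real^'n^'m"
    have "u $ j \<in> dead_vec {} \<and> ?U u w \<in> dead_cols (insert j S) UNIV \<longleftrightarrow> u \<in> dead_cols S UNIV"
      using insert(2) unfolding dead_vec_def dead_cols_def mem_Collect_eq vec_lambda_beta
      by (smt (verit, best) UNIV_I empty_iff insert_iff)
    moreover have "outer_sum (insert j S) (?U u w) = outer_sum S u + outer w"
    proof -
      have "(\<Sum>p\<in>S. outer (?U u w $ p)) = (\<Sum>p\<in>S. outer (u $ p))"
        using insert(2) by (intro sum.cong) auto
      then show ?thesis using insert(1,2) by (simp add: outer_sum_def add_ac)
    qed
    ultimately show "indicator (dead_vec {}) (u $ j) * (indicator (dead_cols (insert j S) UNIV) (?U u w) *
         ennreal (det (outer_sum (insert j S) (?U u w)) powr (- q / 2)))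
       = indicator (dead_cols S UNIV) u * ennreal (det (outer_sum S u + outer w) powr (- q / 2))"
      by (auto simp: indicator_def)
  qed
  also have "\<dots> = (\<integral>\<^sup>+u. \<integral>\<^sup>+(w :: real^'n). indicator (dead_cols S UNIV) u * ennreal (det (outer_sum S u + outer w) powr (- q / 2)) \<partial>lborel \<partial>lborel)"
    by (rule lborel_pair_swap) measurable
  also have "\<dots> = (\<integral>\<^sup>+(u :: real^'n^'m). (indicator (dead_cols S UNIV) u * ennreal (det (outer_sum S u) powr (- (q - 1) / 2))) * japanese_integral TYPE('n) q \<partial>lborel)"
  proof (rule nn_integral_cong)
    fix u :: "real^'n^'m"
    have "(\<integral>\<^sup>+w. indicator (dead_cols S UNIV) u * ennreal (det (outer_sum S u + outer w) powr (- q / 2)) \<partial>lborel)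
        = indicator (dead_cols S UNIV) u * (\<integral>\<^sup>+w. ennreal (det (outer_sum S u + outer w) powr (- q / 2)) \<partial>lborel)"
      by (rule nn_integral_cmult) measurable
    then show "(\<integral>\<^sup>+w. indicator (dead_cols S UNIV) u * ennreal (det (outer_sum S u + outer w) powr (- q / 2)) \<partial>lborel)
        = (indicator (dead_cols S UNIV) u * ennreal (det (outer_sum S u) powr (- (q - 1) / 2))) * japanese_integral TYPE('n) q"
      unfolding nn_integral_det_add_outer[OF outer_sum_pos_def[OF insert(1)]] by (simp only: mult.assoc)
  qed
  also have "\<dots> = (\<integral>\<^sup>+(u :: real^'n^'m). indicator (dead_cols S UNIV) u * ennreal (det (outer_sum S u) powr (- (q - 1) / 2)) \<partial>lborel) * japanese_integral TYPE('n) q"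
    by (rule nn_integral_multc) measurable
  also have "\<dots> < \<infinity>"
    using insert.IH[of "q - 1"] insert.prems insert.hyps japanese_integral_finite[where 'n='n and q=q]
    by (simp add: ennreal_mult_less_top)
  finally show ?case .
qed

lemma outer_sum_transpose:
  fixes y :: "real^'m::finite^'n"
  shows "outer_sum UNIV (transpose y) = mat 1 + y ** transpose y"
proof -
  have "(\<Sum>j\<in>UNIV. outer (transpose y $ j)) $ a $ b = (y ** transpose y) $ a $ b" for a b
    unfolding sum_component by (simp add: outer_def transpose_def matrix_matrix_mult_def)
  then show ?thesis by (simp add: outer_sum_def vec_eq_iff)
qed

lemma nn_integral_det_gram_finite:
  assumes "real CARD('n::finite) + real CARD('m::finite) - 1 < q"
  shows "(\<integral>\<^sup>+(y :: real^'m^'n). ennreal (det (mat 1 + y ** transpose y) powr (- q / 2)) \<partial>lborel) < \<infinity>"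
proof -
  have "(\<integral>\<^sup>+(y :: real^'m^'n). ennreal (det (mat 1 + y ** transpose y) powr (- q / 2)) \<partial>lborel)
     = (\<integral>\<^sup>+u. ennreal (det (outer_sum UNIV u) powr (- q / 2)) \<partial>distr (lborel :: (real^'m^'n) measure) borel transpose)"
    by (subst nn_integral_distr) (simp_all add: outer_sum_transpose)
  also have "\<dots> = (\<integral>\<^sup>+(u :: real^'n^'m). ennreal (det (outer_sum UNIV u) powr (- q / 2)) \<partial>lborel)"
    by (simp add: lborel_transpose)
  also have "\<dots> < \<infinity>"
    using nn_integral_det_outer_sum[of "UNIV :: 'm set" q, where 'n='n] assms by (simp add: dead_cols_def)
  finally show ?thesis .
qed

section \<open>Gaussian weights and their averages over rotations\<close>

definition gauss_integral :: "'n::finite itself \<Rightarrow> ennreal" where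
  "gauss_integral (_ :: 'n itself) = (\<integral>\<^sup>+a. ennreal (exp (- ((a :: real^'n) \<bullet> a) / 2)) \<partial>lborel)"

text \<open>Finiteness by comparison with a Japanese bracket: (1+x)/(2N) <= exp(x/(2N)), raised to
  the power N = n+1, gives an exponent 2N > n.\<close>

lemma gauss_integral_finite: "gauss_integral TYPE('n::finite) < \<infinity>"
proof -
  define N where "N = Suc CARD('n)"
  have bound: "exp (- x / 2) \<le> (2 * real N) ^ N * (1 + x) powr (- (2 * real N) / 2)" if x: "0 \<le> x" for x :: real
  proof -
    have N: "0 < real N" "1 \<le> 2 * real N" by (simp_all add: N_def)
    have "(1 + x) / (2 * real N) \<le> 1 + x / (2 * real N)" using N by (simp add: field_simps)
    also have "\<dots> \<le> exp (x / (2 * real N))" by (rule exp_ge_add_one_self)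
    finally have "((1 + x) / (2 * real N)) ^ N \<le> exp (x / (2 * real N)) ^ N"
      using x N by (intro power_mono) auto
    also have "\<dots> = exp (x / 2)" unfolding exp_of_nat_mult[symmetric] using N by simp
    finally have "inverse (exp (x / 2)) \<le> inverse (((1 + x) / (2 * real N)) ^ N)"
      using x N by (intro le_imp_inverse_le) auto
    also have "\<dots> = (2 * real N) ^ N * inverse ((1 + x) ^ N)"
      by (subst power_divide, subst inverse_divide, rule divide_inverse)
    also have "inverse ((1 + x) ^ N) = (1 + x) powr (- (2 * real N) / 2)"
      using x by (simp add: powr_minus powr_realpow)
    also have "inverse (exp (x / 2)) = exp (- x / 2)"
      by (simp only: exp_minus[symmetric] minus_divide_left)
    finally show ?thesis .
  qed
  have "gauss_integral TYPE('n) \<le> (\<integral>\<^sup>+a. ennreal ((2 * real N) ^ N) * ennreal ((1 + (a :: real^'n) \<bullet> a) powr (- (2 * real N) / 2)) \<partial>lborel)"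
    unfolding gauss_integral_def
    by (intro nn_integral_mono) (simp add: ennreal_mult[symmetric] bound[simplified] ennreal_leI)
  also have "\<dots> = ennreal ((2 * real N) ^ N) * japanese_integral TYPE('n) (2 * real N)"
    unfolding japanese_integral_def by (rule nn_integral_cmult) measurable
  also have "\<dots> < \<infinity>"
    using japanese_integral_finite[where 'n='n and q="2 * real N"] by (simp add: ennreal_mult_less_top N_def)
  finally show ?thesis .
qed

text \<open>The exponent is the quadratic form of I + yy', which the substitution by the root of
  that matrix turns into the squared length.\<close>

lemma nn_integral_gauss_gram:
  fixes y :: "real^'m^'n"
  shows "(\<integral>\<^sup>+a. ennreal (exp (- (a \<bullet> a + (transpose y *v a) \<bullet> (transpose y *v a)) / 2)) \<partial>lborel)
    = gauss_integral TYPE('n) * ennreal (det (mat 1 + y ** transpose y) powr (- 1 / 2))"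
proof -
  let ?B = "mat 1 + y ** transpose y"
  have B: "?B \<in> pos_def_matrices" using pos_def_add_gram[OF mat_1_pos_def, of "transpose y"] by simp
  let ?X = "pos_def_sqrt ?B"
  have X: "transpose ?X = ?X" "?X ** ?X = ?B" using pos_def_sqrt[OF B] pos_def_symmetric by auto
  have dB: "0 < det ?B" by (rule pos_def_det_pos[OF B])
  have "(?X *v a) \<bullet> (?X *v a) = a \<bullet> a + (transpose y *v a) \<bullet> (transpose y *v a)" for a
  proof -
    have "(?X *v a) \<bullet> (?X *v a) = a \<bullet> (?B *v a)" using inner_gram[of a ?X] by (simp add: X)
    then show ?thesis using inner_gram[of a "transpose y"] by (simp add: matrix_vector_mult_add_rdistrib inner_add_right del: transpose_matrix_vector)
  qed
  then have "gauss_integral TYPE('n) = ennreal (sqrt (det ?B)) * (\<integral>\<^sup>+a. ennreal (exp (- (a \<bullet> a + (transpose y *v a) \<bullet> (transpose y *v a)) / 2)) \<partial>lborel)"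
    unfolding gauss_integral_def using nn_integral_pos_def_substitution[OF _ B, of "\<lambda>a. ennreal (exp (- (a \<bullet> a) / 2))"] by (simp del: transpose_matrix_vector)
  then have "gauss_integral TYPE('n) * ennreal (det ?B powr (- 1 / 2)) =
     (ennreal (det ?B powr (- 1 / 2)) * ennreal (sqrt (det ?B))) * (\<integral>\<^sup>+a. ennreal (exp (- (a \<bullet> a + (transpose y *v a) \<bullet> (transpose y *v a)) / 2)) \<partial>lborel)"
    by (simp only: mult_ac)
  also have "ennreal (det ?B powr (- 1 / 2)) * ennreal (sqrt (det ?B)) = 1"
    using dB by (simp add: ennreal_mult[symmetric] powr_half_sqrt[symmetric] powr_add[symmetric])
  finally show ?thesis by simp
qed

lemma stiefel_mult_inner:
  fixes v :: "real^'l^'n" and M :: "real^'m^'l"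
  assumes "transpose v ** v = mat 1"
  shows "(v ** M) \<bullet> (v ** M) = M \<bullet> M"
  unfolding inner_matrix_columns column_matrix_mult
  by (simp add: inner_gram[symmetric] assms)

text \<open>The lower block is a square matrix, almost surely invertible, so its Gram matrix is
  positive definite; the upper block only adds a nonnegative form.\<close>

lemma AE_gram_pos_def: "AE A in lborel. transpose A ** (A :: real^'l^('k::finite + 'l::finite)) \<in> pos_def_matrices"
proof -
  let ?bad = "\<lambda>A :: real^'l^('k + 'l). indicator (- pos_def_matrices) (transpose A ** A) :: ennreal"
  have [measurable]: "- pos_def_matrices \<in> sets (borel :: (real^'l^'l) measure)" by (rule borel_comp) measurable
  have "(\<integral>\<^sup>+A. ?bad A \<partial>lborel) = (\<integral>\<^sup>+\<tau>. \<integral>\<^sup>+\<omega>. ?bad (vstack \<omega> \<tau>) \<partial>lborel \<partial>lborel)"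
    by (rule nn_integral_lborel_vstack) measurable
  also have "\<dots> = 0"
  proof (subst nn_integral_0_iff_AE)
    show "AE \<tau> in lborel. (\<integral>\<^sup>+(\<omega> :: real^'l^'k). ?bad (vstack \<omega> \<tau>) \<partial>lborel) = 0"
      using AE_det_nonzero
    proof eventually_elim
      fix \<tau> :: "real^'l^'l" assume "det \<tau> \<noteq> 0"
      then have "?bad (vstack \<omega> \<tau>) = 0" for \<omega> :: "real^'l^'k"
        using pos_def_add_gram[OF gram_pos_def, of \<tau> \<omega>] by (simp add: vstack_mult add.commute)
      then show "(\<integral>\<^sup>+(\<omega> :: real^'l^'k). ?bad (vstack \<omega> \<tau>) \<partial>lborel) = 0" by simp
    qed
  qed measurable
  finally have "AE A in lborel. ?bad A = 0"
    by (subst (asm) nn_integral_0_iff_AE) auto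
  then show ?thesis by eventually_elim (auto simp: indicator_def split: if_splits)
qed

text \<open>Up to a constant this is det(I + zz') to the power -n/2, because the n rows of
  \<open>A\<close> separate; by Sylvester's identity z'z may replace zz'.\<close>

definition gauss_weight :: "'n::finite itself \<Rightarrow> real^'m^'l \<Rightarrow> ennreal" where
  "gauss_weight (_ :: 'n itself) z = (\<integral>\<^sup>+A. ennreal (exp (- (A \<bullet> A + (A ** z) \<bullet> (A ** z)) / 2)) \<partial>(lborel :: (real^'l^'n) measure))"

lemma borel_gauss_weight [measurable]: "gauss_weight TYPE('n::finite) \<in> borel_measurable borel"
  unfolding gauss_weight_def by measurable

lemma gauss_weight_pos: "0 < gauss_weight TYPE('n::finite) (z :: real^'m^'l)"
proof (rule ccontr)
  assume "\<not> 0 < gauss_weight TYPE('n) z"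
  then have "AE A in (lborel :: (real^'l^'n) measure). False"
    unfolding gauss_weight_def by (simp add: nn_integral_0_iff_AE not_less)
  then show False
    using emeasure_lborel_UNIV[where 'a="real^'l^'n"] by (simp add: AE_iff_null null_sets_def)
qed

lemma exp_half_add: "ennreal (exp (- (a + b) / 2)) = ennreal (exp (- a / 2)) * ennreal (exp (- b / 2))"
  by (simp add: ennreal_mult[symmetric] exp_add[symmetric] add_divide_distrib)

text \<open>
  The Gaussian average makes the mean over $O(n)$ explicit: in the polar decomposition \<open>A = v T\<close>
  the factors \<open>v\<close> and the random rotation can be exchanged.
\<close>

lemma haar_average_gauss_weight:
  fixes y :: "real^'m^('k::finite + 'l::finite)"
  shows "(\<integral>\<^sup>+g. gauss_weight TYPE('k + 'l) (transpose (bottom_frame :: real^'l^('k + 'l)) ** (transpose g ** y)) \<partial>haar)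
    = (\<integral>\<^sup>+A. ennreal (exp (- (A \<bullet> A + (transpose A ** y) \<bullet> (transpose A ** y)) / 2)) \<partial>(lborel :: (real^'l^('k + 'l)) measure))"
    (is "?L = ?R")
proof -
  let ?E = "bottom_frame :: real^'l^('k + 'l)"
  let ?\<gamma> = "\<lambda>A :: real^'l^('k + 'l). ennreal (exp (- (A \<bullet> A) / 2))"
  let ?a = "\<lambda>(A :: real^'l^('k + 'l)) g. ennreal (exp (- ((A ** (transpose ?E ** (transpose g ** y))) \<bullet> (A ** (transpose ?E ** (transpose g ** y)))) / 2))"
  let ?b = "\<lambda>(A :: real^'l^('k + 'l)) g. ennreal (exp (- ((transpose A ** (transpose g ** y)) \<bullet> (transpose A ** (transpose g ** y))) / 2))"
  have "?L = (\<integral>\<^sup>+g. \<integral>\<^sup>+A. ?\<gamma> A * ?a A g \<partial>lborel \<partial>haar)"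
    unfolding gauss_weight_def exp_half_add ..
  also have "\<dots> = (\<integral>\<^sup>+A. \<integral>\<^sup>+g. ?\<gamma> A * ?a A g \<partial>haar \<partial>lborel)"
    using haar_lborel.Fubini[of "\<lambda>(g, A). ?\<gamma> A * ?a A g"] by simp
  also have "\<dots> = (\<integral>\<^sup>+A. \<integral>\<^sup>+g. ?\<gamma> A * ?b A g \<partial>haar \<partial>lborel)"
  \<comment> \<open>The polar decomposition requires a Gram matrix in the open cone, hence the
    restriction to almost all \<open>A\<close>.\<close>
  proof (rule nn_integral_cong_AE, use AE_gram_pos_def in eventually_elim)
    fix A :: "real^'l^('k + 'l)" assume A: "transpose A ** A \<in> pos_def_matrices"
    let ?T = "pos_def_sqrt (transpose A ** A)"
    obtain v where v: "v \<in> stiefel" "v ** ?T = A" using polar_decomposition[OF refl A] .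
    have T: "transpose ?T = ?T" using pos_def_sqrt(1)[OF A] by (rule pos_def_symmetric)
    obtain h where h: "orthogonal_matrix h" "h ** ?E = v"
      using orthogonal_matrix_transitive[OF stiefel_vstack v(1)] .
    let ?e = "\<lambda>g. ennreal (exp (- ((?T ** (transpose ?E ** (transpose g ** y))) \<bullet> (?T ** (transpose ?E ** (transpose g ** y)))) / 2))"
    have a: "?a A g = ?e g" for g
    proof -
      have "A ** (transpose ?E ** (transpose g ** y)) = v ** (?T ** (transpose ?E ** (transpose g ** y)))"
        unfolding matrix_mul_assoc[of v ?T] v(2) ..
      then show ?thesis using v(1) by (simp only: stiefel_def mem_Collect_eq stiefel_mult_inner)
    qed
    have b: "?b A g = ?e (g ** h)" for g
    proof -
      have "transpose A = ?T ** transpose (h ** ?E)"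
        unfolding h(2) by (subst v(2)[symmetric]) (simp only: matrix_transpose_mul T)
      then have "transpose A ** (transpose g ** y) = ?T ** (transpose ?E ** (transpose (g ** h) ** y))"
        by (simp only: matrix_transpose_mul matrix_mul_assoc)
      then show ?thesis by (simp only:)
    qed
    \<comment> \<open>With v = h E and A = v T, the first expression sees only \<open>T\<close>, and
      the second is the first with \<open>g\<close> replaced by \<open>g h\<close>. Right invariance
      removes \<open>h\<close>.\<close>
    have "(\<integral>\<^sup>+g. ?\<gamma> A * ?e (g ** h) \<partial>haar) = (\<integral>\<^sup>+g. ?\<gamma> A * ?e g \<partial>haar)"
      by (rule nn_integral_haar_right[OF _ h(1)]) measurable
    then show "(\<integral>\<^sup>+g. ?\<gamma> A * ?a A g \<partial>haar) = (\<integral>\<^sup>+g. ?\<gamma> A * ?b A g \<partial>haar)"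
      unfolding a b by (rule sym)
  qed
  also have "\<dots> = (\<integral>\<^sup>+g. \<integral>\<^sup>+A. ?\<gamma> A * ?b A g \<partial>lborel \<partial>haar)"
    using haar_lborel.Fubini[of "\<lambda>(g, A). ?\<gamma> A * ?b A g"] by simp
  also have "\<dots> = (\<integral>\<^sup>+g. ?R \<partial>(haar :: (real^('k + 'l)^('k + 'l)) measure))"
  \<comment> \<open>For fixed \<open>g\<close> the substitution A -> g A removes the rotation. The
    integral no longer depends on \<open>g\<close>, and Haar measure has mass 1.\<close>
  proof (rule nn_integral_cong)
    fix g :: "real^('k + 'l)^('k + 'l)" assume "g \<in> space haar"
    then have g: "orthogonal_matrix g" by simp
    have "?\<gamma> A * ?b A g = ennreal (exp (- ((g ** A) \<bullet> (g ** A) + (transpose (g ** A) ** y) \<bullet> (transpose (g ** A) ** y)) / 2))" for A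
    proof -
      have "(g ** A) \<bullet> (g ** A) = A \<bullet> A" using g by (intro stiefel_mult_inner) (simp add: orthogonal_matrix)
      moreover have "transpose (g ** A) ** y = transpose A ** (transpose g ** y)"
        by (simp only: matrix_transpose_mul matrix_mul_assoc)
      ultimately show ?thesis by (simp only: exp_half_add)
    qed
    then show "(\<integral>\<^sup>+A. ?\<gamma> A * ?b A g \<partial>lborel) = ?R"
      using nn_integral_lborel_mult_left[OF _ g, of "\<lambda>A. ennreal (exp (- (A \<bullet> A + (transpose A ** y) \<bullet> (transpose A ** y)) / 2))"]
      by simp
  qed
  also have "\<dots> = ?R" by simp
  finally show ?thesis .
qed

text \<open>The exponent is a sum over the columns of \<open>A\<close>, so the integral is a power
  of the integral for a single column; transposition presents the columns as components.\<close>

lemma nn_integral_gauss_columns: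
  fixes y :: "real^'m^'n"
  shows "(\<integral>\<^sup>+A. ennreal (exp (- (A \<bullet> A + (transpose A ** y) \<bullet> (transpose A ** y)) / 2)) \<partial>(lborel :: (real^'l::finite^'n) measure))
    = (gauss_integral TYPE('n) * ennreal (det (mat 1 + y ** transpose y) powr (- 1 / 2))) ^ CARD('l)"
proof -
  let ?\<phi> = "\<lambda>a. ennreal (exp (- (a \<bullet> a + (transpose y *v a) \<bullet> (transpose y *v a)) / 2))"
  have p: "ennreal (exp (- (transpose u \<bullet> transpose u + (u ** y) \<bullet> (u ** y)) / 2)) = (\<Prod>j\<in>UNIV. ?\<phi> (u $ j))" for u :: "real^'n^'l"
  proof -
    have "column j (transpose u) = u $ j" for j by (simp add: column_def transpose_def vec_eq_iff)
    then have "transpose u \<bullet> transpose u = (\<Sum>j\<in>UNIV. u $ j \<bullet> u $ j)" by (simp add: inner_matrix_columns)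
    moreover have "(u ** y) \<bullet> (u ** y) = (\<Sum>j\<in>UNIV. (transpose y *v u $ j) \<bullet> (transpose y *v u $ j))"
      by (simp only: inner_matrix_rows row_matrix_mult)
    ultimately have "- (transpose u \<bullet> transpose u + (u ** y) \<bullet> (u ** y)) / 2
       = (\<Sum>j\<in>UNIV. - (u $ j \<bullet> u $ j + (transpose y *v u $ j) \<bullet> (transpose y *v u $ j)) / 2)"
      by (simp only: sum.distrib[symmetric] sum_negf[symmetric] sum_divide_distrib)
    then show ?thesis by (simp only: exp_sum finite_class.finite_UNIV prod_ennreal exp_ge_zero)
  qed
  have "(\<integral>\<^sup>+A. ennreal (exp (- (A \<bullet> A + (transpose A ** y) \<bullet> (transpose A ** y)) / 2)) \<partial>(lborel :: (real^'l^'n) measure))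
    = (\<integral>\<^sup>+A. ennreal (exp (- (A \<bullet> A + (transpose A ** y) \<bullet> (transpose A ** y)) / 2)) \<partial>distr (lborel :: (real^'n^'l) measure) borel transpose)"
    by (simp only: lborel_transpose)
  also have "\<dots> = (\<integral>\<^sup>+u. (\<Prod>j\<in>UNIV. ?\<phi> (u $ j)) \<partial>(lborel :: (real^'n^'l) measure))"
    by (subst nn_integral_distr) (measurable, simp only: p transpose_transpose)
  also have "\<dots> = (\<integral>\<^sup>+a. ?\<phi> a \<partial>lborel) ^ CARD('l)"
    by (rule nn_integral_prod_coordinates) measurable
  finally show ?thesis unfolding nn_integral_gauss_gram .
qed

definition gauss_kernel :: "'l::finite itself \<Rightarrow> real^'m^'n \<Rightarrow> real" where
  "gauss_kernel (_ :: 'l itself) y = enn2real (gauss_integral TYPE('n)) ^ CARD('l) * det (mat 1 + y ** transpose y) powr (- real CARD('l) / 2)"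

lemma borel_gauss_kernel [measurable]: "gauss_kernel TYPE('l::finite) \<in> borel_measurable borel"
  unfolding gauss_kernel_def by measurable

lemma gauss_kernel_nonneg: "0 \<le> gauss_kernel TYPE('l::finite) y"
  by (simp add: gauss_kernel_def)

lemma nn_integral_gauss_kernel:
  fixes y :: "real^'m^'n"
  shows "(\<integral>\<^sup>+A. ennreal (exp (- (A \<bullet> A + (transpose A ** y) \<bullet> (transpose A ** y)) / 2)) \<partial>(lborel :: (real^'l::finite^'n) measure))
    = ennreal (gauss_kernel TYPE('l) y)"
proof -
  have B: "mat 1 + y ** transpose y \<in> pos_def_matrices" using pos_def_add_gram[OF mat_1_pos_def, of "transpose y"] by simp
  have "(det (mat 1 + y ** transpose y) powr (- 1 / 2)) ^ CARD('l) = det (mat 1 + y ** transpose y) powr (- real CARD('l) / 2)"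
    using pos_def_det_pos[OF B] by (simp add: powr_powr flip: powr_realpow)
  moreover have "gauss_integral TYPE('n) = ennreal (enn2real (gauss_integral TYPE('n)))"
    using gauss_integral_finite[where 'n='n] by (simp add: less_top)
  ultimately show ?thesis
    unfolding nn_integral_gauss_columns gauss_kernel_def
    by (metis enn2real_nonneg ennreal_mult ennreal_power power_mult_distrib powr_ge_zero mult_nonneg_nonneg)
qed

text \<open>The Gaussian integrand is largest at y = 0. Boundedness of the kernel is what p = 1
  requires.\<close>

lemma gauss_kernel_le: "gauss_kernel TYPE('l::finite) (y :: real^'m^'n) \<le> gauss_kernel TYPE('l) (0 :: real^'m^'n)"
proof -
  have "ennreal (gauss_kernel TYPE('l) y) \<le> ennreal (gauss_kernel TYPE('l) (0 :: real^'m^'n))"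
    unfolding nn_integral_gauss_kernel[symmetric] by (intro nn_integral_mono ennreal_leI) simp
  then show ?thesis by (simp add: gauss_kernel_nonneg)
qed

text \<open>The power \<open>r\<close> of the kernel carries the determinant with exponent -lr/2,
  where l = n-k, so the threshold is the one of \<open>nn_integral_det_gram_finite\<close> with q =
  lr.\<close>

lemma gauss_kernel_powr_finite:
  assumes q: "real CARD('n::finite) + real CARD('m::finite) - 1 < real CARD('l::finite) * r"
  shows "(\<integral>\<^sup>+(y :: real^'m^'n). ennreal (gauss_kernel TYPE('l) y powr r) \<partial>lborel) < \<infinity>"
proof -
  let ?c = "enn2real (gauss_integral TYPE('n)) ^ CARD('l)"
  have "gauss_kernel TYPE('l) y powr r = ?c powr r * det (mat 1 + y ** transpose y) powr (- (real CARD('l) * r) / 2)" for y :: "real^'m^'n"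
    by (simp add: gauss_kernel_def powr_mult powr_powr)
  then have "(\<integral>\<^sup>+(y :: real^'m^'n). ennreal (gauss_kernel TYPE('l) y powr r) \<partial>lborel)
     = ennreal (?c powr r) * (\<integral>\<^sup>+(y :: real^'m^'n). ennreal (det (mat 1 + y ** transpose y) powr (- (real CARD('l) * r) / 2)) \<partial>lborel)"
    by (simp add: ennreal_mult nn_integral_cmult)
  also have "\<dots> < \<infinity>"
    using nn_integral_det_gram_finite[OF q] by (simp add: ennreal_mult_less_top)
  finally show ?thesis .
qed

text \<open>For fixed \<open>g\<close> the pair of \<omega> and \<open>z\<close> gives volume
  preserving coordinates y = g [\<omega>; z], in which z = E'g'y. So the planes with all shifts fill
  the space, and the weight is left averaged over rotations. It is used with the Gaussian weight and
  with weight 1.\<close>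

lemma nn_integral_weighted_rotation_integrand:
  fixes h :: "real^'m^('k::finite + 'l::finite) \<Rightarrow> ennreal" and W :: "real^'m^'l \<Rightarrow> ennreal"
  assumes [measurable]: "h \<in> borel_measurable borel" "W \<in> borel_measurable borel"
  shows "(\<integral>\<^sup>+z. W z * (\<integral>\<^sup>+p. rotation_integrand h z x p \<partial>(haar \<Otimes>\<^sub>M lborel)) \<partial>lborel)
    = (\<integral>\<^sup>+y. h (x + y) * (\<integral>\<^sup>+g. W (transpose (bottom_frame :: real^'l^('k + 'l)) ** (transpose g ** y)) \<partial>haar) \<partial>lborel)"
proof -
  let ?E = "bottom_frame :: real^'l^('k + 'l)"
  have "(\<integral>\<^sup>+z. W z * (\<integral>\<^sup>+p. rotation_integrand h z x p \<partial>(haar \<Otimes>\<^sub>M lborel)) \<partial>lborel)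
     = (\<integral>\<^sup>+z. \<integral>\<^sup>+g. W z * (\<integral>\<^sup>+(\<omega> :: real^'m^'k). h (x + g ** vstack \<omega> z) \<partial>lborel) \<partial>haar \<partial>lborel)"
  proof (rule nn_integral_cong)
    fix z :: "real^'m^'l"
    have "(\<integral>\<^sup>+p. rotation_integrand h z x p \<partial>(haar \<Otimes>\<^sub>M lborel)) = (\<integral>\<^sup>+g. \<integral>\<^sup>+(\<omega> :: real^'m^'k). h (x + g ** vstack \<omega> z) \<partial>lborel \<partial>haar)"
      using lborel.nn_integral_fst[of "rotation_integrand h z x" haar] unfolding rotation_integrand_def by simp
    then show "W z * (\<integral>\<^sup>+p. rotation_integrand h z x p \<partial>(haar \<Otimes>\<^sub>M lborel))
       = (\<integral>\<^sup>+g. W z * (\<integral>\<^sup>+(\<omega> :: real^'m^'k). h (x + g ** vstack \<omega> z) \<partial>lborel) \<partial>haar)"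
      by (simp add: nn_integral_cmult)
  qed
  also have "\<dots> = (\<integral>\<^sup>+g. \<integral>\<^sup>+z. W z * (\<integral>\<^sup>+(\<omega> :: real^'m^'k). h (x + g ** vstack \<omega> z) \<partial>lborel) \<partial>lborel \<partial>haar)"
    using haar_lborel.Fubini[of "\<lambda>(g, z). W z * (\<integral>\<^sup>+(\<omega> :: real^'m^'k). h (x + g ** vstack \<omega> z) \<partial>lborel)"] by simp
  also have "\<dots> = (\<integral>\<^sup>+g. \<integral>\<^sup>+y. W (transpose ?E ** (transpose g ** y)) * h (x + y) \<partial>lborel \<partial>haar)"
  proof (rule nn_integral_cong)
    fix g :: "real^('k + 'l)^('k + 'l)" assume "g \<in> space haar"
    then have g: "orthogonal_matrix g" and g': "orthogonal_matrix (transpose g)" by simp_all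
    have "(\<integral>\<^sup>+z. W z * (\<integral>\<^sup>+(\<omega> :: real^'m^'k). h (x + g ** vstack \<omega> z) \<partial>lborel) \<partial>lborel)
        = (\<integral>\<^sup>+z. \<integral>\<^sup>+(\<omega> :: real^'m^'k). W (transpose ?E ** vstack \<omega> z) * h (x + g ** vstack \<omega> z) \<partial>lborel \<partial>lborel)"
      by (simp add: transpose_bottom_frame_mult nn_integral_cmult)
    also have "\<dots> = (\<integral>\<^sup>+y. W (transpose ?E ** y) * h (x + g ** y) \<partial>lborel)"
      by (rule nn_integral_lborel_vstack[symmetric]) measurable
    also have "\<dots> = (\<integral>\<^sup>+y. W (transpose ?E ** (transpose g ** y)) * h (x + g ** (transpose g ** y)) \<partial>lborel)"
      by (rule nn_integral_lborel_mult_left[OF _ g', symmetric]) measurable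
    finally show "(\<integral>\<^sup>+z. W z * (\<integral>\<^sup>+(\<omega> :: real^'m^'k). h (x + g ** vstack \<omega> z) \<partial>lborel) \<partial>lborel)
       = (\<integral>\<^sup>+y. W (transpose ?E ** (transpose g ** y)) * h (x + y) \<partial>lborel)"
      by (simp only: orthogonal_matrixD(4)[OF g])
  qed
  also have "\<dots> = (\<integral>\<^sup>+y. \<integral>\<^sup>+g. W (transpose ?E ** (transpose g ** y)) * h (x + y) \<partial>haar \<partial>lborel)"
    using haar_lborel.Fubini[of "\<lambda>(g, y). W (transpose ?E ** (transpose g ** y)) * h (x + y)"] by simp
  also have "\<dots> = (\<integral>\<^sup>+y. h (x + y) * (\<integral>\<^sup>+g. W (transpose ?E ** (transpose g ** y)) \<partial>haar) \<partial>lborel)"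
    by (intro nn_integral_cong) (simp add: nn_integral_cmult mult.commute)
  finally show ?thesis .
qed

text \<open>
  Young's inequality against the kernel, which lies in $L^{p'}$ exactly in the stated range of \<open>p\<close>.
\<close>

lemma nn_integral_Lp_gauss_kernel_finite:
  fixes h :: "real^'m^'n \<Rightarrow> real"
  assumes [measurable]: "h \<in> borel_measurable borel" and h: "\<And>y. 0 \<le> h y"
    and p: "1 \<le> p" "(p - 1) * (real CARD('n) + real CARD('m) - 1) < p * real CARD('l::finite)"
    and fin: "(\<integral>\<^sup>+y. ennreal (h y powr p) \<partial>lborel) < \<infinity>"
  shows "(\<integral>\<^sup>+y. ennreal (h (x + y)) * ennreal (gauss_kernel TYPE('l) y) \<partial>lborel) < \<infinity>"
proof -
  have fin': "(\<integral>\<^sup>+y. ennreal (h (x + y) powr p) \<partial>lborel) < \<infinity>"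
    using nn_integral_lborel_shift[of "\<lambda>y. ennreal (h y powr p)" x] fin by (simp add: add.commute)
  show ?thesis
  proof (cases "p = 1")
    \<comment> \<open>The dual exponent is infinite, and the bound on the kernel takes the place of
      Young's inequality.\<close>
    case True
    have "(\<integral>\<^sup>+y. ennreal (h (x + y)) * ennreal (gauss_kernel TYPE('l) y) \<partial>lborel)
       \<le> (\<integral>\<^sup>+y. ennreal (h (x + y) powr p) * ennreal (gauss_kernel TYPE('l) (0 :: real^'m^'n)) \<partial>lborel)"
      using h True by (intro nn_integral_mono mult_mono) (auto intro: ennreal_leI gauss_kernel_le)
    also have "\<dots> < \<infinity>" using fin' by (simp add: nn_integral_multc ennreal_mult_less_top)
    finally show ?thesis .
  next
    case False
    then have p1: "1 < p" using p by simp
    \<comment> \<open>The dual exponent p'. Dividing the second condition on \<open>p\<close> by p -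
      1 gives the integrability threshold of the kernel.\<close>
    define r where "r = p / (p - 1)"
    have r: "1 < r" "1 / p + 1 / r = 1" using p1 by (simp_all add: r_def field_simps)
    have q: "real CARD('n) + real CARD('m) - 1 < real CARD('l) * r"
      using p(2) p1 by (simp add: r_def field_simps)
    have "(\<integral>\<^sup>+y. ennreal (h (x + y)) * ennreal (gauss_kernel TYPE('l) y) \<partial>lborel)
       \<le> (\<integral>\<^sup>+y. ennreal (h (x + y) powr p) + ennreal (gauss_kernel TYPE('l) y powr r) \<partial>lborel)"
    proof (rule nn_integral_mono)
      fix y :: "real^'m^'n"
      have "h (x + y) * gauss_kernel TYPE('l) y \<le> h (x + y) powr p / p + gauss_kernel TYPE('l) y powr r / r"
        using p1 r h by (intro Youngs_inequality) (auto simp: gauss_kernel_nonneg)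
      also have "\<dots> \<le> h (x + y) powr p + gauss_kernel TYPE('l) y powr r"
        using p1 r by (intro add_mono) (auto simp: divide_le_eq mult_le_cancel_left1)
      finally show "ennreal (h (x + y)) * ennreal (gauss_kernel TYPE('l) y) \<le> ennreal (h (x + y) powr p) + ennreal (gauss_kernel TYPE('l) y powr r)"
        using h by (simp add: ennreal_mult[symmetric] gauss_kernel_nonneg ennreal_leI flip: ennreal_plus)
    qed
    also have "\<dots> = (\<integral>\<^sup>+y. ennreal (h (x + y) powr p) \<partial>lborel) + (\<integral>\<^sup>+(y :: real^'m^'n). ennreal (gauss_kernel TYPE('l) y powr r) \<partial>lborel)"
      by (rule nn_integral_add) measurable
    also have "\<dots> < \<infinity>" using fin' gauss_kernel_powr_finite[OF q] by simp
    finally show ?thesis .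
  qed
qed

text \<open>The polar frame of [\<omega>; z] may be replaced by a fixed \<open>v\<close>, which
  leaves an expression in z'z alone. This permits the passage from statements about \<open>z\<close>
  to statements about \<open>s\<close>.\<close>

lemma nn_integral_rotation_integrand:
  fixes h :: "real^'m^('k::finite + 'l::finite) \<Rightarrow> ennreal" and z :: "real^'m^'l"
  assumes [measurable]: "h \<in> borel_measurable borel" and v: "v \<in> stiefel" and z: "transpose z ** z \<in> pos_def_matrices"
  shows "(\<integral>\<^sup>+p. rotation_integrand h z x p \<partial>(haar \<Otimes>\<^sub>M lborel)) =
    (\<integral>\<^sup>+(\<omega> :: real^'m^'k). \<integral>\<^sup>+g. h (x + (g ** v) ** pos_def_sqrt (transpose z ** z + transpose \<omega> ** \<omega>)) \<partial>haar \<partial>lborel)"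
proof -
  have "(\<integral>\<^sup>+p. rotation_integrand h z x p \<partial>(haar \<Otimes>\<^sub>M lborel)) = (\<integral>\<^sup>+\<omega>. \<integral>\<^sup>+g. rotation_integrand h z x (g, \<omega>) \<partial>haar \<partial>lborel)"
    by (rule haar_lborel.nn_integral_snd[symmetric]) measurable
  also have "\<dots> = (\<integral>\<^sup>+(\<omega> :: real^'m^'k). \<integral>\<^sup>+g. h (x + (g ** v) ** pos_def_sqrt (transpose z ** z + transpose \<omega> ** \<omega>)) \<partial>haar \<partial>lborel)"
  proof (rule nn_integral_cong)
    fix \<omega> :: "real^'m^'k"
    let ?q = "pos_def_sqrt (transpose z ** z + transpose \<omega> ** \<omega>)"
    obtain w where w: "w \<in> (stiefel :: (real^'m^('k + 'l)) set)" "w ** ?q = vstack \<omega> z" using polar_vstack[OF z] .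
    have "(\<integral>\<^sup>+g. rotation_integrand h z x (g, \<omega>) \<partial>haar) = (\<integral>\<^sup>+g. h (x + (g ** w) ** ?q) \<partial>haar)"
      by (simp add: rotation_integrand_def matrix_mul_assoc[symmetric] w(2))
    also have "\<dots> = (\<integral>\<^sup>+g. h (x + (g ** v) ** ?q) \<partial>haar)"
      by (rule nn_integral_haar_frame[OF _ w(1) v]) measurable
    finally show "(\<integral>\<^sup>+g. rotation_integrand h z x (g, \<omega>) \<partial>haar) = (\<integral>\<^sup>+g. h (x + (g ** v) ** ?q) \<partial>haar)" .
  qed
  finally show ?thesis .
qed

text \<open>The image of Lebesgue measure under z -> z'z has a density that is positive on the whole
  cone, so a set of \<open>s\<close> in the cone is null as soon as its preimage is.\<close>

lemma AE_sym_lborel_gram: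
  fixes Q :: "real^'m^'m \<Rightarrow> bool"
  assumes ml: "CARD('m) \<le> CARD('l::finite)" and Q: "{s. Q s} \<in> sets borel"
    and AE: "AE z in (lborel :: (real^'m^'l) measure). transpose z ** z \<in> pos_def_matrices \<longrightarrow> Q (transpose z ** z)"
  shows "AE s in sym_lborel. s \<in> pos_def_matrices \<longrightarrow> Q s"
proof -
  have t: "transpose (0 :: real^'m^'m) = 0" by (simp add: transpose_def vec_eq_iff)
  have "{s. s \<in> pos_def_matrices \<longrightarrow> Q s} = - pos_def_matrices \<union> {s. Q s}" by auto
  then have "{s. s \<in> pos_def_matrices \<longrightarrow> Q s} \<in> sets borel"
    using Q by (simp only:) (intro sets.Un borel_comp pos_def_matrices_borel)
  then have "AE s in density sym_lborel (gram_density TYPE('l) 0). s \<in> pos_def_matrices \<longrightarrow> Q s"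
    unfolding distr_gram[OF ml t, symmetric] using AE by (subst AE_distr_iff) auto
  then show ?thesis
    by (subst (asm) AE_density) (auto simp: gram_density_pos_iff[OF ml])
qed

section \<open>Borel representatives and null sets\<close>

lemma lebesgue_borel_representative:
  fixes f :: "'a::euclidean_space \<Rightarrow> complex"
  assumes "f \<in> borel_measurable lebesgue"
  obtains f0 where "f0 \<in> borel_measurable borel" "AE a in lborel. f a = f0 a"
proof -
  have "(\<lambda>a. Re (f a)) \<in> borel_measurable lebesgue" "(\<lambda>a. Im (f a)) \<in> borel_measurable lebesgue"
    using assms by measurable
  from this[THEN completion_ex_borel_measurable_real]
  obtain a b where ab: "a \<in> borel_measurable lborel" "AE t in lborel. Re (f t) = a t"
    "b \<in> borel_measurable lborel" "AE t in lborel. Im (f t) = b t"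
    by blast
  have "(\<lambda>t. complex_of_real (a t) + \<i> * complex_of_real (b t)) \<in> borel_measurable borel"
    using ab(1,3) by simp
  moreover have "AE t in lborel. f t = complex_of_real (a t) + \<i> * complex_of_real (b t)"
    using ab(2,4) by eventually_elim (simp add: complex_eq_iff)
  ultimately show ?thesis by (rule that)
qed

lemma frac_AE_mp:
  "frac_AE TYPE('k::finite) P s \<Longrightarrow> frac_AE TYPE('k) (\<lambda>r. P r \<longrightarrow> R r) s \<Longrightarrow> frac_AE TYPE('k) R s"
  unfolding frac_AE_def by (auto split: if_splits elim: eventually_elim2)

lemma frac_AE_I: "(\<And>r. R r) \<Longrightarrow> frac_AE TYPE('k::finite) R s"
  by (simp add: frac_AE_def)

text \<open>On a single plane or sphere \<open>f\<close> need not be measurable at all. The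
  assumption \<open>null\<close>, read in the two orders of integration, says that \<open>N\<close>
  is negligible on almost every sphere and on almost every plane that occurs; there \<open>f\<close>
  and \<open>f0\<close> cannot be told apart.\<close>

lemma null_set_transfer:
  fixes f f0 :: "real^'m^('k::finite + 'l::finite) \<Rightarrow> complex" and z :: "real^'m^'l"
  assumes f0[measurable]: "f0 \<in> borel_measurable borel" and N[measurable]: "N \<in> sets borel"
    and agree_off: "\<forall>a. a \<notin> N \<longrightarrow> f a = f0 a"
    and z: "transpose z ** z \<in> pos_def_matrices"
    and null: "(\<integral>\<^sup>+p. rotation_integrand (indicator N) z x p \<partial>(haar \<Otimes>\<^sub>M lborel)) = 0"
  shows "frac_mean_converges TYPE('k) f x (transpose z ** z) \<longleftrightarrow> frac_mean_converges TYPE('k) f0 x (transpose z ** z)"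
    and "frac_integral TYPE('k) (sph_mean f x) (transpose z ** z) = frac_integral TYPE('k) (sph_mean f0 x) (transpose z ** z)"
    and "dual_radon_converges f z x \<longleftrightarrow> dual_radon_converges f0 z x"
    and "shifted_dual (radon f) z x = shifted_dual (radon f0) z x"
proof -
  let ?s = "transpose z ** z"
  have eq: "f a = f0 a" if "a \<notin> N" for a using agree_off that by blast
  have fn[measurable]: "(\<lambda>a. norm (f0 a)) \<in> borel_measurable borel" by measurable
  have s: "transpose ?s = ?s" by (rule transpose_gram)
  obtain v where v: "v \<in> (stiefel :: (real^'m^('k + 'l)) set)" using polar_vstack[OF z, of "0 :: real^'m^'k"] by blast
  \<comment> \<open>The sphere of matrix radius \<open>pos_def_sqrt r\<close> around
    \<open>x\<close> meets \<open>N\<close> in a null set only.\<close>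
  define agree where "agree r \<longleftrightarrow> (AE a in stiefel_measure. x + (a :: real^'m^('k + 'l)) ** pos_def_sqrt r \<notin> N)" for r
  have agree: "agree r \<longleftrightarrow> (\<integral>\<^sup>+g. indicator N (x + (g ** v) ** pos_def_sqrt r) \<partial>haar) = 0" for r
  proof -
    have "agree r \<longleftrightarrow> (AE g in haar. x + (g ** v) ** pos_def_sqrt r \<notin> N)"
      unfolding agree_def by (rule AE_stiefel_iff[OF v]) measurable
    also have "\<dots> \<longleftrightarrow> (\<integral>\<^sup>+g. indicator N (x + (g ** v) ** pos_def_sqrt r) \<partial>haar) = 0"
      by (subst nn_integral_0_iff_AE) (auto simp: indicator_def intro!: AE_cong)
    finally show ?thesis .
  qed
  \<comment> \<open>First order of integration: for almost every \<omega> the sphere belonging to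
    \<omega> is harmless.\<close>
  have "(\<integral>\<^sup>+(\<omega> :: real^'m^'k). \<integral>\<^sup>+g. indicator N (x + (g ** v) ** pos_def_sqrt (?s + transpose \<omega> ** \<omega>)) \<partial>haar \<partial>lborel) = 0"
    using null by (subst (asm) nn_integral_rotation_integrand[OF _ v z]) auto
  then have "AE (\<omega> :: real^'m^'k) in lborel. agree (?s + transpose \<omega> ** \<omega>)"
    unfolding agree by (subst (asm) nn_integral_0_iff_AE) auto
  moreover have "{r. agree r} \<in> sets borel" unfolding agree by measurable
  ultimately have fa: "frac_AE TYPE('k) agree ?s" by (simp add: frac_AE_iff[OF s])
  \<comment> \<open>The value type is left general because the fact is applied to \<open>f\<close>
    itself and to its norm; the same is done for planes below.\<close>
  have stiefel_eq: "(integrable stiefel_measure (\<lambda>a. F (x + a ** pos_def_sqrt r)) \<longleftrightarrow> integrable stiefel_measure (\<lambda>a. F0 (x + a ** pos_def_sqrt r)))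
      \<and> sph_mean F x r = sph_mean F0 x r"
    if r: "agree r" and F0[measurable]: "F0 \<in> borel_measurable borel" and F: "\<And>a. a \<notin> N \<Longrightarrow> F a = F0 a"
    for r and F F0 :: "real^'m^('k + 'l) \<Rightarrow> 'c::{banach, second_countable_topology}"
  proof -
    have 1: "AE a in frame_measure v. F (x + a ** pos_def_sqrt r) = F0 (x + a ** pos_def_sqrt r)"
      using r unfolding agree_def stiefel_measure_eq[OF v] AE_completion_iff by eventually_elim (rule F)
    have "(\<lambda>a. F0 (x + a ** pos_def_sqrt r)) \<in> borel_measurable (restrict_space borel stiefel)"
      by (rule measurable_restrict_space1) measurable
    then have 2: "(\<lambda>a. F0 (x + a ** pos_def_sqrt r)) \<in> borel_measurable (frame_measure v)"
      by (simp cong: measurable_cong_sets)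
    show ?thesis
      unfolding sph_mean_def stiefel_measure_eq[OF v] integrable_completion_cong[OF 1 2] integral_completion_cong[OF 1 2]
        integrable_completion[OF 2] integral_completion[OF 2] by simp
  qed
  have mean: "frac_AE TYPE('k) (\<lambda>r. sph_mean f x r = sph_mean f0 x r) ?s"
    by (rule frac_AE_mp[OF fa frac_AE_I]) (use stiefel_eq[OF _ f0 eq] in blast)
  have mean_norm: "frac_AE TYPE('k) (\<lambda>r. sph_mean (\<lambda>a. norm (f a)) x r = sph_mean (\<lambda>a. norm (f0 a)) x r) ?s"
    by (rule frac_AE_mp[OF fa frac_AE_I]) (use stiefel_eq[OF _ fn, of _ "\<lambda>a. norm (f a)"] eq in simp)
  have int: "frac_AE TYPE('k) (\<lambda>r. integrable stiefel_measure (\<lambda>a. f (x + a ** pos_def_sqrt r)) \<longleftrightarrow>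
      integrable stiefel_measure (\<lambda>a. f0 (x + a ** pos_def_sqrt r))) ?s"
    by (rule frac_AE_mp[OF fa frac_AE_I]) (use stiefel_eq[OF _ f0 eq] in blast)
  have "frac_AE TYPE('k) (\<lambda>r. integrable stiefel_measure (\<lambda>a. f (x + a ** pos_def_sqrt r))) ?s \<longleftrightarrow>
     frac_AE TYPE('k) (\<lambda>r. integrable stiefel_measure (\<lambda>a. f0 (x + a ** pos_def_sqrt r))) ?s"
  proof
    assume "frac_AE TYPE('k) (\<lambda>r. integrable stiefel_measure (\<lambda>a. f (x + a ** pos_def_sqrt r))) ?s"
    then show "frac_AE TYPE('k) (\<lambda>r. integrable stiefel_measure (\<lambda>a. f0 (x + a ** pos_def_sqrt r))) ?s"
      by (rule frac_AE_mp) (rule frac_AE_mp[OF int frac_AE_I], blast)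
  next
    assume "frac_AE TYPE('k) (\<lambda>r. integrable stiefel_measure (\<lambda>a. f0 (x + a ** pos_def_sqrt r))) ?s"
    then show "frac_AE TYPE('k) (\<lambda>r. integrable stiefel_measure (\<lambda>a. f (x + a ** pos_def_sqrt r))) ?s"
      by (rule frac_AE_mp) (rule frac_AE_mp[OF int frac_AE_I], blast)
  qed
  then show "frac_mean_converges TYPE('k) f x ?s \<longleftrightarrow> frac_mean_converges TYPE('k) f0 x ?s"
    unfolding frac_mean_converges_iff frac_integrable_cong[OF borel_sph_mean[OF fn v] mean_norm] by simp
  show "frac_integral TYPE('k) (sph_mean f x) ?s = frac_integral TYPE('k) (sph_mean f0 x) ?s"
    by (rule frac_integral_cong[OF borel_sph_mean[OF f0 v] mean])

  let ?S = "stiefel_measure :: (real^'l^('k + 'l)) measure"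
  let ?E = "bottom_frame :: real^'l^('k + 'l)"
  have E: "?E \<in> stiefel" by (rule stiefel_vstack)
  \<comment> \<open>Second order of integration: for almost every rotation the plane is
    harmless.\<close>
  have "(\<integral>\<^sup>+g. \<integral>\<^sup>+(\<omega> :: real^'m^'k). indicator N (x + g ** vstack \<omega> z) \<partial>lborel \<partial>haar) = 0"
    using null lborel.nn_integral_fst[of "rotation_integrand (indicator N :: _ \<Rightarrow> ennreal) z x" haar] unfolding rotation_integrand_def by simp
  then have "AE g in haar. (\<integral>\<^sup>+(\<omega> :: real^'m^'k). indicator N (x + g ** vstack \<omega> z) \<partial>lborel) = 0"
    by (subst (asm) nn_integral_0_iff_AE) auto
  note zero = this
  have plane: "(\<integral>\<^sup>+(\<omega> :: real^'m^'k). indicator N (x + g ** vstack \<omega> z) \<partial>lborel) = (\<integral>\<^sup>+a. indicator N a \<partial>plane_measure x z (g ** ?E))"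
    if "g \<in> space haar" for g
    using that by (subst plane_measure_eq) (auto simp: nn_integral_distr simp del: nn_integral_indicator)
  have "AE g in haar. (\<integral>\<^sup>+a. indicator N a \<partial>plane_measure x z (g ** ?E)) = 0"
    using zero AE_space by eventually_elim (simp only: plane)
  then have "AE \<xi> in ?S. (\<integral>\<^sup>+a. indicator N a \<partial>plane_measure x z \<xi>) = 0"
    by (subst AE_stiefel_iff[OF E]) measurable
  then have good: "AE \<xi> in frame_measure ?E. \<xi> \<in> stiefel \<and> (\<integral>\<^sup>+a. indicator N a \<partial>plane_measure x z \<xi>) = 0"
    unfolding stiefel_measure_eq[OF E] AE_completion_iff using AE_space by eventually_elim (simp del: nn_integral_indicator)
  have plane_eq: "(integrable lebesgue (\<lambda>\<omega>. F (frame_rotation \<xi> ** vstack \<omega> (transpose \<xi> ** x + z))) \<longleftrightarrow>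
        integrable lebesgue (\<lambda>\<omega>. F0 (frame_rotation \<xi> ** vstack \<omega> (transpose \<xi> ** x + z))))
      \<and> radon F \<xi> (transpose \<xi> ** x + z) = integral\<^sup>L (plane_measure x z \<xi>) F0"
    if \<xi>: "\<xi> \<in> stiefel \<and> (\<integral>\<^sup>+a. indicator N a \<partial>plane_measure x z \<xi>) = 0" and F0[measurable]: "F0 \<in> borel_measurable borel" and F: "\<And>a. a \<notin> N \<Longrightarrow> F a = F0 a"
    for \<xi> :: "real^'l^('k + 'l)" and F F0 :: "real^'m^('k + 'l) \<Rightarrow> 'c::{banach, second_countable_topology}"
  proof -
    let ?t = "\<lambda>\<omega> :: real^'m^'k. frame_rotation \<xi> ** vstack \<omega> (transpose \<xi> ** x + z)"
    have "(\<integral>\<^sup>+\<omega>. indicator N (?t \<omega>) \<partial>lborel) = 0"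
      using \<xi> unfolding plane_measure_frame_rotation[OF conjunct1[OF \<xi>]]
      by (simp add: nn_integral_distr del: nn_integral_indicator)
    then have "AE \<omega> in lborel. ?t \<omega> \<notin> N"
      by (subst (asm) nn_integral_0_iff_AE) (auto simp: indicator_def elim: eventually_mono)
    then have 1: "AE \<omega> in lborel. F (?t \<omega>) = F0 (?t \<omega>)" by eventually_elim (rule F)
    have 2: "(\<lambda>\<omega>. F0 (?t \<omega>)) \<in> borel_measurable lborel" by measurable
    have "radon F \<xi> (transpose \<xi> ** x + z) = radon F0 \<xi> (transpose \<xi> ** x + z)"
      unfolding radon_def integral_completion_cong[OF 1 2] integral_completion[OF 2] ..
    then show ?thesis
      using \<xi> unfolding integrable_completion_cong[OF 1 2] integrable_completion[OF 2] by (simp add: radon_eq)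
  qed
  have meas: "(\<lambda>\<xi>. integral\<^sup>L (plane_measure x z \<xi>) F0) \<in> borel_measurable (frame_measure ?E)"
    if F0[measurable]: "F0 \<in> borel_measurable borel"
    for F0 :: "real^'m^('k + 'l) \<Rightarrow> 'c::{banach, second_countable_topology}"
  proof -
    have "(\<lambda>\<xi>. integral\<^sup>L (plane_measure x z \<xi>) F0) \<in> borel_measurable (restrict_space borel stiefel)"
      by (rule measurable_restrict_space1) measurable
    then show ?thesis by (simp cong: measurable_cong_sets)
  qed
  have outer_eq: "(integrable ?S (\<lambda>\<xi>. radon F \<xi> (transpose \<xi> ** x + z)) \<longleftrightarrow> integrable ?S (\<lambda>\<xi>. radon F0 \<xi> (transpose \<xi> ** x + z)))
     \<and> (\<integral>\<xi>. radon F \<xi> (transpose \<xi> ** x + z) \<partial>?S) = (\<integral>\<xi>. radon F0 \<xi> (transpose \<xi> ** x + z) \<partial>?S)"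
    if F0: "F0 \<in> borel_measurable borel" and F: "\<And>a. a \<notin> N \<Longrightarrow> F a = F0 a"
    for F F0 :: "real^'m^('k + 'l) \<Rightarrow> 'c::{banach, second_countable_topology}"
  proof -
    have 1: "AE \<xi> in frame_measure ?E. radon F \<xi> (transpose \<xi> ** x + z) = integral\<^sup>L (plane_measure x z \<xi>) F0"
      using good by eventually_elim (use plane_eq[OF _ F0 F] in blast)
    have 2: "AE \<xi> in frame_measure ?E. radon F0 \<xi> (transpose \<xi> ** x + z) = integral\<^sup>L (plane_measure x z \<xi>) F0"
      using good by eventually_elim (use plane_eq[OF _ F0 refl] in blast)
    show ?thesis
      unfolding stiefel_measure_eq[OF E] integrable_completion_cong[OF 1 meas[OF F0]] integral_completion_cong[OF 1 meas[OF F0]]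
        integrable_completion_cong[OF 2 meas[OF F0]] integral_completion_cong[OF 2 meas[OF F0]] by simp
  qed
  have inner_eq: "(AE \<xi> in ?S. integrable lebesgue (\<lambda>\<omega>. f (frame_rotation \<xi> ** vstack \<omega> (transpose \<xi> ** x + z)))) \<longleftrightarrow>
     (AE \<xi> in ?S. integrable lebesgue (\<lambda>\<omega>. f0 (frame_rotation \<xi> ** vstack \<omega> (transpose \<xi> ** x + z))))"
    unfolding stiefel_measure_eq[OF E] AE_completion_iff
    by (rule eventually_subst) (use good in eventually_elim, use plane_eq[OF _ f0 eq] in blast)
  show "dual_radon_converges f z x \<longleftrightarrow> dual_radon_converges f0 z x"
    unfolding dual_radon_converges_def inner_eq using outer_eq[OF fn, of "\<lambda>a. norm (f a)"] eq by simp
  show "shifted_dual (radon f) z x = shifted_dual (radon f0) z x"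
    unfolding shifted_dual_def using outer_eq[OF f0 eq] by simp
qed

text \<open>A frame times the root of \<open>s\<close> is a solution. It provides some
  \<open>z\<close> for the claim on spherical means, in which no \<open>z\<close> occurs.\<close>

lemma gram_surjective:
  fixes s :: "real^'m^'m"
  assumes "CARD('m) \<le> CARD('l::finite)" "s \<in> pos_def_matrices"
  obtains z :: "real^'m^'l" where "transpose z ** z = s"
proof -
  obtain v where v: "v \<in> (stiefel :: (real^'m^'l) set)" using stiefel_nonempty[OF assms(1)] .
  let ?q = "pos_def_sqrt s"
  have q: "transpose ?q = ?q" "?q ** ?q = s" using pos_def_sqrt[OF assms(2)] pos_def_symmetric by auto
  have "transpose (v ** ?q) ** (v ** ?q) = transpose ?q ** (transpose v ** v) ** ?q"
    by (simp only: matrix_transpose_mul matrix_mul_assoc)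
  also have "\<dots> = s" using v by (simp add: stiefel_def q matrix_mul_rid)
  finally show ?thesis by (rule that)
qed

text \<open>Two null sets of shifts are collected: one from integrability of the norm of
  \<open>f0\<close>, the other from the set \<open>N\<close> on which \<open>f\<close> and its
  representative may differ. A single exceptional set of \<open>s\<close> then serves all
  \<open>z\<close> with z'z = s.\<close>

lemma AE_sym_integrable_rotation_integrand:
  fixes f0 :: "real^'m^('k::finite + 'l::finite) \<Rightarrow> complex"
  assumes ml: "CARD('m) \<le> CARD('l)" and p: "1 \<le> p"
    "p < (real CARD('k + 'l) + real CARD('m) - 1) / (real CARD('k) + real CARD('m) - 1)"
    and [measurable]: "f0 \<in> borel_measurable borel" and fin: "(\<integral>\<^sup>+a. ennreal (norm (f0 a) powr p) \<partial>lborel) < \<infinity>"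
    and N: "N \<in> null_sets lborel"
  shows "AE s in sym_lborel. s \<in> pos_def_matrices \<longrightarrow> (\<forall>z :: real^'m^'l. transpose z ** z = s \<longrightarrow>
     integrable (haar \<Otimes>\<^sub>M lborel) (rotation_integrand f0 z x) \<and>
     (\<integral>\<^sup>+p. rotation_integrand (indicator N) z x p \<partial>(haar \<Otimes>\<^sub>M lborel)) = 0)"
proof -
  have [measurable]: "N \<in> sets borel" and N0: "emeasure lborel N = 0" using N by (auto simp: null_sets_def)
  let ?h = "\<lambda>a. ennreal (norm (f0 a))"
  obtain v0 where "v0 \<in> (stiefel :: (real^'m^'l) set)" using stiefel_nonempty[OF ml] .
  then have "vstack (0 :: real^'m^'k) v0 \<in> stiefel" by (simp add: stiefel_def vstack_mult)
  then obtain v where v: "v \<in> (stiefel :: (real^'m^('k + 'l)) set)" by blast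
  \<comment> \<open>The integral over the product as a function of \<open>s\<close>, with a base
    frame \<open>v\<close> that does not depend on \<open>z\<close>.\<close>
  define G where "G h s = (\<integral>\<^sup>+(\<omega> :: real^'m^'k). \<integral>\<^sup>+g. h (x + (g ** v) ** pos_def_sqrt (s + transpose \<omega> ** \<omega>)) \<partial>haar \<partial>lborel)"
    for h :: "real^'m^('k + 'l) \<Rightarrow> ennreal" and s
  have [measurable]: "G h \<in> borel_measurable borel" if [measurable]: "h \<in> borel_measurable borel" for h
    unfolding G_def by measurable
  have G: "(\<integral>\<^sup>+p. rotation_integrand h z x p \<partial>(haar \<Otimes>\<^sub>M lborel)) = G h (transpose z ** z)"
    if "h \<in> borel_measurable borel" "transpose z ** z \<in> pos_def_matrices" for h and z :: "real^'m^'l"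
    unfolding G_def by (rule nn_integral_rotation_integrand[OF that(1) v that(2)])
  have km: "0 < real CARD('k) + real CARD('m) - 1"
    using zero_less_card_finite[where 'a='k] zero_less_card_finite[where 'a='m] by linarith
  \<comment> \<open>A rearrangement of the bound on \<open>p\<close>: the two numbers in its
    quotient differ by n - k = l.\<close>
  have p': "(p - 1) * (real CARD('k + 'l) + real CARD('m) - 1) < p * real CARD('l)"
  proof -
    have "p * (real CARD('k) + real CARD('m) - 1) < real CARD('k + 'l) + real CARD('m) - 1"
      using p(2) km by (simp add: pos_less_divide_eq)
    then show ?thesis by (simp add: algebra_simps)
  qed
  \<comment> \<open>Finite against a strictly positive weight, hence the inner integral is finite
    for almost every \<open>z\<close>.\<close>
  have "(\<integral>\<^sup>+z. gauss_weight TYPE('k + 'l) (z :: real^'m^'l) * (\<integral>\<^sup>+p. rotation_integrand ?h z x p \<partial>(haar \<Otimes>\<^sub>M lborel)) \<partial>lborel)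
     = (\<integral>\<^sup>+y. ?h (x + y) * ennreal (gauss_kernel TYPE('l) y) \<partial>lborel)"
    by (subst nn_integral_weighted_rotation_integrand) (measurable, simp only: haar_average_gauss_weight nn_integral_gauss_kernel)
  also have "\<dots> < \<infinity>"
    by (rule nn_integral_Lp_gauss_kernel_finite[OF _ _ p(1) p' fin]) auto
  finally have "AE z in lborel. gauss_weight TYPE('k + 'l) (z :: real^'m^'l) * (\<integral>\<^sup>+p. rotation_integrand ?h z x p \<partial>(haar \<Otimes>\<^sub>M lborel)) \<noteq> \<infinity>"
    by (intro nn_integral_noteq_infinite) (auto simp: rotation_integrand_def)
  then have fin': "AE z in (lborel :: (real^'m^'l) measure). transpose z ** z \<in> pos_def_matrices \<longrightarrow> G ?h (transpose z ** z) \<noteq> \<infinity>"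
  proof eventually_elim
    case (elim z)
    then show ?case using gauss_weight_pos[of z, where 'n="'k + 'l"] by (auto simp: G[symmetric] ennreal_mult_eq_top_iff)
  qed
  \<comment> \<open>With weight 1 the rotation average is 1, and the double integral is the volume
    of a translate of \<open>N\<close>.\<close>
  have "(\<integral>\<^sup>+z. 1 * (\<integral>\<^sup>+p. rotation_integrand (indicator N) (z :: real^'m^'l) x p \<partial>(haar \<Otimes>\<^sub>M lborel)) \<partial>lborel)
     = (\<integral>\<^sup>+y. indicator N (x + y) \<partial>lborel)"
    by (subst nn_integral_weighted_rotation_integrand) simp_all
  also have "\<dots> = 0"
    using nn_integral_lborel_shift[of "indicator N" x] N0 by (simp add: add.commute)
  finally have "AE z in lborel. (\<integral>\<^sup>+p. rotation_integrand (indicator N) (z :: real^'m^'l) x p \<partial>(haar \<Otimes>\<^sub>M lborel)) = 0"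
    by (subst (asm) nn_integral_0_iff_AE) (auto simp: rotation_integrand_def)
  then have null: "AE z in (lborel :: (real^'m^'l) measure). transpose z ** z \<in> pos_def_matrices \<longrightarrow> G (indicator N) (transpose z ** z) = 0"
    by eventually_elim (simp add: G[symmetric])
  have "AE s in sym_lborel. s \<in> pos_def_matrices \<longrightarrow> G ?h s \<noteq> \<infinity> \<and> G (indicator N) s = 0"
  proof (rule AE_sym_lborel_gram[OF ml])
    show "{s. G ?h s \<noteq> \<infinity> \<and> G (indicator N) s = 0} \<in> sets borel" by measurable
    show "AE z in (lborel :: (real^'m^'l) measure). transpose z ** z \<in> pos_def_matrices \<longrightarrow>
        G ?h (transpose z ** z) \<noteq> \<infinity> \<and> G (indicator N) (transpose z ** z) = 0"
      using fin' null by eventually_elim auto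
  qed
  then show ?thesis
  proof eventually_elim
    case (elim s)
    show ?case
    proof (intro impI allI conjI)
      fix z :: "real^'m^'l" assume s: "s \<in> pos_def_matrices" and z: "transpose z ** z = s"
      have "(\<integral>\<^sup>+p. rotation_integrand ?h z x p \<partial>(haar \<Otimes>\<^sub>M lborel)) < \<infinity>"
        using elim s z by (simp add: G less_top)
      then show "integrable (haar \<Otimes>\<^sub>M lborel) (rotation_integrand f0 z x)"
        unfolding integrable_iff_bounded by (simp add: rotation_integrand_def case_prod_beta)
      show "(\<integral>\<^sup>+p. rotation_integrand (indicator N) z x p \<partial>(haar \<Otimes>\<^sub>M lborel)) = 0"
        using elim s z by (simp add: G)
    qed
  qed
qed

theorem lemma0p7:
  fixes f :: "real^'m^('k::finite + 'l::finite) \<Rightarrow> complex"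
    and x :: "real^'m^('k + 'l)"
    and p :: real
  assumes "CARD('m) \<le> CARD('l)"
    and "1 \<le> p"
    and "p < (real CARD('k + 'l) + real CARD('m) - 1) / (real CARD('k) + real CARD('m) - 1)"
    and "f \<in> borel_measurable lebesgue"
    and "integrable lebesgue (\<lambda>a. norm (f a) powr p)"
  shows
    "(AE s in sym_lebesgue. s \<in> pos_def_matrices \<longrightarrow>
        frac_mean_converges TYPE('k) f x s \<and>
        (\<forall>z :: real^'m^'l. transpose z ** z = s \<longrightarrow>
           dual_radon_converges f z x \<and>
           shifted_dual (radon f) z x =
             pi powr (real CARD('k) * real CARD('m) / 2) *\<^sub>R
               frac_integral TYPE('k) (sph_mean f x) s)) \<and>
     (f \<in> borel_measurable borel \<longrightarrow>
        (\<forall>s\<in>pos_def_matrices. \<forall>z :: real^'m^'l. transpose z ** z = s \<longrightarrow>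
           (dual_radon_converges f z x \<longleftrightarrow> frac_mean_converges TYPE('k) f x s) \<and>
           (frac_mean_converges TYPE('k) f x s \<longrightarrow>
              shifted_dual (radon f) z x =
                pi powr (real CARD('k) * real CARD('m) / 2) *\<^sub>R
                  frac_integral TYPE('k) (sph_mean f x) s)))"
proof (rule conjI)
  note ml = assms(1)
  obtain f0 where f0: "f0 \<in> borel_measurable borel" and ae: "AE a in lborel. f a = f0 a"
    using lebesgue_borel_representative[OF assms(4)] .
  obtain N where N: "{a \<in> space lborel. f a \<noteq> f0 a} \<subseteq> N" "emeasure lborel N = 0" "N \<in> sets lborel"
    using AE_E[OF ae] .
  then have null: "N \<in> null_sets lborel" and N_borel: "N \<in> sets borel" by (auto simp: null_sets_def)
  have eq: "\<forall>a. a \<notin> N \<longrightarrow> f a = f0 a" using N(1) by auto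
  \<comment> \<open>The L^p bound passes from \<open>f\<close> to its representative, since
    completion does not change the integral.\<close>
  have "(\<integral>\<^sup>+a. ennreal (norm (f0 a) powr p) \<partial>lborel) = (\<integral>\<^sup>+a. ennreal (norm (f a) powr p) \<partial>lebesgue)"
  proof -
    have "(\<integral>\<^sup>+a. ennreal (norm (f0 a) powr p) \<partial>lborel) = (\<integral>\<^sup>+a. ennreal (norm (f0 a) powr p) \<partial>lebesgue)"
      by (rule nn_integral_completion[symmetric])
    also have "\<dots> = (\<integral>\<^sup>+a. ennreal (norm (f a) powr p) \<partial>lebesgue)"
      by (rule nn_integral_cong_AE) (use ae in \<open>auto simp: AE_completion_iff elim: eventually_mono\<close>)
    finally show ?thesis .
  qed
  also have "\<dots> < \<infinity>"
    using assms(5) by (simp add: integrable_iff_bounded)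
  finally have fin: "(\<integral>\<^sup>+a. ennreal (norm (f0 a) powr p) \<partial>lborel) < \<infinity>" .
  have "AE s in sym_lborel. s \<in> pos_def_matrices \<longrightarrow> (\<forall>z :: real^'m^'l. transpose z ** z = s \<longrightarrow>
     integrable (haar \<Otimes>\<^sub>M lborel) (rotation_integrand f0 z x) \<and>
     (\<integral>\<^sup>+p. rotation_integrand (indicator N) z x p \<partial>(haar \<Otimes>\<^sub>M lborel)) = 0)"
    by (rule AE_sym_integrable_rotation_integrand[OF ml assms(2,3) f0 fin null])
  then show "AE s in sym_lebesgue. s \<in> pos_def_matrices \<longrightarrow>
        frac_mean_converges TYPE('k) f x s \<and>
        (\<forall>z :: real^'m^'l. transpose z ** z = s \<longrightarrow>
           dual_radon_converges f z x \<and>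
           shifted_dual (radon f) z x =
             pi powr (real CARD('k) * real CARD('m) / 2) *\<^sub>R
               frac_integral TYPE('k) (sph_mean f x) s)"
    unfolding sym_lebesgue_eq AE_completion_iff
  proof eventually_elim
    case (elim s)
    show ?case
    proof (rule impI)
      assume s: "s \<in> pos_def_matrices"
      have good: "frac_mean_converges TYPE('k) f x s \<and> dual_radon_converges f z x \<and>
           shifted_dual (radon f) z x = pi powr (real CARD('k) * real CARD('m) / 2) *\<^sub>R frac_integral TYPE('k) (sph_mean f x) s"
        if z: "transpose z ** z = s" for z :: "real^'m^'l"
      proof -
        have zs: "transpose z ** z \<in> pos_def_matrices" using s z by simp
        have int: "integrable (haar \<Otimes>\<^sub>M lborel) (rotation_integrand f0 z x)"
          and zero: "(\<integral>\<^sup>+p. rotation_integrand (indicator N) z x p \<partial>(haar \<Otimes>\<^sub>M lborel)) = 0"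
          using elim s z by blast+
        note transfer = null_set_transfer[OF f0 N_borel eq zs zero]
        show ?thesis
          using int unfolding z[symmetric] transfer
          by (simp add: frac_mean_converges_product[OF f0 zs] dual_radon_converges_iff[OF f0]
              shifted_dual_radon_eq[OF f0] frac_integral_product[OF f0 zs])
      qed
      \<comment> \<open>Convergence of the fractional integral is a claim about \<open>s\<close>
        alone, so some \<open>z\<close> has to be exhibited for it.\<close>
      obtain z :: "real^'m^'l" where "transpose z ** z = s" using gram_surjective[OF ml s] .
      then show "frac_mean_converges TYPE('k) f x s \<and>
        (\<forall>z :: real^'m^'l. transpose z ** z = s \<longrightarrow>
           dual_radon_converges f z x \<and>
           shifted_dual (radon f) z x =
             pi powr (real CARD('k) * real CARD('m) / 2) *\<^sub>R
               frac_integral TYPE('k) (sph_mean f x) s)"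
        using good by blast
    qed
  qed
next
  show "f \<in> borel_measurable borel \<longrightarrow>
        (\<forall>s\<in>pos_def_matrices. \<forall>z :: real^'m^'l. transpose z ** z = s \<longrightarrow>
           (dual_radon_converges f z x \<longleftrightarrow> frac_mean_converges TYPE('k) f x s) \<and>
           (frac_mean_converges TYPE('k) f x s \<longrightarrow>
              shifted_dual (radon f) z x =
                pi powr (real CARD('k) * real CARD('m) / 2) *\<^sub>R
                  frac_integral TYPE('k) (sph_mean f x) s))"
  proof (intro impI ballI allI)
    fix s and z :: "real^'m^'l"
    assume f: "f \<in> borel_measurable borel" and "s \<in> pos_def_matrices" and z: "transpose z ** z = s"
    then have zs: "transpose z ** z \<in> pos_def_matrices" by simp
    show "(dual_radon_converges f z x \<longleftrightarrow> frac_mean_converges TYPE('k) f x s) \<and>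
           (frac_mean_converges TYPE('k) f x s \<longrightarrow>
              shifted_dual (radon f) z x =
                pi powr (real CARD('k) * real CARD('m) / 2) *\<^sub>R
                  frac_integral TYPE('k) (sph_mean f x) s)"
      \<comment> \<open>For Borel \<open>f\<close> both convergence conditions are equivalent to
        integrability of \<open>rotation_integrand f z x\<close>, and under it both sides equal its
        integral.\<close>
      unfolding z[symmetric]
      by (auto simp: frac_mean_converges_product[OF f zs] dual_radon_converges_iff[OF f]
          shifted_dual_radon_eq[OF f] frac_integral_product[OF f zs])
  qed
qed

end
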